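(* Let $s\in(0,1)$, $N\ge 2$, $\gamma>0$, let $\Omega\subset\mathbb{R}^N$ be a bounded open set with Lipschitz boundary, and let $f\in L^p(\Omega)$ with $p\ge 2_s^\ast=\frac{2N}{N-2s}$ and $f\ge 0$. If $u\in X_0^s(\Omega)$ is the weak solution to $$(-\Delta)^s u=\frac{f(x)}{u^\gamma}\ \text{ in }\Omega,\qquad u>0\ \text{ in }\Omega,\qquad u=0\ \text{ on }\mathbb{R}^N\setminus\Omega,$$ then the following hold. 1. If $p<\frac{N}{2s}$, then $u\in L^q(\Omega)$ with $q=\frac{Np(\gamma+1)}{N-2sp}$, and there exists a positive constant $C$ such that $\|u\|_{L^q(\Omega)}\le C\,\|f\|_{L^p(\Omega)}^{1/(\gamma+1)}$. 2. If $p=\frac{N}{2s}$, then $u\in L_\Phi(\Omega)$, where $L_\Phi(\Omega)$ is the Orlicz space generated by the $N$-function $\Phi(t)=\exp\left(|t|^{(\gamma+1)p'}\right)-1$, with $p'=\frac{p}{p-1}$, and there exists a positive constant $C$ such that $\|u\|_{L_\Phi(\Omega)}\le C\,\|f\|_{L^p(\Omega)}^{1/(\gamma+1)}$. 3. If $p>\frac{N}{2s}$, then $u\in L^\infty(\Omega)$ and there exists a positive constant $C$ such that $\|u\|_{L^\infty(\Omega)}\le C\,\|f\|_{L^p(\Omega)}^{1/(\gamma+1)}$.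
   Context: Function spaces. For an open set $D\subset\mathbb{R}^N$, $[u]_{H^s(D)}=\left(\iint_{D\times D}\frac{|u(x)-u(y)|^2}{|x-y|^{N+2s}}\,dx\,dy\right)^{1/2}$ and $H^s(D)=\{u\in L^2(D): [u]_{H^s(D)}<\infty\}$. $H^s_{\mathrm{loc}}(\Omega)$ is the set of $u:\Omega\to\mathbb{R}$ with $u|_K\in H^s(K)$ for all $K\subset\subset\Omega$. $X_0^s(\Omega)=\{u\in H^s(\mathbb{R}^N): u=0 \text{ a.e. in }\mathbb{R}^N\setminus\Omega\}$. The fractional Laplacian is $(-\Delta)^s u(x)=C_{N,s}\,\mathrm{P.V.}\int_{\mathbb{R}^N}\frac{u(x)-u(y)}{|x-y|^{N+2s}}\,dy$ with $C_{N,s}=\frac{s\,2^{2s}\,\Gamma\left(\frac{N+2s}{2}\right)}{\pi^{N/2}\,\Gamma(1-s)}$, understood in the weak sense below. Weak solution. A positive function $u\in H^s_{\mathrm{loc}}(\Omega)\cap L^1(\Omega)$ (extended by $0$ outside $\Omega$) is a weak solution to $(-\Delta)^s u=f/u^\gamma$ in $\Omega$, $u>0$ in $\Omega$, $u=0$ on $\mathbb{R}^N\setminus\Omega$, if $u^{\max\{\frac{\gamma+1}{2},1\}}\in X_0^s(\Omega)$, $\frac{f}{u^\gamma}\in L^1_{\mathrm{loc}}(\Omega)$, and for every nonnegative $\varphi\in C_c^\infty(\Omega)$ $$\frac{C_{N,s}}{2}\iint_{\mathbb{R}^{2N}}\frac{(u(x)-u(y))(\varphi(x)-\varphi(y))}{|x-y|^{N+2s}}\,dx\,dy=\int_\Omega\frac{f(x)}{u(x)^\gamma}\varphi(x)\,dx.$$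 $L_\Phi(\Omega)$ carries the Luxemburg norm $\|u\|_{L_\Phi(\Omega)}=\inf\{\lambda>0:\int_\Omega\Phi(u/\lambda)\,dx\le 1\}$. *)

theory Defs
  imports "HOL-Analysis.Analysis" "HOL-Probability.Essential_Supremum"
begin

text \<open>
  Functions on $\Omega$ are represented by total functions \<open>real ^ 'n \<Rightarrow> real\<close>, and elements of the
  function spaces by arbitrary Lebesgue measurable representatives: pointwise (in)equalities
  between them are read almost everywhere.
\<close>

definition has_lipschitz_boundary :: "(real ^ 'n) set \<Rightarrow> bool" where
  "has_lipschitz_boundary \<Omega> \<longleftrightarrow>
     (\<forall>x\<in>frontier \<Omega>. \<exists>r \<nu> L g. r > 0 \<and> norm \<nu> = 1 \<and> L-lipschitz_on {y. y \<bullet> \<nu> = 0} g \<and>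
        \<Omega> \<inter> ball x r = {y \<in> ball x r. g (y - (y \<bullet> \<nu>) *\<^sub>R \<nu>) < y \<bullet> \<nu>})"


text \<open>The exponent is an extended real; only $1 \le p \le \infty$ is meaningful.\<close>

definition Lp_space :: "ereal \<Rightarrow> (real ^ 'n) set \<Rightarrow> (real ^ 'n \<Rightarrow> real) set" where
  "Lp_space p D = {u. u \<in> borel_measurable (lebesgue_on D) \<and>
     (if p = \<infinity> then esssup (lebesgue_on D) (\<lambda>x. ennreal \<bar>u x\<bar>) < \<infinity>
      else integrable (lebesgue_on D) (\<lambda>x. \<bar>u x\<bar> powr real_of_ereal p))}"

definition Lp_norm :: "ereal \<Rightarrow> (real ^ 'n) set \<Rightarrow> (real ^ 'n \<Rightarrow> real) \<Rightarrow> real" where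
  "Lp_norm p D u =
     (if p = \<infinity> then enn2real (esssup (lebesgue_on D) (\<lambda>x. ennreal \<bar>u x\<bar>))
      else (\<integral>x. \<bar>u x\<bar> powr real_of_ereal p \<partial>lebesgue_on D) powr (1 / real_of_ereal p))"

definition L1_loc :: "(real ^ 'n) set \<Rightarrow> (real ^ 'n \<Rightarrow> real) set" where
  "L1_loc D = {u. \<forall>K. compact K \<and> K \<subseteq> D \<longrightarrow> u \<in> Lp_space 1 K}"


text \<open>The square of the Gagliardo seminorm $[u]_{H^s(D)}$.\<close>

definition gagliardo_energy :: "real \<Rightarrow> (real ^ 'n) set \<Rightarrow> (real ^ 'n \<Rightarrow> real) \<Rightarrow> ennreal" where
  "gagliardo_energy s D u =
     (\<integral>\<^sup>+(x, y). ennreal (\<bar>u x - u y\<bar>\<^sup>2 / norm (x - y) powr (real CARD('n) + 2 * s))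
        \<partial>(lebesgue_on D \<Otimes>\<^sub>M lebesgue_on D))"

definition Hs :: "real \<Rightarrow> (real ^ 'n) set \<Rightarrow> (real ^ 'n \<Rightarrow> real) set" where
  "Hs s D = {u. u \<in> Lp_space 2 D \<and> gagliardo_energy s D u < \<infinity>}"

definition Hs_loc :: "real \<Rightarrow> (real ^ 'n) set \<Rightarrow> (real ^ 'n \<Rightarrow> real) set" where
  "Hs_loc s \<Omega> = {u. \<forall>K. open K \<and> compact (closure K) \<and> closure K \<subseteq> \<Omega> \<longrightarrow> u \<in> Hs s K}"

definition X0 :: "real \<Rightarrow> (real ^ 'n) set \<Rightarrow> (real ^ 'n \<Rightarrow> real) set" where
  "X0 s \<Omega> = {u. u \<in> Hs s UNIV \<and> (AE x in lebesgue. x \<notin> \<Omega> \<longrightarrow> u x = 0)}"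


text \<open>\<open>Ck k f\<close>: $f$ is of class $C^k$ on the whole space.\<close>

primrec Ck :: "nat \<Rightarrow> (real ^ 'n \<Rightarrow> real) \<Rightarrow> bool" where
  "Ck 0 f \<longleftrightarrow> continuous_on UNIV f"
| "Ck (Suc k) f \<longleftrightarrow> f differentiable_on UNIV \<and>
     (\<forall>i. Ck k (\<lambda>x. frechet_derivative f (at x) (axis i 1)))"

definition test_functions :: "(real ^ 'n) set \<Rightarrow> (real ^ 'n \<Rightarrow> real) set" where
  "test_functions \<Omega> = {\<phi>. (\<forall>k. Ck k \<phi>) \<and>
     compact (closure {x. \<phi> x \<noteq> 0}) \<and> closure {x. \<phi> x \<noteq> 0} \<subseteq> \<Omega>}"


definition frac_laplace_const :: "nat \<Rightarrow> real \<Rightarrow> real" where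
  "frac_laplace_const N s =
     s * 2 powr (2 * s) * Gamma ((real N + 2 * s) / 2) / (pi powr (real N / 2) * Gamma (1 - s))"

text \<open>
  Weak solutions of $(-\Delta)^s u = f / u^\gamma$ in $\Omega$ with $u > 0$ in $\Omega$ and $u = 0$
  outside $\Omega$. Both integrals of the weak formulation converge absolutely: the left-hand one
  since $u$ is in $H^s_{loc}(\Omega) \cap L^1(\Omega)$ and vanishes outside $\Omega$, the right-hand
  one since $f / u^\gamma$ is in $L^1_{loc}(\Omega)$.
\<close>

definition weak_solution ::
  "real \<Rightarrow> real \<Rightarrow> (real ^ 'n \<Rightarrow> real) \<Rightarrow> (real ^ 'n) set \<Rightarrow> (real ^ 'n \<Rightarrow> real) \<Rightarrow> bool" where
  "weak_solution s \<gamma> f \<Omega> u \<longleftrightarrow>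
     u \<in> Hs_loc s \<Omega> \<and> u \<in> Lp_space 1 \<Omega> \<and>
     (AE x in lebesgue. x \<in> \<Omega> \<longrightarrow> u x > 0) \<and>
     (AE x in lebesgue. x \<notin> \<Omega> \<longrightarrow> u x = 0) \<and>
     (\<lambda>x. u x powr max ((\<gamma> + 1) / 2) 1) \<in> X0 s \<Omega> \<and>
     (\<lambda>x. f x / u x powr \<gamma>) \<in> L1_loc \<Omega> \<and>
     (\<forall>\<phi>\<in>test_functions \<Omega>. (\<forall>x. \<phi> x \<ge> 0) \<longrightarrow>
        frac_laplace_const CARD('n) s / 2 *
          (\<integral>(x, y). (u x - u y) * (\<phi> x - \<phi> y) / norm (x - y) powr (real CARD('n) + 2 * s)
             \<partial>(lebesgue \<Otimes>\<^sub>M lebesgue))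
        = (\<integral>x. f x / u x powr \<gamma> * \<phi> x \<partial>lebesgue_on \<Omega>))"


text \<open>
  The Orlicz space is the linear span of the Orlicz class of \<open>\<Phi>\<close>, for an N-function \<open>\<Phi>\<close>.
  On this space the set in the Luxemburg norm is nonempty.
\<close>

definition orlicz_space :: "(real \<Rightarrow> real) \<Rightarrow> (real ^ 'n) set \<Rightarrow> (real ^ 'n \<Rightarrow> real) set" where
  "orlicz_space \<Phi> D = {u. u \<in> borel_measurable (lebesgue_on D) \<and>
     (\<exists>k>0. (\<integral>\<^sup>+x. ennreal (\<Phi> (u x / k)) \<partial>lebesgue_on D) < \<infinity>)}"

definition luxemburg_norm :: "(real \<Rightarrow> real) \<Rightarrow> (real ^ 'n) set \<Rightarrow> (real ^ 'n \<Rightarrow> real) \<Rightarrow> real" where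
  "luxemburg_norm \<Phi> D u =
     Inf {k. k > 0 \<and> (\<integral>\<^sup>+x. ennreal (\<Phi> (u x / k)) \<partial>lebesgue_on D) \<le> 1}"

end

theory Submission
  imports Defs
begin

text \<open>
  The proof is a nonlocal De Giorgi argument along dyadic quantiles of $u$. For levels
  $0 < k < l$ put $T = \min((u-k)^+, l-k)$. Truncation decreases the form, so that testing the
  equation with $T$ bounds the energy of $T$ by $C\, k^{-\gamma} (l-k) \int_{u>k} f$: the singular
  factor $u^{-\gamma}$ is at most $k^{-\gamma}$ wherever $T$ does not vanish. On the other hand
  every point of $\{u \ge l\}$ sees the difference $l-k$ against every point outside $\{u > k\}$,
  and outside a set of measure $\mu$ the kernel $|x-y|^{-N-2s}$ still has mass at least
  $c\, \mu^{-2s/N}$ (\<open>gform_lower_bound\<close>). Together (\<open>level_estimate\<close>), if $|\{u > k\}| \le \mu$,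
  \[ (l-k)\, k^\gamma\, |\{u \ge l\}| \le C \mu^{2s/N} \int_{u>k} f . \]

  Let $t_j$ be the quantile with $|\{u > t_j\}| \le \mu_j$ and, if $t_j > 0$, also
  $|\{u \ge t_j\}| \ge \mu_j$, where $\mu_j = 2^{-j} M$ and $M \ge |\Omega|$. Applied between consecutive quantiles, the estimate
  gives a recursion for $v_j = t_j^{\gamma+1}$ (\<open>quantile_increment\<close>):
  \[ v_{j+1} - v_j \le C \mu_j^{2s/N-1} \int_{u > t_j} f . \]
  By Hoelder's inequality the integral is at most a multiple of $\|f\|_p\, \mu_j^{1-1/p}$, so the
  increments are of order $\mu_j^{2s/N-1/p}$, and the sign of $2s/N - 1/p$ separates the three cases.
  If it is positive, the increments are summable and $u$ is bounded. If it is zero or negative, one keeps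
  track of how $\|f\|_p^p$ is distributed over the shells $\{t_j < u \le t_{j+1}\}$: this yields
  $v_n \le C n^{1-1/p} \|f\|_p$ in the critical case, which is exponential integrability since
  $|\{u > t_n\}| \le 2^{-n} M$, and an $\ell^q$ bound for $2^{-n/q} v_n$ with
  $1/q = 1/p - 2s/N$ in the subcritical one. Because it is $u^{\gamma+1}$ that is estimated
  linearly by $f$, the power $1/(\gamma+1)$ of $\|f\|_p$ appears.

  What remains is to justify $T$ as a test function, since the weak formulation only allows smooth
  functions with compact support in $\Omega$. This is where the Lipschitz boundary enters
  (\<open>tested_chart\<close>). Locally, a function vanishing outside $\Omega$ is pushed into $\Omega$ by a small
  translation, which is a small perturbation in energy. Replacing the translate by its minimum
  with the original function keeps it below that function, so the right-hand side of the equation,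
  whose integrability near the boundary is unknown, does not increase in the limit. The resulting
  inequality for $T$ is all that is used. The minimum has compact support in $\Omega$, and for such
  functions mollification gives the equation itself (\<open>weak_compact_support\<close>).
\<close>

section \<open>Continuity of translations in the space of integrable functions\<close>

lemma distr_lborel_shift: "distr lborel borel (\<lambda>x. x + z) = (lborel :: 'a::euclidean_space measure)"
proof -
  have "(\<lambda>x. x + z) = (+) z" by (auto simp: fun_eq_iff add.commute)
  then show ?thesis using lborel_distr_plus[of z] by simp
qed

lemma nn_integral_lborel_shift:
  fixes f :: "'a::euclidean_space \<Rightarrow> ennreal"
  assumes [measurable]: "f \<in> borel_measurable borel"
  shows "(\<integral>\<^sup>+x. f (x + z) \<partial>lborel) = (\<integral>\<^sup>+x. f x \<partial>lborel)"
proof -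
  have "(\<integral>\<^sup>+x. f x \<partial>lborel) = (\<integral>\<^sup>+x. f x \<partial>distr lborel borel (\<lambda>x. x + z))"
    by (simp add: distr_lborel_shift)
  also have "\<dots> = (\<integral>\<^sup>+x. f (x + z) \<partial>lborel)"
    by (subst nn_integral_distr) auto
  finally show ?thesis by simp
qed

lemma
  fixes f :: "'a::euclidean_space \<Rightarrow> real"
  assumes f: "integrable lborel f"
  shows integrable_lborel_shift: "integrable lborel (\<lambda>x. f (x + z))"
    and integral_lborel_shift: "(\<integral>x. f (x + z) \<partial>lborel) = (\<integral>x. f x \<partial>lborel)"
proof -
  have [measurable]: "f \<in> borel_measurable borel"
    using borel_measurable_integrable[OF f] by simp
  show "integrable lborel (\<lambda>x. f (x + z))"
    using f integrable_distr_eq[of "\<lambda>x. x + z" lborel borel f] by (simp add: distr_lborel_shift)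
  show "(\<integral>x. f (x + z) \<partial>lborel) = (\<integral>x. f x \<partial>lborel)"
    using integral_distr[of "\<lambda>x. x + z" lborel borel f] by (simp add: distr_lborel_shift)
qed

text \<open>
  The set is enclosed in an open set of almost the same measure, whose points stay inside under
  small translations. The integral of $1_A(x+z) - 1_A(x)$ vanishes, so only the part where this
  difference is negative has to be controlled.
\<close>

lemma tendsto_shift_indicator:
  fixes A :: "'a::euclidean_space set"
  assumes A: "A \<in> sets borel" "emeasure lborel A < \<infinity>" and z: "z \<longlonglongrightarrow> 0"
  shows "(\<lambda>n. \<integral>x. \<bar>indicator A (x + z n) - indicator A x\<bar> \<partial>lborel) \<longlonglongrightarrow> (0::real)"
proof (rule LIMSEQ_I)
  fix e :: real assume "e > 0"
  obtain U where U: "open U" "A \<subseteq> U" "emeasure lborel (U - A) < ennreal (e / 4)"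
    using outer_regular_lborel[OF A(1), of "e / 4"] \<open>e > 0\<close> by auto
  have [measurable]: "A \<in> sets borel" "U \<in> sets borel" using A U by auto
  let ?a = "\<lambda>x. indicator A x :: real"
  let ?r = "\<lambda>n x. indicator {x \<in> A. x + z n \<notin> U} x :: real"
  let ?d = "\<lambda>x. indicator (U - A) x :: real"
  have ia: "integrable lborel ?a" using A by (simp add: integrable_indicator_iff)
  have id: "integrable lborel ?d"
    using U(3) by (auto simp: integrable_indicator_iff intro: order.strict_trans)
  have "(\<lambda>n. \<integral>x. ?r n x \<partial>lborel) \<longlonglongrightarrow> (\<integral>x. 0 \<partial>(lborel :: 'a measure))"
  proof (rule integral_dominated_convergence[where w = ?a])
    show "AE x in lborel. (\<lambda>n. ?r n x) \<longlonglongrightarrow> 0"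
    proof (rule AE_I2)
      fix x :: 'a
      show "(\<lambda>n. ?r n x) \<longlonglongrightarrow> 0"
      proof (cases "x \<in> A")
        case True
        have "(\<lambda>n. x + z n) \<longlonglongrightarrow> x + 0" by (intro tendsto_intros z)
        then have "\<forall>\<^sub>F n in sequentially. x + z n \<in> U"
          using topological_tendstoD[OF _ U(1)] U(2) True by fastforce
        then show ?thesis by (intro tendsto_eventually) (auto elim: eventually_mono)
      qed (auto simp: indicator_def)
    qed
  qed (use ia in \<open>auto simp: indicator_def\<close>)
  then obtain n0 where n0: "\<And>n. n \<ge> n0 \<Longrightarrow> (\<integral>x. ?r n x \<partial>lborel) < e / 4"
    using LIMSEQ_D[of _ 0 "e / 4"] \<open>e > 0\<close> by fastforce
  have dle: "(\<integral>x. ?d x \<partial>lborel) < e / 4"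
  proof -
    have "ennreal (\<integral>x. ?d x \<partial>lborel) = emeasure lborel (U - A)"
      by (subst nn_integral_eq_integral[symmetric]) (auto simp: id nn_integral_indicator ennreal_indicator)
    then have "ennreal (\<integral>x. ?d x \<partial>lborel) < ennreal (e / 4)" using U(3) by simp
    then show ?thesis by (subst (asm) ennreal_less_iff) (auto intro!: integral_nonneg)
  qed
  show "\<exists>no. \<forall>n\<ge>no. norm ((\<integral>x. \<bar>?a (x + z n) - ?a x\<bar> \<partial>lborel) - 0) < e"
  proof (intro exI[of _ n0] allI impI)
    fix n assume "n \<ge> n0"
    have ias: "integrable lborel (\<lambda>x. ?a (x + z n))"
      using integrable_lborel_shift[OF ia] by simp
    have ir: "integrable lborel (?r n)"
      by (rule Bochner_Integration.integrable_bound[OF ia]) (auto simp: indicator_def)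
    have ids: "integrable lborel (\<lambda>x. ?d (x + z n))"
      using integrable_lborel_shift[OF id] by simp
    \<comment> \<open>The signed part has integral zero; leaving \<open>A\<close> means leaving \<open>U\<close> or landing in \<open>U - A\<close>.\<close>
    have "(\<integral>x. \<bar>?a (x + z n) - ?a x\<bar> \<partial>lborel)
       \<le> (\<integral>x. (?a (x + z n) - ?a x) + 2 * (?r n x + ?d (x + z n)) \<partial>lborel)"
      using U(2) by (intro integral_mono Bochner_Integration.integrable_abs Bochner_Integration.integrable_diff
          Bochner_Integration.integrable_add integrable_mult_right ia ias ir ids)
        (auto simp: indicator_def)
    also have "\<dots> = 2 * ((\<integral>x. ?r n x \<partial>lborel) + (\<integral>x. ?d x \<partial>lborel))"
      using ia ias ir ids integral_lborel_shift[OF ia, of "z n"] integral_lborel_shift[OF id, of "z n"]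
      by simp
    also have "\<dots> < e" using n0[OF \<open>n \<ge> n0\<close>] dle by simp
    finally show "norm ((\<integral>x. \<bar>?a (x + z n) - ?a x\<bar> \<partial>lborel) - 0) < e"
      by (simp add: abs_of_nonneg integral_nonneg)
  qed
qed

text \<open>
  Approximation by simple functions, since translations are isometries.
\<close>

lemma tendsto_shift_L1:
  fixes f :: "'a::euclidean_space \<Rightarrow> real"
  assumes "integrable lborel f" and z: "z \<longlonglongrightarrow> 0"
  shows "(\<lambda>n. \<integral>x. \<bar>f (x + z n) - f x\<bar> \<partial>lborel) \<longlonglongrightarrow> 0"
  using assms(1)
proof (induct f)
  case (base A c)
  have "(\<lambda>n. \<bar>c\<bar> * (\<integral>x. \<bar>indicator A (x + z n) - indicator A x\<bar> \<partial>lborel)) \<longlonglongrightarrow> \<bar>c\<bar> * 0"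
    using base by (intro tendsto_intros tendsto_shift_indicator z) auto
  moreover have "\<bar>c * indicat_real A (x + z n) - c * indicat_real A x\<bar>
      = \<bar>c\<bar> * \<bar>indicat_real A (x + z n) - indicat_real A x\<bar>" for x n
    by (simp flip: right_diff_distrib add: abs_mult)
  ultimately show ?case by (simp add: mult.commute[of _ c])
next
  case (add f g)
  show ?case
  proof (rule tendsto_sandwich[OF _ _ tendsto_const tendsto_add_zero[OF add(2,4)]])
    show "\<forall>\<^sub>F n in sequentially. (\<integral>x. \<bar>f (x + z n) + g (x + z n) - (f x + g x)\<bar> \<partial>lborel)
      \<le> (\<integral>x. \<bar>f (x + z n) - f x\<bar> \<partial>lborel) + (\<integral>x. \<bar>g (x + z n) - g x\<bar> \<partial>lborel)"
      using add(1,3)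
      by (intro always_eventually allI)
        (subst Bochner_Integration.integral_add[symmetric],
          auto intro!: integral_mono Bochner_Integration.integrable_abs integrable_lborel_shift)
  qed (auto intro!: always_eventually integral_nonneg)
next
  case (lim f s)
  show ?case
  proof (rule LIMSEQ_I)
    fix e :: real assume "e > 0"
    have "(\<lambda>i. \<integral>x. \<bar>s i x - f x\<bar> \<partial>lborel) \<longlonglongrightarrow> (\<integral>x. 0 \<partial>(lborel :: 'a measure))"
    proof (rule integral_dominated_convergence[where w = "\<lambda>x. 3 * \<bar>f x\<bar>"])
      show "AE x in lborel. (\<lambda>i. \<bar>s i x - f x\<bar>) \<longlonglongrightarrow> 0"
        using lim(3) by (intro AE_I2 tendsto_rabs_zero LIM_zero) auto
      show "AE x in lborel. norm \<bar>s i x - f x\<bar> \<le> 3 * \<bar>f x\<bar>" for i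
        using lim(4)[of _ i] by (intro AE_I2) (force intro: order_trans[OF abs_triangle_ineq4])
    qed (use lim(1,5) in auto)
    then obtain i where i: "(\<integral>x. \<bar>s i x - f x\<bar> \<partial>lborel) < e / 3"
      using LIMSEQ_D[of _ 0 "e / 3"] \<open>e > 0\<close> by fastforce
    obtain n0 where n0: "\<And>n. n \<ge> n0 \<Longrightarrow> (\<integral>x. \<bar>s i (x + z n) - s i x\<bar> \<partial>lborel) < e / 3"
      using LIMSEQ_D[OF lim(2)[of i], of "e / 3"] \<open>e > 0\<close> by fastforce
    show "\<exists>no. \<forall>n\<ge>no. norm ((\<integral>x. \<bar>f (x + z n) - f x\<bar> \<partial>lborel) - 0) < e"
    proof (intro exI[of _ n0] allI impI)
      fix n assume "n \<ge> n0"
      let ?d = "\<lambda>x. \<bar>s i x - f x\<bar>"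
      have d: "integrable lborel ?d" "integrable lborel (\<lambda>x. \<bar>s i (x + z n) - f (x + z n)\<bar>)"
        using integrable_lborel_shift[OF lim(1)] integrable_lborel_shift[OF lim(5)] lim(1,5) by auto
      have e: "integrable lborel (\<lambda>x. \<bar>s i (x + z n) - s i x\<bar>)"
        using integrable_lborel_shift[OF lim(1)] lim(1,5) by auto
      have "(\<integral>x. \<bar>f (x + z n) - f x\<bar> \<partial>lborel)
        \<le> (\<integral>x. ?d (x + z n) + \<bar>s i (x + z n) - s i x\<bar> + ?d x \<partial>lborel)"
        using d e lim(5) integrable_lborel_shift[OF lim(5)] by (intro integral_mono) auto
      also have "\<dots> = (\<integral>x. ?d x \<partial>lborel) + (\<integral>x. \<bar>s i (x + z n) - s i x\<bar> \<partial>lborel) + (\<integral>x. ?d x \<partial>lborel)"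
        using d e integral_lborel_shift[OF d(1), of "z n"] by simp
      also have "\<dots> < e" using i n0[OF \<open>n \<ge> n0\<close>] by simp
      finally show "norm ((\<integral>x. \<bar>f (x + z n) - f x\<bar> \<partial>lborel) - 0) < e"
        by (simp add: abs_of_nonneg integral_nonneg)
    qed
  qed
qed

section \<open>The Gagliardo form\<close>

text \<open>
  Half of the exponent $N + 2s$, so that products of two difference quotients are the integrands of
  the Gagliardo form. On the diagonal the value is $0$ because division by zero is.
\<close>

definition diff_quot :: "real \<Rightarrow> ('a::euclidean_space \<Rightarrow> real) \<Rightarrow> 'a \<times> 'a \<Rightarrow> real" where
  "diff_quot s w = (\<lambda>(x, y). (w x - w y) / norm (x - y) powr ((real DIM('a) + 2 * s) / 2))"

definition finite_energy :: "real \<Rightarrow> ('a::euclidean_space \<Rightarrow> real) \<Rightarrow> bool" where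
  "finite_energy s w \<longleftrightarrow>
     w \<in> borel_measurable borel \<and> integrable lborel (\<lambda>p. (diff_quot s w p)\<^sup>2)"

text \<open>
  The weak form of the fractional Laplacian, up to the constant $C_{N,s}/2$.
\<close>

definition gform :: "real \<Rightarrow> ('a::euclidean_space \<Rightarrow> real) \<Rightarrow> ('a \<Rightarrow> real) \<Rightarrow> real" where
  "gform s v w = (\<integral>p. diff_quot s v p * diff_quot s w p \<partial>lborel)"

lemma finite_energy_borel: "finite_energy s w \<Longrightarrow> w \<in> borel_measurable borel"
  by (simp add: finite_energy_def)

lemma diff_quot_measurable[measurable]:
  fixes w :: "'a::euclidean_space \<Rightarrow> real"
  assumes [measurable]: "w \<in> borel_measurable borel"
  shows "diff_quot s w \<in> borel_measurable borel"
proof -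
  have "diff_quot s w \<in> borel_measurable (borel \<Otimes>\<^sub>M borel)"
    unfolding diff_quot_def by measurable
  then show ?thesis by (simp add: borel_prod)
qed

lemma diff_quot_diff: "diff_quot s (\<lambda>x. v x - w x) p = diff_quot s v p - diff_quot s w p"
  by (auto simp: diff_quot_def split_beta diff_divide_distrib)

lemma diff_quot_mult:
  fixes v w :: "'a::euclidean_space \<Rightarrow> real"
  shows "diff_quot s v (x, y) * diff_quot s w (x, y)
    = (v x - v y) * (w x - w y) / norm (x - y) powr (real DIM('a) + 2 * s)"
  by (simp add: diff_quot_def flip: powr_add)

lemma diff_quot_square:
  fixes w :: "'a::euclidean_space \<Rightarrow> real"
  shows "(diff_quot s w (x, y))\<^sup>2 = (w x - w y)\<^sup>2 / norm (x - y) powr (real DIM('a) + 2 * s)"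
  by (simp add: power2_eq_square diff_quot_mult)

lemma integrable_diff_quot_mult:
  assumes "finite_energy s v" "finite_energy s w"
  shows "integrable lborel (\<lambda>p. diff_quot s v p * diff_quot s w p)"
proof -
  have [measurable]: "v \<in> borel_measurable borel" "w \<in> borel_measurable borel"
    using assms by (auto simp: finite_energy_def)
  have pt: "\<bar>a * b\<bar> \<le> a\<^sup>2 + b\<^sup>2" for a b :: real
    using sum_squares_bound[of "\<bar>a\<bar>" "\<bar>b\<bar>"] mult_nonneg_nonneg[of "\<bar>a\<bar>" "\<bar>b\<bar>"]
    unfolding abs_mult power2_abs by linarith
  have i: "integrable lborel (\<lambda>p. (diff_quot s v p)\<^sup>2 + (diff_quot s w p)\<^sup>2)"
    using assms by (intro Bochner_Integration.integrable_add) (simp_all add: finite_energy_def)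
  show ?thesis
  proof (rule Bochner_Integration.integrable_bound[OF i])
    show "AE p in lborel. norm (diff_quot s v p * diff_quot s w p)
        \<le> norm ((diff_quot s v p)\<^sup>2 + (diff_quot s w p)\<^sup>2)"
      by (rule AE_I2) (unfold real_norm_def, rule order_trans[OF pt abs_ge_self])
  qed measurable
qed

lemma gform_nonneg: "0 \<le> gform s w w"
  by (simp add: gform_def integral_nonneg)

lemma ennreal_gform:
  assumes "finite_energy s w"
  shows "(\<integral>\<^sup>+p. ennreal ((diff_quot s w p)\<^sup>2) \<partial>lborel) = ennreal (gform s w w)"
  using assms by (simp add: gform_def finite_energy_def nn_integral_eq_integral flip: power2_eq_square)

lemma finite_energyI_nn:
  assumes "w \<in> borel_measurable borel" "(\<integral>\<^sup>+p. ennreal ((diff_quot s w p)\<^sup>2) \<partial>lborel) < \<infinity>"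
  shows "finite_energy s w"
  using assms unfolding finite_energy_def by (auto intro!: integrableI_bounded)

text \<open>
  Truncations, minima and products with cut-offs are operations that control increments pointwise;
  their energies are all estimated through this comparison.
\<close>

lemma finite_energy_dominated:
  fixes w :: "'a::euclidean_space \<Rightarrow> real"
  assumes "w \<in> borel_measurable borel" "finite_energy s v1" "finite_energy s v2" "0 \<le> a" "0 \<le> b"
    and le: "\<And>x y. (w x - w y)\<^sup>2 \<le> a * (v1 x - v1 y)\<^sup>2 + b * (v2 x - v2 y)\<^sup>2"
  shows "finite_energy s w" "gform s w w \<le> a * gform s v1 v1 + b * gform s v2 v2"
proof -
  have pt: "(diff_quot s w p)\<^sup>2 \<le> a * (diff_quot s v1 p)\<^sup>2 + b * (diff_quot s v2 p)\<^sup>2" for p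
  proof (cases p)
    case (Pair x y)
    show ?thesis
      using divide_right_mono[OF le[of x y], of "norm (x - y) powr (real DIM('a) + 2 * s)"]
      by (simp add: Pair diff_quot_square add_divide_distrib)
  qed
  have i: "integrable lborel (\<lambda>p. a * (diff_quot s v1 p)\<^sup>2 + b * (diff_quot s v2 p)\<^sup>2)"
    using assms by (auto simp: finite_energy_def)
  have [measurable]: "w \<in> borel_measurable borel" by fact
  have "integrable lborel (\<lambda>p. (diff_quot s w p)\<^sup>2)"
  proof (rule Bochner_Integration.integrable_bound[OF i])
    show "AE p in lborel. norm ((diff_quot s w p)\<^sup>2)
        \<le> norm (a * (diff_quot s v1 p)\<^sup>2 + b * (diff_quot s v2 p)\<^sup>2)"
      by (rule AE_I2) (unfold real_norm_def abs_power2, rule order_trans[OF pt abs_ge_self])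
  qed measurable
  then show fw: "finite_energy s w"
    using assms(1) by (simp add: finite_energy_def)
  have "(\<integral>p. (diff_quot s w p)\<^sup>2 \<partial>lborel) \<le> (\<integral>p. a * (diff_quot s v1 p)\<^sup>2 + b * (diff_quot s v2 p)\<^sup>2 \<partial>lborel)"
    using i fw pt by (intro integral_mono) (auto simp: finite_energy_def)
  then show "gform s w w \<le> a * gform s v1 v1 + b * gform s v2 v2"
    using assms by (simp add: gform_def finite_energy_def flip: power2_eq_square)
qed

lemma finite_energy_contraction:
  assumes "w \<in> borel_measurable borel" "finite_energy s v" and "\<And>x y. \<bar>w x - w y\<bar> \<le> \<bar>v x - v y\<bar>"
  shows "finite_energy s w" "gform s w w \<le> gform s v v"
  using finite_energy_dominated[OF assms(1,2,2), of 1 0] assms(3) by (simp_all add: abs_le_square_iff)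

lemma finite_energy_diff:
  assumes v: "finite_energy s v" and w: "finite_energy s w"
  shows "finite_energy s (\<lambda>x. v x - w x)"
proof (rule finite_energy_dominated(1)[OF _ v w, of _ 2 2])
  fix x y
  have "(a - b)\<^sup>2 \<le> 2 * a\<^sup>2 + 2 * b\<^sup>2" for a b :: real
    using zero_le_power2[of "a + b"] by (simp add: power2_sum power2_diff)
  from this[of "v x - v y" "w x - w y"]
  show "(v x - w x - (v y - w y))\<^sup>2 \<le> 2 * (v x - v y)\<^sup>2 + 2 * (w x - w y)\<^sup>2"
    by (simp add: algebra_simps)
qed (use v w in \<open>auto simp: finite_energy_def\<close>)

lemma gform_diff_right:
  assumes "finite_energy s u" "finite_energy s v" "finite_energy s w"
  shows "gform s u (\<lambda>x. v x - w x) = gform s u v - gform s u w"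
  using integrable_diff_quot_mult[OF assms(1,2)] integrable_diff_quot_mult[OF assms(1,3)]
  by (simp add: gform_def diff_quot_diff right_diff_distrib)

lemma gform_abs_le:
  assumes u: "finite_energy s u" and w: "finite_energy s w" and d: "d > 0"
  shows "\<bar>gform s u w\<bar> \<le> d * gform s u u + gform s w w / d"
proof -
  have pt: "\<bar>a * b\<bar> \<le> d * a\<^sup>2 + b\<^sup>2 / d" for a b :: real
  proof -
    have "2 * (sqrt d * \<bar>a\<bar>) * (\<bar>b\<bar> / sqrt d) \<le> (sqrt d * \<bar>a\<bar>)\<^sup>2 + (\<bar>b\<bar> / sqrt d)\<^sup>2"
      by (rule sum_squares_bound)
    moreover have "2 * (sqrt d * \<bar>a\<bar>) * (\<bar>b\<bar> / sqrt d) = 2 * \<bar>a * b\<bar>"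
      using d by (simp add: abs_mult)
    ultimately show ?thesis using d by (simp add: power_mult_distrib power_divide)
  qed
  have i: "integrable lborel (\<lambda>p. d * (diff_quot s u p)\<^sup>2 + (diff_quot s w p)\<^sup>2 / d)"
    using u w by (auto simp: finite_energy_def)
  have "\<bar>gform s u w\<bar> \<le> (\<integral>p. \<bar>diff_quot s u p * diff_quot s w p\<bar> \<partial>lborel)"
    unfolding gform_def by (rule integral_abs_bound)
  also have "\<dots> \<le> (\<integral>p. d * (diff_quot s u p)\<^sup>2 + (diff_quot s w p)\<^sup>2 / d \<partial>lborel)"
    using i integrable_diff_quot_mult[OF u w] pt by (intro integral_mono) auto
  also have "\<dots> = d * gform s u u + gform s w w / d"
    using u w by (simp add: gform_def finite_energy_def flip: power2_eq_square)
  finally show ?thesis .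
qed

text \<open>
  The weighted inequality of arithmetic and geometric means bounds the form by the fixed energy of
  \<open>u\<close>, with a small weight, and the vanishing energy of the difference, with a large one.
\<close>

lemma gform_tendsto_right:
  assumes u: "finite_energy s u" and v: "\<And>n. finite_energy s (v n)" and w: "finite_energy s w"
    and lim: "(\<lambda>n. gform s (\<lambda>x. v n x - w x) (\<lambda>x. v n x - w x)) \<longlonglongrightarrow> 0"
  shows "(\<lambda>n. gform s u (v n)) \<longlonglongrightarrow> gform s u w"
proof (rule LIMSEQ_I)
  fix e :: real assume e: "e > 0"
  \<comment> \<open>The weight makes the fixed energy of \<open>u\<close> contribute less than \<open>e / 2\<close>.\<close>
  define d where "d = e / (2 * (gform s u u + 1))"
  have d: "d > 0" using e gform_nonneg[of s u] by (simp add: d_def)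
  have de: "d * gform s u u < e / 2"
    using e gform_nonneg[of s u] by (simp add: d_def field_simps)
  obtain n0 where n0: "\<And>n. n \<ge> n0 \<Longrightarrow> gform s (\<lambda>x. v n x - w x) (\<lambda>x. v n x - w x) < d * (e / 2)"
    using LIMSEQ_D[OF lim, of "d * (e / 2)"] d e by fastforce
  show "\<exists>no. \<forall>n\<ge>no. norm (gform s u (v n) - gform s u w) < e"
  proof (intro exI[of _ n0] allI impI)
    fix n assume "n \<ge> n0"
    have "\<bar>gform s u (v n) - gform s u w\<bar> = \<bar>gform s u (\<lambda>x. v n x - w x)\<bar>"
      by (simp add: gform_diff_right u v w)
    also have "\<dots> \<le> d * gform s u u + gform s (\<lambda>x. v n x - w x) (\<lambda>x. v n x - w x) / d"
      by (rule gform_abs_le[OF u finite_energy_diff[OF v w] d])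
    also have "\<dots> < e / 2 + e / 2"
      using de n0[OF \<open>n \<ge> n0\<close>] d by (intro add_strict_mono) (auto simp: field_simps)
    finally show "norm (gform s u (v n) - gform s u w) < e" by simp
  qed
qed

lemma diff_quot_shift: "diff_quot s (\<lambda>x. w (x + z)) p = diff_quot s w (p + (z, z))"
  by (simp add: diff_quot_def split_beta)

lemma finite_energy_shift:
  fixes w :: "'a::euclidean_space \<Rightarrow> real"
  assumes w: "finite_energy s w"
  shows "finite_energy s (\<lambda>x. w (x + z))"
  using w integrable_lborel_shift[of "\<lambda>p. (diff_quot s w p)\<^sup>2" "(z, z)"]
  by (auto simp: finite_energy_def diff_quot_shift)

text \<open>
  This turns continuity of translations for the integrable function $a|a|$ into the same statement
  for the square integrable function $a$.
\<close>

lemma square_diff_le: "(a - b)\<^sup>2 \<le> 2 * \<bar>a * \<bar>a\<bar> - b * \<bar>b\<bar>\<bar>" for a b :: real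
proof -
  have e: "(a - b)\<^sup>2 = a * a - 2 * (a * b) + b * b" for a b :: real
    by (simp add: power2_eq_square algebra_simps)
  have lin: "x - 2 * y + z \<le> 2 * \<bar>x - z\<bar>" if "x \<le> y" for x y z :: real
    using that by (cases "x \<le> z") (simp_all add: abs_if)
  have lin2: "x - 2 * y + z \<le> 2 * \<bar>x - z\<bar>" if "z \<le> y" for x y z :: real
    using that by (cases "x \<le> z") (simp_all add: abs_if)
  have same: "(a - b)\<^sup>2 \<le> 2 * \<bar>a * a - b * b\<bar>" if "0 \<le> a" "0 \<le> b" for a b :: real
  proof (cases "a \<le> b")
    case True
    then have "a * a \<le> a * b" using that by (intro mult_left_mono)
    then show ?thesis
      unfolding e by (rule lin)
  next
    case False
    then have "b * b \<le> a * b" using that by (intro mult_right_mono) auto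
    then show ?thesis
      unfolding e by (rule lin2)
  qed
  have opp: "(a - b)\<^sup>2 \<le> 2 * (a * a + b * b)" for a b :: real
    using zero_le_power2[of "a + b"] by (simp add: power2_eq_square algebra_simps)
  consider "0 \<le> a" "0 \<le> b" | "a \<le> 0" "b \<le> 0" | "0 \<le> a" "b \<le> 0" | "a \<le> 0" "0 \<le> b" by linarith
  then show ?thesis
  proof cases
    case 1
    have "\<bar>a\<bar> = a" "\<bar>b\<bar> = b" using 1 by auto
    then show ?thesis using same[OF 1] by simp
  next
    case 2
    have "\<bar>a\<bar> = -a" "\<bar>b\<bar> = -b" using 2 by auto
    moreover have "(a - b)\<^sup>2 = (- a - - b)\<^sup>2" by (simp add: power2_commute)
    moreover have "a * - a - b * - b = - ((- a) * (- a) - (- b) * (- b))" by simp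
    ultimately show ?thesis using same[of "-a" "-b"] 2 by (simp only: abs_minus_cancel)
  next
    case 3
    have "\<bar>a\<bar> = a" "\<bar>b\<bar> = -b" using 3 by auto
    then show ?thesis using opp[of a b] abs_ge_self[of "a * a + b * b"] by simp
  next
    case 4
    have "\<bar>a\<bar> = -a" "\<bar>b\<bar> = b" using 4 by auto
    then show ?thesis using opp[of a b] abs_ge_minus_self[of "- (a * a) - b * b"] by simp
  qed
qed

text \<open>
  The kernel depends on $x - y$ only, so translating $w$ by $z$ translates its difference quotient
  by $(z,z)$ in the product space.
\<close>

lemma tendsto_shift_energy:
  fixes w :: "'a::euclidean_space \<Rightarrow> real"
  assumes w: "finite_energy s w" and z: "z \<longlonglongrightarrow> 0"
  shows "(\<lambda>n. gform s (\<lambda>x. w (x + z n) - w x) (\<lambda>x. w (x + z n) - w x)) \<longlonglongrightarrow> 0"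
proof -
  define h where "h p = diff_quot s w p * \<bar>diff_quot s w p\<bar>" for p
  have [measurable]: "w \<in> borel_measurable borel" using w by (simp add: finite_energy_def)
  have h: "integrable lborel h"
  proof (rule Bochner_Integration.integrable_bound)
    show "integrable lborel (\<lambda>p. (diff_quot s w p)\<^sup>2)" using w by (simp add: finite_energy_def)
    show "h \<in> borel_measurable lborel" unfolding h_def by measurable
    show "AE p in lborel. norm (h p) \<le> norm ((diff_quot s w p)\<^sup>2)"
      by (rule AE_I2) (simp add: h_def abs_mult power2_eq_square)
  qed
  have z2: "(\<lambda>n. (z n, z n)) \<longlonglongrightarrow> 0"
    using tendsto_Pair[OF z z] by (simp add: zero_prod_def)
  have "(\<lambda>n. 2 * (\<integral>p. \<bar>h (p + (z n, z n)) - h p\<bar> \<partial>lborel)) \<longlonglongrightarrow> 2 * 0"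
    by (intro tendsto_intros tendsto_shift_L1 h z2)
  then have lim: "(\<lambda>n. 2 * (\<integral>p. \<bar>h (p + (z n, z n)) - h p\<bar> \<partial>lborel)) \<longlonglongrightarrow> 0" by simp
  show ?thesis
  proof (rule tendsto_sandwich[OF _ _ tendsto_const lim])
    show "\<forall>\<^sub>F n in sequentially. gform s (\<lambda>x. w (x + z n) - w x) (\<lambda>x. w (x + z n) - w x)
       \<le> 2 * (\<integral>p. \<bar>h (p + (z n, z n)) - h p\<bar> \<partial>lborel)"
    proof (intro always_eventually allI)
      fix n
      let ?d = "\<lambda>x. w (x + z n) - w x"
      have "gform s ?d ?d = (\<integral>p. (diff_quot s ?d p)\<^sup>2 \<partial>lborel)"
        by (simp add: gform_def power2_eq_square)
      also have "\<dots> \<le> (\<integral>p. 2 * \<bar>h (p + (z n, z n)) - h p\<bar> \<partial>lborel)"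
      proof (rule integral_mono)
        show "integrable lborel (\<lambda>p. (diff_quot s ?d p)\<^sup>2)"
          using finite_energy_diff[OF finite_energy_shift[OF w] w] by (simp add: finite_energy_def)
        show "integrable lborel (\<lambda>p. 2 * \<bar>h (p + (z n, z n)) - h p\<bar>)"
          by (intro integrable_mult_right Bochner_Integration.integrable_abs
              Bochner_Integration.integrable_diff integrable_lborel_shift h)
        show "(diff_quot s ?d p)\<^sup>2 \<le> 2 * \<bar>h (p + (z n, z n)) - h p\<bar>" for p
          unfolding diff_quot_diff diff_quot_shift h_def by (rule square_diff_le)
      qed
      finally show "gform s ?d ?d \<le> 2 * (\<integral>p. \<bar>h (p + (z n, z n)) - h p\<bar> \<partial>lborel)" by simp
    qed
  qed (simp add: gform_nonneg)
qed

section \<open>Cut-off functions and a lower bound for the energy\<close>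

lemma ex_powr_two:
  fixes r :: real
  assumes "0 < r"
  obtains t where "r = 2 powr t"
  using assms by (intro that[of "log 2 r"]) simp

lemma ennreal_le_suminf: "f n \<le> (\<Sum>n. f n :: ennreal)"
  using sum_le_suminf[of f "{n}"] by simp

lemma suminf_geometric_ennreal_finite:
  fixes c q :: real
  assumes "0 \<le> c" "0 \<le> q" "q < 1"
  shows "(\<Sum>n. ennreal (c * q ^ n)) < \<infinity>"
proof -
  have "summable (\<lambda>n. c * q ^ n)" using assms by (intro summable_mult summable_geometric) auto
  then show ?thesis using assms by (subst suminf_ennreal2) auto
qed

text \<open>
  The integrand is of size $|z|^{2-N-2s}$ near the origin and $|z|^{-N-2s}$ far away. On dyadic
  shells this gives geometric series with ratios $2^{2s-2}$ and $2^{-2s}$.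
\<close>

lemma levy_kernel_finite:
  fixes s :: real
  assumes s: "0 < s" "s < 1"
  shows "(\<integral>\<^sup>+z. ennreal (min 1 ((norm z)\<^sup>2) / norm z powr (real DIM('a) + 2 * s)) \<partial>(lborel :: 'a::euclidean_space measure)) < \<infinity>"
proof -
  define N where "N = real DIM('a)"
  define \<omega> where "\<omega> = unit_ball_vol N"
  define a where "a n = 2 powr (- 2 * real n + (real n + 1) * (N + 2 * s))" for n
  define b where "b n = 2 powr (- real n * (N + 2 * s))" for n
  have \<omega>: "0 \<le> \<omega>" by (simp add: \<omega>_def N_def unit_ball_vol_nonneg)
  have N: "0 < N" by (simp add: N_def)
  have vol: "emeasure lborel (cball (0::'a) (2 powr r)) = ennreal (\<omega> * 2 powr (r * N))" for r
    by (simp add: emeasure_cball \<omega>_def N_def powr_powr[symmetric] powr_realpow)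
  have pt: "ennreal (min 1 ((norm z)\<^sup>2) / norm z powr (N + 2 * s))
     \<le> (\<Sum>n. ennreal (a n) * indicator (cball 0 (2 powr (- real n))) z)
        + (\<Sum>n. ennreal (b n) * indicator (cball 0 (2 powr (real n + 1))) z)" (is "?l \<le> ?A + ?B") for z :: 'a
  proof (cases "z = 0")
    case False
    then obtain t where t: "norm z = 2 powr t" using ex_powr_two[of "norm z"] by auto
    have sq: "(norm z)\<^sup>2 = 2 powr (2 * t)" by (simp add: t power2_eq_square flip: powr_add)
    have pw: "norm z powr (N + 2 * s) = 2 powr (t * (N + 2 * s))" by (simp add: t powr_powr)
    show ?thesis
    proof (cases "t \<le> 0")
      case True
      define n where "n = nat \<lfloor>- t\<rfloor>"
      have n: "real n \<le> - t" "- t \<le> real n + 1" using True by (auto simp: n_def)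
      have "min 1 ((norm z)\<^sup>2) / norm z powr (N + 2 * s) \<le> 2 powr (2 * t) / 2 powr (t * (N + 2 * s))"
        unfolding pw sq by (intro divide_right_mono) auto
      also have "\<dots> = 2 powr (2 * t + (- t) * (N + 2 * s))" by (simp flip: powr_diff)
      also have "\<dots> \<le> a n"
        unfolding a_def using n N s by (intro powr_mono add_mono mult_right_mono) auto
      finally have "?l \<le> ennreal (a n) * indicator (cball 0 (2 powr (- real n))) z"
        using n by (simp add: t indicator_def ennreal_leI)
      also have "\<dots> \<le> ?A"
        by (rule ennreal_le_suminf[of "\<lambda>n. ennreal (a n) * indicator (cball 0 (2 powr (- real n))) z"])
      finally show ?thesis by (simp add: add_increasing2)
    next
      case False
      define n where "n = nat \<lfloor>t\<rfloor>"
      have n: "real n \<le> t" "t \<le> real n + 1" using False by (auto simp: n_def)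
      have "min 1 ((norm z)\<^sup>2) / norm z powr (N + 2 * s) \<le> 1 / 2 powr (t * (N + 2 * s))"
        unfolding pw by (intro divide_right_mono) auto
      also have "\<dots> = 2 powr ((- t) * (N + 2 * s))" by (simp add: powr_minus_divide)
      also have "\<dots> \<le> b n"
        unfolding b_def using n N s by (intro powr_mono mult_right_mono) auto
      finally have "?l \<le> ennreal (b n) * indicator (cball 0 (2 powr (real n + 1))) z"
        using n by (simp add: t indicator_def ennreal_leI)
      also have "\<dots> \<le> ?B"
        by (rule ennreal_le_suminf[of "\<lambda>n. ennreal (b n) * indicator (cball 0 (2 powr (real n + 1))) z"])
      finally show ?thesis by (simp add: add_increasing)
    qed
  qed simp
  have pw: "2 powr X * (\<omega> * 2 powr Y) = (\<omega> * 2 powr Z) * (2 powr q) ^ n"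
    if "X + Y = Z + q * real n" for X Y Z q :: real and n
  proof -
    have "2 powr X * 2 powr Y = 2 powr Z * 2 powr (q * real n)"
      by (simp only: that flip: powr_add)
    then show ?thesis by (simp add: powr_power mult.commute[of q])
  qed
  have ia: "a n * (\<omega> * 2 powr (- real n * N)) = (\<omega> * 2 powr (N + 2 * s)) * (2 powr (2 * s - 2)) ^ n" for n
    unfolding a_def by (rule pw) (simp add: algebra_simps)
  have ib: "b n * (\<omega> * 2 powr ((real n + 1) * N)) = (\<omega> * 2 powr N) * (2 powr (- 2 * s)) ^ n" for n
    unfolding b_def by (rule pw) (simp add: algebra_simps)
  have q: "2 powr (2 * s - 2) < 1" "2 powr (- 2 * s) < (1::real)"
    using s by (auto simp: powr_less_one)
  have "(\<integral>\<^sup>+z. ennreal (min 1 ((norm z)\<^sup>2) / norm z powr (N + 2 * s)) \<partial>(lborel :: 'a measure))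
     \<le> (\<integral>\<^sup>+z. (\<Sum>n. ennreal (a n) * indicator (cball 0 (2 powr (- real n))) z)
        + (\<Sum>n. ennreal (b n) * indicator (cball 0 (2 powr (real n + 1))) z) \<partial>(lborel :: 'a measure))"
    by (intro nn_integral_mono pt)
  also have "\<dots> = (\<Sum>n. ennreal (a n) * ennreal (\<omega> * 2 powr (- real n * N)))
      + (\<Sum>n. ennreal (b n) * ennreal (\<omega> * 2 powr ((real n + 1) * N)))"
  proof -
    have sA: "(\<integral>\<^sup>+z. (\<Sum>n. c n * indicator (cball 0 (r n)) z) \<partial>(lborel :: 'a measure))
        = (\<Sum>n. c n * emeasure lborel (cball (0::'a) (r n)))" for c :: "nat \<Rightarrow> ennreal" and r
    proof -
      have [measurable]: "cball (0::'a) (r n) \<in> sets borel" for n by simp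
      have "(\<integral>\<^sup>+z. (\<Sum>n. c n * indicator (cball 0 (r n)) z) \<partial>(lborel :: 'a measure))
          = (\<Sum>n. \<integral>\<^sup>+z. c n * indicator (cball 0 (r n)) z \<partial>(lborel :: 'a measure))"
        by (rule nn_integral_suminf) measurable
      then show ?thesis by (simp only: nn_integral_cmult_indicator sets_lborel \<open>cball 0 (r _) \<in> sets borel\<close>)
    qed
    have sM: "(\<lambda>z. \<Sum>n. c n * indicator (cball (0::'a) (r n)) z) \<in> borel_measurable lborel"
      for c :: "nat \<Rightarrow> ennreal" and r
    proof -
      have [measurable]: "cball (0::'a) (r n) \<in> sets borel" for n by simp
      show ?thesis by measurable
    qed
    show ?thesis unfolding nn_integral_add[OF sM sM] sA vol ..
  qed
  also have "\<dots> = (\<Sum>n. ennreal ((\<omega> * 2 powr (N + 2 * s)) * (2 powr (2 * s - 2)) ^ n))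
      + (\<Sum>n. ennreal ((\<omega> * 2 powr N) * (2 powr (- 2 * s)) ^ n))"
    unfolding ia[symmetric] ib[symmetric] using \<omega> by (simp add: a_def b_def flip: ennreal_mult)
  also have "\<dots> < \<infinity>"
    unfolding infinity_ennreal_def ennreal_add_less_top
    by (intro conjI suminf_geometric_ennreal_finite[unfolded infinity_ennreal_def] q
        mult_nonneg_nonneg \<omega> powr_ge_zero)
  finally show ?thesis by (simp add: N_def)
qed

definition bump :: "'a::euclidean_space \<Rightarrow> real \<Rightarrow> 'a \<Rightarrow> real" where
  "bump c \<rho> y = max 0 (min 1 (2 - dist y c / \<rho>))"

lemma bump_bounds: "0 \<le> bump c \<rho> y" "bump c \<rho> y \<le> 1"
  by (auto simp: bump_def)

lemma bump_eq_1: "0 < \<rho> \<Longrightarrow> dist y c \<le> \<rho> \<Longrightarrow> bump c \<rho> y = 1"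
  by (auto simp: bump_def)

lemma bump_eq_0: "0 < \<rho> \<Longrightarrow> 2 * \<rho> \<le> dist y c \<Longrightarrow> bump c \<rho> y = 0"
  by (auto simp: bump_def field_simps)

lemma bump_borel[measurable]: "bump c \<rho> \<in> borel_measurable borel"
  unfolding bump_def by measurable

lemma bump_lipschitz: 
  assumes "0 < \<rho>" shows "\<bar>bump c \<rho> x - bump c \<rho> y\<bar> \<le> norm (x - y) / \<rho>"
proof -
  have "\<bar>bump c \<rho> x - bump c \<rho> y\<bar> \<le> \<bar>dist x c / \<rho> - dist y c / \<rho>\<bar>" by (auto simp: bump_def)
  also have "\<dots> = \<bar>dist x c - dist y c\<bar> / \<rho>"
    using assms by (simp flip: diff_divide_distrib)
  also have "\<dots> \<le> norm (x - y) / \<rho>"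
    using assms abs_dist_diff_le[of x c y] by (intro divide_right_mono) (auto simp: dist_norm norm_minus_commute)
  finally show ?thesis .
qed

text \<open>
  The increment of a cut-off is at most a multiple of $\min(1,|x-y|)$ and vanishes unless one of
  the two points lies in a fixed ball, so the energy is at most the measure of that ball times
  the integral of the kernel above.
\<close>

lemma finite_energy_bump:
  fixes c :: "'a::euclidean_space"
  assumes s: "0 < s" "s < 1" and \<rho>: "0 < \<rho>"
  shows "finite_energy s (bump c \<rho>)"
proof (rule finite_energyI_nn)
  let ?C = "1 + 1 / \<rho>\<^sup>2"
  let ?k = "\<lambda>z::'a. ennreal (min 1 ((norm z)\<^sup>2) / norm z powr (real DIM('a) + 2 * s))"
  define B where "B = cball c (2 * \<rho>)"
  have [measurable]: "B \<in> sets borel" by (simp add: B_def)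
  define J where "J = (\<integral>\<^sup>+z. ?k z \<partial>lborel)"
  have J: "J < \<infinity>" unfolding J_def by (rule levy_kernel_finite[OF s])
  have C: "0 \<le> ?C" by simp
  have vB: "emeasure lborel B < \<infinity>" using \<rho> by (simp add: B_def emeasure_cball)
  have sq: "(bump c \<rho> x - bump c \<rho> y)\<^sup>2
     \<le> ?C * min 1 ((norm (x - y))\<^sup>2) * (indicator B x + indicator B y)" for x y
  proof (cases "x \<in> B \<or> y \<in> B")
    case True
    have "(bump c \<rho> x - bump c \<rho> y)\<^sup>2 \<le> ?C * min 1 ((norm (x - y))\<^sup>2)"
    proof (cases "norm (x - y) \<le> 1")
      case True
      have "(bump c \<rho> x - bump c \<rho> y)\<^sup>2 \<le> (norm (x - y) / \<rho>)\<^sup>2"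
        using power_mono[OF bump_lipschitz[OF \<rho>, of c x y] abs_ge_zero, of 2] by simp
      also have "\<dots> \<le> ?C * (norm (x - y))\<^sup>2"
        by (simp add: power_divide distrib_right)
      also have "(norm (x - y))\<^sup>2 = min 1 ((norm (x - y))\<^sup>2)"
        using True power_le_one[of "norm (x - y)" 2] by (simp add: min_absorb2)
      finally show ?thesis by simp
    next
      case False
      have "\<bar>bump c \<rho> x - bump c \<rho> y\<bar> \<le> \<bar>1\<bar>"
        using bump_bounds[of c \<rho> x] bump_bounds[of c \<rho> y] by auto
      then have "(bump c \<rho> x - bump c \<rho> y)\<^sup>2 \<le> 1" unfolding abs_le_square_iff by simp
      also have "1 \<le> ?C * min 1 ((norm (x - y))\<^sup>2)"
        using False one_le_power[of "norm (x - y)" 2] by (simp add: min_def)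
      finally show ?thesis .
    qed
    also have "\<dots> \<le> ?C * min 1 ((norm (x - y))\<^sup>2) * (indicator B x + indicator B y)"
    proof -
      have "1 \<le> (indicator B x + indicator B y :: real)" using True by (auto simp: indicator_def)
      moreover have "0 \<le> ?C * min 1 ((norm (x - y))\<^sup>2)" by (intro mult_nonneg_nonneg C) simp
      ultimately have "?C * min 1 ((norm (x - y))\<^sup>2) * 1
          \<le> ?C * min 1 ((norm (x - y))\<^sup>2) * (indicator B x + indicator B y)"
        by (rule mult_left_mono)
      then show ?thesis by (simp only: mult_1_right)
    qed
    finally show ?thesis .
  next
    case False
    then have "bump c \<rho> x = 0" "bump c \<rho> y = 0"
      using \<rho> by (auto intro!: bump_eq_0 simp: dist_commute B_def)
    then show ?thesis by simp
  qed
  have "(\<integral>\<^sup>+p. ennreal ((diff_quot s (bump c \<rho>) p)\<^sup>2) \<partial>lborel)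
     = (\<integral>\<^sup>+p. ennreal ((diff_quot s (bump c \<rho>) p)\<^sup>2) \<partial>(lborel \<Otimes>\<^sub>M lborel))"
    by (simp add: lborel_prod)
  also have "\<dots> \<le> (\<integral>\<^sup>+p. (case p of (x, y) \<Rightarrow> ennreal ?C * (?k (x - y) * indicator B x)
      + ennreal ?C * (?k (x - y) * indicator B y)) \<partial>(lborel \<Otimes>\<^sub>M lborel))"
  proof (rule nn_integral_mono, clarify)
    fix x y :: 'a
    define K where "K = min 1 ((norm (x - y))\<^sup>2) / norm (x - y) powr (real DIM('a) + 2 * s)"
    have K: "0 \<le> K" by (simp add: K_def)
    have "(diff_quot s (bump c \<rho>) (x, y))\<^sup>2
      \<le> ?C * min 1 ((norm (x - y))\<^sup>2) * (indicator B x + indicator B y) / norm (x - y) powr (real DIM('a) + 2 * s)"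
      unfolding diff_quot_square by (intro divide_right_mono sq) simp
    also have "\<dots> = ?C * (K * indicator B x) + ?C * (K * indicator B y)"
      by (simp add: K_def distrib_left add_divide_distrib mult.assoc)
    finally have "ennreal ((diff_quot s (bump c \<rho>) (x, y))\<^sup>2)
        \<le> ennreal (?C * (K * indicator B x) + ?C * (K * indicator B y))"
      by (rule ennreal_leI)
    also have "\<dots> = ennreal (?C * (K * indicator B x)) + ennreal (?C * (K * indicator B y))"
      using K C by (intro ennreal_plus mult_nonneg_nonneg) auto
    also have "\<dots> = ennreal ?C * (ennreal K * indicator B x) + ennreal ?C * (ennreal K * indicator B y)"
      using K C by (simp only: ennreal_mult mult_nonneg_nonneg indicator_pos_le ennreal_indicator)
    finally show "ennreal ((diff_quot s (bump c \<rho>) (x, y))\<^sup>2)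
      \<le> ennreal ?C * (?k (x - y) * indicator B x) + ennreal ?C * (?k (x - y) * indicator B y)"
      unfolding K_def .
  qed
  also have "\<dots> = (\<integral>\<^sup>+p. (case p of (x, y) \<Rightarrow> ennreal ?C * (?k (x - y) * indicator B x)) \<partial>(lborel \<Otimes>\<^sub>M lborel))
      + (\<integral>\<^sup>+p. (case p of (x, y) \<Rightarrow> ennreal ?C * (?k (x - y) * indicator B y)) \<partial>(lborel \<Otimes>\<^sub>M lborel))"
    unfolding split_beta by (rule nn_integral_add) measurable
  also have "(\<integral>\<^sup>+p. (case p of (x, y) \<Rightarrow> ennreal ?C * (?k (x - y) * indicator B y)) \<partial>(lborel \<Otimes>\<^sub>M lborel))
     = (\<integral>\<^sup>+y. \<integral>\<^sup>+x. ennreal ?C * (?k (x - y) * indicator B y) \<partial>lborel \<partial>lborel)"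
    by (subst lborel_pair.nn_integral_snd[symmetric]) (auto simp: split_beta)
  also have "\<dots> = (\<integral>\<^sup>+y. ennreal ?C * (J * indicator B y) \<partial>lborel)"
    using nn_integral_lborel_shift[of ?k "- _"]
    by (intro nn_integral_cong) (simp add: nn_integral_cmult nn_integral_multc J_def)
  also have "\<dots> = ennreal ?C * (J * emeasure lborel B)"
    by (simp add: nn_integral_cmult)
  also have "(\<integral>\<^sup>+p. (case p of (x, y) \<Rightarrow> ennreal ?C * (?k (x - y) * indicator B x)) \<partial>(lborel \<Otimes>\<^sub>M lborel))
     = (\<integral>\<^sup>+x. \<integral>\<^sup>+y. ennreal ?C * (?k (x - y) * indicator B x) \<partial>lborel \<partial>lborel)"
    by (subst lborel.nn_integral_fst[symmetric]) (auto simp: split_beta)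
  also have "\<dots> = (\<integral>\<^sup>+x. ennreal ?C * (J * indicator B x) \<partial>lborel)"
    using nn_integral_lborel_shift[of ?k "- _"]
    by (intro nn_integral_cong) (simp add: nn_integral_cmult nn_integral_multc J_def norm_minus_commute)
  also have "\<dots> = ennreal ?C * (J * emeasure lborel B)"
    by (simp add: nn_integral_cmult)
  also have "ennreal ?C * (J * emeasure lborel B) + ennreal ?C * (J * emeasure lborel B) < \<infinity>"
    using J vB by (simp add: ennreal_mult_less_top)
  finally show "(\<integral>\<^sup>+p. ennreal ((diff_quot s (bump c \<rho>) p)\<^sup>2) \<partial>lborel) < \<infinity>" .
qed measurable

text \<open>
  Whatever the set $A$ of measure at most $\mu$ is, a ball around $x$ of measure $2\mu$ has at least
  the measure $\mu$ outside $A$. There $w$ differs from its value at $x \in B$ by $h$, and the kernel is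
  at least the power $-N-2s$ of the radius of the ball. This plays the role of the Sobolev
  inequality: $1 - 2s/N$ is the power of the measure that a Sobolev inequality produces for a
  plateau of height $h$.
\<close>

lemma gform_lower_bound:
  fixes w :: "'a::euclidean_space \<Rightarrow> real"
  assumes s: "0 < s" and w: "finite_energy s w" and h: "0 \<le> h" and \<mu>: "0 < \<mu>"
    and A: "A \<in> sets borel" "\<And>x. x \<notin> A \<Longrightarrow> w x = 0" "emeasure lborel A \<le> ennreal \<mu>"
    and B: "B \<in> sets borel" "B \<subseteq> A" "\<And>x. x \<in> B \<Longrightarrow> w x = h" "emeasure lborel B \<ge> ennreal m" "0 \<le> m"
  shows "h\<^sup>2 * m * (unit_ball_vol (real DIM('a)) / 2) powr (1 + 2 * s / DIM('a)) * \<mu> powr (- 2 * s / DIM('a))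
     \<le> gform s w w"
proof -
  define N where "N = real DIM('a)"
  define \<omega> where "\<omega> = unit_ball_vol N"
  have N: "0 < N" by (simp add: N_def)
  have \<omega>: "0 < \<omega>" by (simp add: \<omega>_def N_def unit_ball_vol_pos)
  \<comment> \<open>The radius of a ball of measure \<open>2 * \<mu>\<close>.\<close>
  define R where "R = (2 * \<mu> / \<omega>) powr (1 / N)"
  have R: "0 < R" using \<mu> \<omega> by (simp add: R_def)
  have RN: "R powr N = 2 * \<mu> / \<omega>" using \<mu> \<omega> N by (simp add: R_def powr_powr)
  have vol: "emeasure lborel (ball x R) = ennreal (2 * \<mu>)" for x :: 'a
  proof -
    have "emeasure lborel (ball x R) = ennreal (\<omega> * R powr N)"
      using R by (simp add: emeasure_ball \<omega>_def N_def powr_realpow)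
    then show ?thesis using \<omega> by (simp add: RN)
  qed
  have [measurable]: "A \<in> sets borel" "B \<in> sets borel" by fact+
  have far: "ennreal \<mu> \<le> emeasure lborel (ball x R - A)" for x
  proof -
    have "ennreal (2 * \<mu>) \<le> emeasure lborel (ball x R - A) + emeasure lborel A"
      unfolding vol[of x, symmetric]
      by (rule order_trans[OF emeasure_mono emeasure_subadditive]) auto
    also have "\<dots> \<le> emeasure lborel (ball x R - A) + ennreal \<mu>" by (intro add_left_mono A)
    also have "ennreal (2 * \<mu>) = ennreal \<mu> + ennreal \<mu>" using \<mu> by (simp flip: ennreal_plus)
    finally show ?thesis by (simp add: add.commute ennreal_add_left_cancel_le)
  qed
  let ?c = "h\<^sup>2 * R powr (- (N + 2 * s))"
  have pt: "ennreal ?c * (indicator B x * indicator (ball x R - A) y) \<le> ennreal ((diff_quot s w (x, y))\<^sup>2)" for x y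
  proof (cases "x \<in> B \<and> y \<in> ball x R - A")
    case True
    then have "x \<noteq> y" using B(2) by auto
    have "?c = h\<^sup>2 / R powr (N + 2 * s)" unfolding powr_minus_divide by simp
    also have "\<dots> \<le> h\<^sup>2 / norm (x - y) powr (N + 2 * s)"
      using True \<open>x \<noteq> y\<close> N s by (intro divide_left_mono powr_mono2 mult_pos_pos) (auto simp: dist_norm R)
    also have "\<dots> = (diff_quot s w (x, y))\<^sup>2"
      using True A(2)[of y] B(3)[of x] by (simp add: diff_quot_square N_def)
    finally show ?thesis using True by (simp add: ennreal_leI)
  qed (auto simp: indicator_def)
  have "h\<^sup>2 * m * (\<omega> / 2) powr (1 + 2 * s / N) * \<mu> powr (- 2 * s / N) = ?c * \<mu> * m"
  proof -
    have "R powr (- (N + 2 * s)) = (2 * \<mu> / \<omega>) powr (- (1 + 2 * s / N))"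
    proof -
      have "1 / N * (- (N + 2 * s)) = - (1 + 2 * s / N)" using N by (simp add: field_simps)
      then show ?thesis unfolding R_def powr_powr by simp
    qed
    also have "\<dots> = (\<mu> / (\<omega> / 2)) powr (- (1 + 2 * s / N))" by (simp add: mult.commute)
    also have "\<dots> = \<mu> powr (- (1 + 2 * s / N)) * (\<omega> / 2) powr (1 + 2 * s / N)"
      using \<mu> \<omega> by (subst powr_divide) (auto simp: powr_minus divide_simps)
    finally have "R powr (- (N + 2 * s)) * \<mu> = \<mu> powr (- (1 + 2 * s / N)) * \<mu> powr 1 * (\<omega> / 2) powr (1 + 2 * s / N)"
      using \<mu> by simp
    also have "\<mu> powr (- (1 + 2 * s / N)) * \<mu> powr 1 = \<mu> powr (- 2 * s / N)"
      unfolding powr_add[symmetric] by simp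
    finally show ?thesis by (simp add: mult_ac)
  qed
  also have "ennreal (?c * \<mu> * m) = ennreal ?c * (ennreal \<mu> * ennreal m)"
    using \<mu> B(5) by (simp add: ennreal_mult mult_ac)
  also have "\<dots> \<le> ennreal ?c * (ennreal \<mu> * emeasure lborel B)"
    by (intro mult_left_mono B) auto
  also have "\<dots> = (\<integral>\<^sup>+x. ennreal ?c * (ennreal \<mu> * indicator B x) \<partial>lborel)"
    by (simp add: nn_integral_cmult)
  also have "\<dots> \<le> (\<integral>\<^sup>+x. ennreal ?c * (emeasure lborel (ball x R - A) * indicator B x) \<partial>lborel)"
    by (intro nn_integral_mono mult_left_mono mult_right_mono far) auto
  also have "\<dots> = (\<integral>\<^sup>+x. \<integral>\<^sup>+y. ennreal ?c * (indicator B x * indicator (ball x R - A) y) \<partial>lborel \<partial>lborel)"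
  proof (rule nn_integral_cong)
    fix x
    have [measurable]: "ball x R - A \<in> sets borel" by measurable
    show "ennreal ?c * (emeasure lborel (ball x R - A) * indicator B x)
        = (\<integral>\<^sup>+y. ennreal ?c * (indicator B x * indicator (ball x R - A) y) \<partial>lborel)"
      by (subst nn_integral_cmult, measurable, subst nn_integral_cmult_indicator, measurable)
        (simp add: mult.commute)
  qed
  also have "\<dots> \<le> (\<integral>\<^sup>+x. \<integral>\<^sup>+y. ennreal ((diff_quot s w (x, y))\<^sup>2) \<partial>lborel \<partial>lborel)"
    by (intro nn_integral_mono pt)
  also have "\<dots> = (\<integral>\<^sup>+p. ennreal ((diff_quot s w p)\<^sup>2) \<partial>(lborel \<Otimes>\<^sub>M lborel))"
    using w unfolding finite_energy_def
    by (subst lborel.nn_integral_fst[symmetric]) (auto simp: lborel_prod)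
  also have "\<dots> = ennreal (gform s w w)"
    using ennreal_gform[OF w] by (simp add: lborel_prod)
  finally show ?thesis
    by (simp add: ennreal_le_iff gform_nonneg N_def \<omega>_def)
qed

section \<open>Smooth mollifiers\<close>

lemma Ck_SucD: "Ck (Suc k) f \<Longrightarrow> Ck k f"
proof (induction k arbitrary: f)
  case 0
  then show ?case by (simp add: differentiable_imp_continuous_on)
next
  case (Suc k)
  show ?case
    unfolding Ck.simps(2)[of k]
  proof (intro conjI allI)
    show "f differentiable_on UNIV" using Suc.prems by simp
    show "Ck k (\<lambda>x. frechet_derivative f (at x) (axis i 1))" for i
      using Suc.prems Suc.IH[of "\<lambda>x. frechet_derivative f (at x) (axis i 1)"]
      unfolding Ck.simps(2)[of "Suc k"] by blast
  qed
qed

lemma Ck_SucI: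
  assumes d: "\<And>x. (f has_derivative f' x) (at x)" and p: "\<And>i. Ck k (\<lambda>x. f' x (axis i 1))"
  shows "Ck (Suc k) f"
proof -
  have e: "frechet_derivative f (at x) = f' x" for x
    using frechet_derivative_at[OF d[of x]] by simp
  have "f differentiable_on UNIV"
    using d by (auto simp: differentiable_on_def differentiable_def)
  then show ?thesis using p unfolding Ck.simps e by simp
qed

lemma Ck_Suc_has_derivative:
  "Ck (Suc k) f \<Longrightarrow> (f has_derivative frechet_derivative f (at x)) (at x)"
  by (simp add: differentiable_on_def frechet_derivative_works)

lemma Ck_const: "Ck k (\<lambda>x. c)"
proof (induction k arbitrary: c)
  case (Suc k)
  show ?case by (rule Ck_SucI[where f' = "\<lambda>x h. 0"]) (auto intro: Suc)
qed simp

lemma Ck_component: "Ck k (\<lambda>x. x $ i)"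
proof (cases k)
  case (Suc l)
  show ?thesis unfolding Suc
    by (rule Ck_SucI[where f' = "\<lambda>x h. h $ i"])
      (auto intro: Ck_const bounded_linear_imp_has_derivative bounded_linear_vec_nth)
qed (auto intro: continuous_intros)

lemma Ck_add: "Ck k f \<Longrightarrow> Ck k g \<Longrightarrow> Ck k (\<lambda>x. f x + g x)"
proof (induction k arbitrary: f g)
  case (Suc k)
  show ?case
    by (rule Ck_SucI[OF has_derivative_add[OF Ck_Suc_has_derivative[OF Suc.prems(1)]
            Ck_Suc_has_derivative[OF Suc.prems(2)]]])
      (use Suc in auto)
qed (auto intro: continuous_intros)

lemma Ck_mult: "Ck k f \<Longrightarrow> Ck k g \<Longrightarrow> Ck k (\<lambda>x. f x * g x)"
proof (induction k arbitrary: f g)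
  case (Suc k)
  show ?case
  proof (rule Ck_SucI[OF has_derivative_mult[OF Ck_Suc_has_derivative[OF Suc.prems(1)]
            Ck_Suc_has_derivative[OF Suc.prems(2)]]])
    show "Ck k (\<lambda>x. f x * frechet_derivative g (at x) (axis i 1) +
                   frechet_derivative f (at x) (axis i 1) * g x)" for i
      using Suc.prems Ck_SucD[OF Suc.prems(1)] Ck_SucD[OF Suc.prems(2)]
      by (intro Ck_add Suc.IH) auto
  qed
qed (auto intro: continuous_intros)

text \<open>
  The family $t^{-m} e^{-1/t}$, extended by zero, is closed under differentiation up to linear
  combinations; an induction on the order of differentiability has to treat all $m$ at once.
\<close>

definition flat_exp :: "nat \<Rightarrow> real \<Rightarrow> real" where
  "flat_exp m t = (if t > 0 then exp (- (1 / t)) / t ^ m else 0)"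

lemma flat_exp_nonneg: "0 \<le> flat_exp m t"
  by (simp add: flat_exp_def)

text \<open>
  From $e^y \ge (y/n)^n$ with $n = m + 2$ and $y = 1/t$. The quadratic bound gives the derivative $0$
  at the origin.
\<close>

lemma flat_exp_le: "\<bar>flat_exp m t\<bar> \<le> real (m + 2) ^ (m + 2) * t\<^sup>2"
proof (cases "t > 0")
  case True
  define n where "n = m + 2"
  have n: "0 < real n" by (simp add: n_def)
  have "(1 / (real n * t)) ^ n \<le> exp (1 / (real n * t)) ^ n"
  proof (rule power_mono)
    show "1 / (real n * t) \<le> exp (1 / (real n * t))"
      using exp_ge_add_one_self[of "1 / (real n * t)"] by linarith
  qed (use True in simp)
  also have "\<dots> = exp (1 / t)"
    using n by (simp flip: exp_of_nat_mult)
  finally have "1 / (real n ^ n * t ^ n) \<le> exp (1 / t)"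
    by (simp add: power_divide power_mult_distrib)
  then have "exp (- (1 / t)) \<le> real n ^ n * t ^ n"
    using True n by (simp add: exp_minus field_simps)
  then have "exp (- (1 / t)) / t ^ m \<le> real n ^ n * t ^ n / t ^ m"
    using True by (intro divide_right_mono) auto
  also have "\<dots> = real n ^ n * t\<^sup>2" using True by (simp add: n_def power2_eq_square)
  finally show ?thesis using True by (simp add: flat_exp_def n_def)
qed (simp add: flat_exp_def)

lemma flat_exp_deriv:
  "(flat_exp m has_real_derivative (- real m * flat_exp (m + 1) t + flat_exp (m + 2) t)) (at t)"
proof -
  consider "t > 0" | "t < 0" | "t = 0" by linarith
  then show ?thesis
  proof cases
    case 1
    have "((\<lambda>t. exp (- (1 / t)) / t ^ m) has_real_derivative
       (exp (- (1 / t)) * (1 / t\<^sup>2) * t ^ m - exp (- (1 / t)) * (real m * t ^ (m - 1))) / (t ^ m * t ^ m)) (at t)"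
      using 1 by (auto intro!: derivative_eq_intros simp: power2_eq_square field_simps)
    moreover have "(exp (- (1 / t)) * (1 / t\<^sup>2) * t ^ m - exp (- (1 / t)) * (real m * t ^ (m - 1))) / (t ^ m * t ^ m)
      = - real m * (exp (- (1 / t)) / t ^ (m + 1)) + exp (- (1 / t)) / t ^ (m + 2)"
      using 1 by (cases m) (simp_all add: divide_simps power2_eq_square, simp add: algebra_simps)
    ultimately have "((\<lambda>t. exp (- (1 / t)) / t ^ m) has_real_derivative
       (- real m * flat_exp (m + 1) t + flat_exp (m + 2) t)) (at t)"
      using 1 by (simp add: flat_exp_def)
    moreover have "\<forall>\<^sub>F u in nhds t. flat_exp m u = exp (- (1 / u)) / u ^ m"
      using eventually_nhds_in_open[of "{0<..}" t] 1 by (auto elim!: eventually_mono simp: flat_exp_def)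
    ultimately show ?thesis by (subst DERIV_cong_ev[OF refl _ refl]) auto
  next
    case 2
    have "\<forall>\<^sub>F u in nhds t. flat_exp m u = 0"
      using eventually_nhds_in_open[of "{..<0}" t] 2 by (auto elim!: eventually_mono simp: flat_exp_def)
    then have "(flat_exp m has_real_derivative 0) (at t)"
      by (subst DERIV_cong_ev[OF refl _ refl]) auto
    then show ?thesis using 2 by (simp add: flat_exp_def)
  next
    case 3
    have lim: "((\<lambda>h. real (m + 2) ^ (m + 2) * \<bar>h\<bar>) \<longlongrightarrow> 0) (at (0::real))"
      by (auto intro!: tendsto_eq_intros)
    have "((\<lambda>h. (flat_exp m (0 + h) - flat_exp m 0) / h) \<longlongrightarrow> 0) (at 0)"
    proof (rule tendsto_rabs_zero_cancel, rule tendsto_sandwich[OF _ _ tendsto_const lim])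
      show "\<forall>\<^sub>F h in at 0. \<bar>(flat_exp m (0 + h) - flat_exp m 0) / h\<bar> \<le> real (m + 2) ^ (m + 2) * \<bar>h\<bar>"
      proof (rule eventually_at_filter[THEN iffD2, OF always_eventually], intro allI impI)
        fix h :: real assume "h \<noteq> 0"
        have "\<bar>flat_exp m h\<bar> \<le> (real (m + 2) ^ (m + 2) * \<bar>h\<bar>) * \<bar>h\<bar>"
          using flat_exp_le[of m h] by (simp add: power2_eq_square mult.assoc)
        then show "\<bar>(flat_exp m (0 + h) - flat_exp m 0) / h\<bar> \<le> real (m + 2) ^ (m + 2) * \<bar>h\<bar>"
          using \<open>h \<noteq> 0\<close> by (simp add: flat_exp_def[of m 0] divide_le_eq)
      qed
    qed auto
    then show ?thesis using 3 by (simp add: DERIV_def flat_exp_def)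
  qed
qed

lemma Ck_flat_exp: "Ck k (\<lambda>x::real^'n. flat_exp m (a - x \<bullet> x))"
proof (induction k arbitrary: m)
  case 0
  have "continuous_on UNIV (flat_exp m)"
    by (intro DERIV_continuous_on[OF has_field_derivative_at_within[OF flat_exp_deriv]])
  then show ?case
    using continuous_on_compose2[of UNIV "flat_exp m" UNIV "\<lambda>x::real^'n. a - x \<bullet> x"]
    by (simp add: continuous_intros)
next
  case (Suc k)
  let ?q = "\<lambda>x::real^'n. a - x \<bullet> x"
  show ?case
  proof (rule Ck_SucI)
    show "((\<lambda>x. flat_exp m (?q x)) has_derivative
        (\<lambda>h. (- real m * flat_exp (m + 1) (?q x) + flat_exp (m + 2) (?q x)) * (- 2 * (x \<bullet> h)))) (at x)" for x
    proof -
      have "(?q has_derivative (\<lambda>h. - 2 * (x \<bullet> h))) (at x)"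
        by (auto intro!: derivative_eq_intros simp: inner_commute)
      from has_derivative_compose[OF this flat_exp_deriv[unfolded has_field_derivative_def]]
      show ?thesis by simp
    qed
    show "Ck k (\<lambda>x. (- real m * flat_exp (m + 1) (?q x) + flat_exp (m + 2) (?q x)) * (- 2 * (x \<bullet> axis i 1)))" for i
      by (intro Ck_mult Ck_add Ck_const Suc.IH) (simp add: inner_axis Ck_component)
  qed
qed

lemma smooth_mollifier_exists:
  assumes "0 < r"
  obtains \<rho> :: "real^'n \<Rightarrow> real" where
    "\<And>k. Ck k \<rho>" "\<And>x. 0 \<le> \<rho> x" "\<And>x. r < norm x \<Longrightarrow> \<rho> x = 0" "integrable lborel \<rho>" "(\<integral>x. \<rho> x \<partial>lborel) = 1"
proof -
  define g :: "real^'n \<Rightarrow> real" where "g x = flat_exp 0 (r\<^sup>2 - x \<bullet> x)" for x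
  have Ck_g: "Ck k g" for k unfolding g_def by (rule Ck_flat_exp)
  have g0: "0 \<le> g x" for x by (simp add: g_def flat_exp_nonneg)
  have supp: "g x = 0" if "r < norm x" for x
    using that assms power_strict_mono[of r "norm x" 2] by (simp add: g_def flat_exp_def power2_norm_eq_inner)
  have pos: "0 < g x" if "norm x < r" for x
    using that power_strict_mono[of "norm x" r 2] by (simp add: g_def flat_exp_def power2_norm_eq_inner)
  have le1: "g x \<le> 1" for x by (simp add: g_def flat_exp_def)
  have "continuous_on UNIV g" using Ck_g[of 0] by simp
  then have [measurable]: "g \<in> borel_measurable borel" by (rule borel_measurable_continuous_onI)
  have ig: "integrable lborel g"
  proof (rule Bochner_Integration.integrable_bound)
    show "integrable lborel (indicator (cball (0::real^'n) r) :: _ \<Rightarrow> real)"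
      using assms by (simp add: integrable_indicator_iff emeasure_cball)
    show "AE x in lborel. norm (g x) \<le> norm (indicator (cball (0::real^'n) r) x :: real)"
      using g0 le1 supp by (intro AE_I2) (auto simp: indicator_def not_le)
  qed simp
  have "(\<integral>x. g x \<partial>lborel) \<noteq> 0"
  proof
    assume "(\<integral>x. g x \<partial>lborel) = 0"
    then have "AE x in lborel. g x = 0"
      using integral_nonneg_eq_0_iff_AE[OF ig] g0 by simp
    then have "AE x in lborel. x \<notin> ball (0::real^'n) r"
    proof eventually_elim
      case (elim x)
      then show ?case using pos[of x] by (auto simp: dist_norm)
    qed
    then have "emeasure lborel (ball (0::real^'n) r) = 0"
      using AE_iff_measurable[of "ball (0::real^'n) r" lborel "\<lambda>x. x \<notin> ball 0 r"]
      by (auto simp: set_eq_iff)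
    then show False using assms unit_ball_vol_pos[of "real CARD('n)"] by (simp add: emeasure_ball)
  qed
  then have Z: "0 < (\<integral>x. g x \<partial>lborel)" using g0 by (simp add: less_le integral_nonneg)
  show thesis
  proof (rule that[of "\<lambda>x. (1 / (\<integral>x. g x \<partial>lborel)) * g x"])
    show "Ck k (\<lambda>x. (1 / (\<integral>x. g x \<partial>lborel)) * g x)" for k by (intro Ck_mult Ck_const Ck_g)
  qed (use Z g0 supp ig in auto)
qed

text \<open>
  Convolution of $G$ with the reflection of $\rho$. In this form the function becomes an average of
  translates of $G$ without reflecting the variable of integration.
\<close>

definition smear :: "('a::euclidean_space \<Rightarrow> real) \<Rightarrow> ('a \<Rightarrow> real) \<Rightarrow> 'a \<Rightarrow> real" where
  "smear \<rho> G x = (\<integral>y. \<rho> (y - x) * G y \<partial>lborel)"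

lemma compact_supp_bounded:
  fixes f :: "'a::euclidean_space \<Rightarrow> real"
  assumes "continuous_on UNIV f" "\<And>x. r < norm x \<Longrightarrow> f x = 0"
  obtains B where "0 \<le> B" "\<And>x. \<bar>f x\<bar> \<le> B"
proof -
  have "compact (f ` cball 0 r)"
    by (intro compact_continuous_image continuous_on_subset[OF assms(1)]) auto
  then obtain B where B: "\<And>x. x \<in> cball 0 r \<Longrightarrow> \<bar>f x\<bar> \<le> B"
    by (fastforce dest!: compact_imp_bounded simp: bounded_iff)
  show thesis
  proof (rule that[of "max 0 B"])
    show "\<bar>f x\<bar> \<le> max 0 B" for x
      using B[of x] assms(2)[of x] by (cases "norm x \<le> r") auto
  qed simp
qed

text \<open>
  Difference quotients of $\rho$ are bounded by its Lipschitz constant, so dominated convergence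
  applies with a multiple of $|G|$ as a majorant.
\<close>

lemma smear_has_derivative:
  fixes \<rho> G :: "real^'n \<Rightarrow> real"
  assumes \<rho>: "Ck 1 \<rho>" and supp: "\<And>x. r < norm x \<Longrightarrow> \<rho> x = 0" and G: "integrable lborel G"
  shows "(smear \<rho> G has_derivative
    (\<lambda>h. \<Sum>i\<in>UNIV. h $ i * smear (\<lambda>z. - frechet_derivative \<rho> (at z) (axis i 1)) G x)) (at x)"
    and "\<And>i z. r < norm z \<Longrightarrow> frechet_derivative \<rho> (at z) (axis i 1) = 0"
proof -
  define P where "P i z = frechet_derivative \<rho> (at z) (axis i 1)" for i z
  have P_cont: "continuous_on UNIV (P i)" for i using \<rho> by (simp add: P_def)
  have d0: "(\<rho> has_derivative frechet_derivative \<rho> (at z)) (at z)" for z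
    using Ck_Suc_has_derivative[of 0 \<rho>] \<rho> by simp
  have supp': "frechet_derivative \<rho> (at z) = (\<lambda>h. 0)" if "r < norm z" for z
  proof -
    have "open {z::real^'n. r < norm z}" by (intro open_Collect_less continuous_intros)
    then have "((\<lambda>z. 0) has_derivative frechet_derivative \<rho> (at z)) (at z)"
      using that supp by (intro has_derivative_transform_within_open[OF d0]) auto
    then show ?thesis using has_derivative_const has_derivative_unique by blast
  qed
  then show "frechet_derivative \<rho> (at z) (axis i 1) = 0" if "r < norm z" for i z
    using that by simp
  have lin: "frechet_derivative \<rho> (at z) h = (\<Sum>i\<in>UNIV. h $ i * P i z)" for z h
  proof -
    have l: "linear (frechet_derivative \<rho> (at z))"
      using d0 has_derivative_linear by blast
    have "frechet_derivative \<rho> (at z) h = frechet_derivative \<rho> (at z) (\<Sum>i\<in>UNIV. h $ i *\<^sub>R axis i 1)"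
      using basis_expansion[of h] by (simp add: scalar_mult_eq_scaleR)
    also have "\<dots> = (\<Sum>i\<in>UNIV. h $ i * P i z)"
      by (simp add: linear_sum[OF l] linear_scale[OF l] P_def)
    finally show ?thesis .
  qed
  have "\<forall>i. \<exists>B\<ge>0. \<forall>z. \<bar>P i z\<bar> \<le> B"
    using compact_supp_bounded[OF P_cont] supp' by (metis P_def)
  then obtain B where B: "\<And>i. 0 \<le> B i" "\<And>i z. \<bar>P i z\<bar> \<le> B i" by metis
  define L where "L = (\<Sum>i\<in>UNIV. B i)"
  have L: "0 \<le> L" unfolding L_def by (intro sum_nonneg B)
  have D_le: "\<bar>\<Sum>i\<in>UNIV. h $ i * P i z\<bar> \<le> L * norm h" for h z
  proof -
    have "\<bar>\<Sum>i\<in>UNIV. h $ i * P i z\<bar> \<le> (\<Sum>i\<in>UNIV. norm h * B i)"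
      by (rule order_trans[OF sum_abs], rule sum_mono)
        (simp add: abs_mult component_le_norm_cart B mult_mono)
    then show ?thesis by (simp add: L_def sum_distrib_left mult.commute)
  qed
  have lip: "\<bar>\<rho> a - \<rho> b\<bar> \<le> L * norm (a - b)" for a b
  proof -
    have "norm (\<rho> a - \<rho> b) \<le> L * norm (a - b)"
    proof (rule differentiable_bound[OF convex_UNIV])
      show "(\<rho> has_derivative frechet_derivative \<rho> (at z)) (at z within UNIV)" for z by (simp add: d0)
      show "onorm (frechet_derivative \<rho> (at z)) \<le> L" for z
        by (rule onorm_le) (simp add: lin D_le)
    qed auto
    then show ?thesis by simp
  qed
  have \<rho>_cont: "continuous_on UNIV \<rho>" using Ck_SucD[of 0 \<rho>] \<rho> by simp
  have [measurable]: "\<rho> \<in> borel_measurable borel" "G \<in> borel_measurable borel" "P i \<in> borel_measurable borel" for i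
    using \<rho>_cont P_cont G borel_measurable_integrable[OF G] by (auto intro: borel_measurable_continuous_onI)
  obtain B0 where B0: "0 \<le> B0" "\<And>z. \<bar>\<rho> z\<bar> \<le> B0"
    using compact_supp_bounded[OF \<rho>_cont supp] by blast
  have i\<rho>: "integrable lborel (\<lambda>y. \<rho> (y - a) * G y)" for a
    by (rule Bochner_Integration.integrable_bound[OF integrable_mult_right[OF G, of B0]])
      (auto simp: abs_mult B0 intro!: AE_I2 mult_mono)
  have iP: "integrable lborel (\<lambda>y. P i (y - a) * G y)" for a i
    by (rule Bochner_Integration.integrable_bound[OF integrable_mult_right[OF G, of "B i"]])
      (auto simp: abs_mult B intro!: AE_I2 mult_mono)
  let ?D = "\<lambda>h. \<Sum>i\<in>UNIV. h $ i * smear (\<lambda>z. - P i z) G x"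
  have "(smear \<rho> G has_derivative ?D) (at x)"
    unfolding has_derivative_at
  proof (intro conjI)
    show "bounded_linear ?D"
      by (intro bounded_linear_sum bounded_linear_mult_const bounded_linear_vec_nth)
    show "((\<lambda>h. norm (smear \<rho> G (x + h) - smear \<rho> G x - ?D h) / norm h) \<longlongrightarrow> 0) (at 0)"
      unfolding tendsto_at_iff_sequentially
    proof (intro allI impI)
      fix X :: "nat \<Rightarrow> real^'n" assume X: "\<forall>i. X i \<in> UNIV - {0}" "X \<longlonglongrightarrow> 0"
      define R where "R n y = (\<rho> (y - x - X n) - \<rho> (y - x) + (\<Sum>i\<in>UNIV. X n $ i * P i (y - x))) / norm (X n) * G y" for n y
      have "(\<lambda>n. \<integral>y. R n y \<partial>lborel) \<longlonglongrightarrow> (\<integral>y. 0 \<partial>(lborel :: (real^'n) measure))"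
      proof (rule integral_dominated_convergence)
        show "integrable lborel (\<lambda>y. 2 * L * \<bar>G y\<bar>)" using G by simp
        show "R n \<in> borel_measurable lborel" for n unfolding R_def by measurable
        show "AE y in lborel. (\<lambda>n. R n y) \<longlonglongrightarrow> 0"
        proof (rule AE_I2)
          fix y
          have "((\<lambda>h. norm (\<rho> (y - x + h) - \<rho> (y - x) - frechet_derivative \<rho> (at (y - x)) h) / norm h) \<longlongrightarrow> 0) (at 0)"
            using d0[of "y - x"] unfolding has_derivative_at by blast
          moreover have "\<forall>i. - X i \<in> UNIV - {0}" "(\<lambda>n. - X n) \<longlonglongrightarrow> 0"
            using X tendsto_minus[OF X(2)] by auto
          ultimately have "(\<lambda>n. norm (\<rho> (y - x + - X n) - \<rho> (y - x) - frechet_derivative \<rho> (at (y - x)) (- X n)) / norm (- X n)) \<longlonglongrightarrow> 0"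
            unfolding tendsto_at_iff_sequentially comp_def by (elim allE[of _ "\<lambda>n. - X n"] impE) blast+
          then have "(\<lambda>n. \<bar>(\<rho> (y - x - X n) - \<rho> (y - x) + (\<Sum>i\<in>UNIV. X n $ i * P i (y - x))) / norm (X n)\<bar>) \<longlonglongrightarrow> 0"
            by (simp add: lin sum_negf)
          then have "(\<lambda>n. (\<rho> (y - x - X n) - \<rho> (y - x) + (\<Sum>i\<in>UNIV. X n $ i * P i (y - x))) / norm (X n)) \<longlonglongrightarrow> 0"
            by (rule tendsto_rabs_zero_cancel)
          then show "(\<lambda>n. R n y) \<longlonglongrightarrow> 0"
            unfolding R_def by (rule tendsto_mult_left_zero)
        qed
        show "AE y in lborel. norm (R n y) \<le> 2 * L * \<bar>G y\<bar>" for n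
        proof (rule AE_I2)
          fix y
          have "\<bar>\<rho> (y - x - X n) - \<rho> (y - x) + (\<Sum>i\<in>UNIV. X n $ i * P i (y - x))\<bar> \<le> 2 * L * norm (X n)"
            using lip[of "y - x - X n" "y - x"] D_le[of "X n" "y - x"] by simp
          then have "\<bar>\<rho> (y - x - X n) - \<rho> (y - x) + (\<Sum>i\<in>UNIV. X n $ i * P i (y - x))\<bar> / norm (X n) \<le> 2 * L"
            using X(1) by (simp add: divide_le_eq)
          then show "norm (R n y) \<le> 2 * L * \<bar>G y\<bar>"
            unfolding R_def real_norm_def abs_mult abs_divide by (intro mult_right_mono) auto
        qed
      qed simp
      then have "(\<lambda>n. \<bar>\<integral>y. R n y \<partial>lborel\<bar>) \<longlonglongrightarrow> 0" by (simp add: tendsto_rabs_zero)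
      moreover have "\<bar>\<integral>y. R n y \<partial>lborel\<bar> = norm (smear \<rho> G (x + X n) - smear \<rho> G x - ?D (X n)) / norm (X n)" for n
      proof -
        have "(\<integral>y. R n y \<partial>lborel) = (\<integral>y. (\<rho> (y - (x + X n)) * G y - \<rho> (y - x) * G y
            + (\<Sum>i\<in>UNIV. X n $ i * (P i (y - x) * G y))) / norm (X n) \<partial>lborel)"
          unfolding R_def
          by (intro Bochner_Integration.integral_cong refl)
            (simp add: field_simps sum_distrib_right sum_distrib_left diff_diff_eq)
        also have "\<dots> = (smear \<rho> G (x + X n) - smear \<rho> G x + (\<Sum>i\<in>UNIV. X n $ i * (\<integral>y. P i (y - x) * G y \<partial>lborel))) / norm (X n)"
          using i\<rho> iP unfolding smear_def by simp
        also have "(\<Sum>i\<in>UNIV. X n $ i * (\<integral>y. P i (y - x) * G y \<partial>lborel)) = - ?D (X n)"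
          by (simp add: smear_def sum_negf)
        finally show ?thesis by simp
      qed
      ultimately show "((\<lambda>h. norm (smear \<rho> G (x + h) - smear \<rho> G x - ?D h) / norm h) \<circ> X) \<longlonglongrightarrow> 0"
        by (simp add: comp_def)
    qed
  qed
  then show "(smear \<rho> G has_derivative
    (\<lambda>h. \<Sum>i\<in>UNIV. h $ i * smear (\<lambda>z. - frechet_derivative \<rho> (at z) (axis i 1)) G x)) (at x)"
    by (simp add: P_def)
qed

lemma Ck_smear:
  fixes \<rho> G :: "real^'n \<Rightarrow> real"
  assumes "\<And>k. Ck k \<rho>" "\<And>x. r < norm x \<Longrightarrow> \<rho> x = 0" and G: "integrable lborel G"
  shows "Ck k (smear \<rho> G)"
  using assms(1,2)
proof (induction k arbitrary: \<rho>)
  case 0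
  have "continuous_on UNIV (smear \<rho> G)"
    using smear_has_derivative(1)[OF 0(1) 0(2) G]
    by (intro differentiable_imp_continuous_on) (auto simp: differentiable_on_def differentiable_def)
  then show ?case by simp
next
  case (Suc k)
  note d = smear_has_derivative[OF Suc.prems(1) Suc.prems(2) G]
  show ?case
  proof (rule Ck_SucI[OF d(1)])
    fix i :: 'n
    have "Ck l (\<lambda>z. frechet_derivative \<rho> (at z) (axis i 1))" for l
      using Suc.prems(1)[of "Suc l"] by simp
    then have "Ck l (\<lambda>z. - 1 * frechet_derivative \<rho> (at z) (axis i 1))" for l
      by (intro Ck_mult Ck_const)
    then have "Ck k (smear (\<lambda>z. - frechet_derivative \<rho> (at z) (axis i 1)) G)"
      using d(2) by (intro Suc.IH) auto
    moreover have "(\<Sum>j\<in>UNIV. axis i 1 $ j * smear (\<lambda>z. - frechet_derivative \<rho> (at z) (axis j 1)) G x)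
      = smear (\<lambda>z. - frechet_derivative \<rho> (at z) (axis i 1)) G x" for x
      by (simp add: axis_def if_distrib[of "\<lambda>a. a * _"] cong: if_cong)
    ultimately show "Ck k (\<lambda>x. \<Sum>j\<in>UNIV. axis i 1 $ j * smear (\<lambda>z. - frechet_derivative \<rho> (at z) (axis j 1)) G x)"
      by simp
  qed
qed

section \<open>Approximation by test functions\<close>

text \<open>
  Jensen's inequality for the square, from the nonnegativity of the variance.
\<close>

lemma ennreal_square_mean_le:
  fixes \<rho> X :: "'a::euclidean_space \<Rightarrow> real"
  assumes \<rho>: "\<And>z. 0 \<le> \<rho> z" "integrable lborel \<rho>" "(\<integral>z. \<rho> z \<partial>lborel) = 1"
    and X: "X \<in> borel_measurable borel" "\<And>z. \<bar>X z\<bar> \<le> B"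
  shows "ennreal ((\<integral>z. \<rho> z * X z \<partial>lborel)\<^sup>2) \<le> (\<integral>\<^sup>+z. ennreal (\<rho> z * (X z)\<^sup>2) \<partial>lborel)"
proof -
  have [measurable]: "\<rho> \<in> borel_measurable borel" "X \<in> borel_measurable borel"
    using borel_measurable_integrable[OF \<rho>(2)] X by auto
  define m where "m = (\<integral>z. \<rho> z * X z \<partial>lborel)"
  have B: "0 \<le> B" using X(2)[of 0] abs_ge_zero[of "X 0"] by linarith
  have i1: "integrable lborel (\<lambda>z. \<rho> z * X z)"
  proof (rule Bochner_Integration.integrable_bound[OF integrable_mult_right[OF \<rho>(2), of B]])
    show "AE z in lborel. norm (\<rho> z * X z) \<le> norm (B * \<rho> z)"
      using mult_right_mono[OF X(2) \<rho>(1)] \<rho>(1) B by (intro AE_I2) (simp add: abs_mult mult.commute)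
  qed measurable
  have sq: "(X z)\<^sup>2 \<le> B\<^sup>2" for z using power_mono[OF X(2) abs_ge_zero, of z 2] by simp
  have i2: "integrable lborel (\<lambda>z. \<rho> z * (X z)\<^sup>2)"
  proof (rule Bochner_Integration.integrable_bound[OF integrable_mult_right[OF \<rho>(2), of "B\<^sup>2"]])
    show "AE z in lborel. norm (\<rho> z * (X z)\<^sup>2) \<le> norm (B\<^sup>2 * \<rho> z)"
      using mult_right_mono[OF sq \<rho>(1)] \<rho>(1) by (intro AE_I2) (simp add: abs_mult mult.commute)
  qed measurable
  have "0 \<le> (\<integral>z. \<rho> z * (X z - m)\<^sup>2 \<partial>lborel)" using \<rho>(1) by (intro integral_nonneg_AE AE_I2) simp
  also have "\<dots> = (\<integral>z. \<rho> z * (X z)\<^sup>2 - 2 * m * (\<rho> z * X z) + m\<^sup>2 * \<rho> z \<partial>lborel)"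
    by (intro Bochner_Integration.integral_cong refl) (simp add: power2_eq_square algebra_simps)
  also have "\<dots> = (\<integral>z. \<rho> z * (X z)\<^sup>2 \<partial>lborel) - 2 * m * m + m\<^sup>2"
    using i1 i2 \<rho> by (simp add: m_def)
  finally have "m\<^sup>2 \<le> (\<integral>z. \<rho> z * (X z)\<^sup>2 \<partial>lborel)" by (simp add: power2_eq_square)
  moreover have "(\<integral>\<^sup>+z. ennreal (\<rho> z * (X z)\<^sup>2) \<partial>lborel) = ennreal (\<integral>z. \<rho> z * (X z)\<^sup>2 \<partial>lborel)"
    using \<rho>(1) by (intro nn_integral_eq_integral i2) auto
  ultimately show ?thesis by (simp add: m_def ennreal_leI)
qed

lemma smear_shift:
  fixes \<rho> G :: "'a::euclidean_space \<Rightarrow> real"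
  assumes "\<rho> \<in> borel_measurable borel" "G \<in> borel_measurable borel" "\<And>x. integrable lborel (\<lambda>z. \<rho> z * G (x + z))"
  shows "smear \<rho> G x = (\<integral>z. \<rho> z * G (x + z) \<partial>lborel)"
proof -
  have "(\<integral>y. \<rho> (y + - x) * G (x + (y + - x)) \<partial>lborel) = (\<integral>z. \<rho> z * G (x + z) \<partial>lborel)"
    by (rule integral_lborel_shift[OF assms(3)])
  then show ?thesis by (simp add: smear_def)
qed

text \<open>
  Continuity of translations is stated along sequences; averaging over a mollifier needs it
  uniformly in a ball.
\<close>

lemma sequential_epsilon_delta:
  fixes F :: "'a::real_normed_vector \<Rightarrow> real"
  assumes "\<And>z. z \<longlonglongrightarrow> 0 \<Longrightarrow> (\<lambda>n. F (z n)) \<longlonglongrightarrow> 0" and "0 < e"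
  obtains d where "0 < d" "\<And>z. norm z \<le> d \<Longrightarrow> F z < e"
proof -
  have "\<exists>d>0. \<forall>z. norm z \<le> d \<longrightarrow> F z < e"
  proof (rule ccontr)
    assume "\<not> ?thesis"
    then have "\<forall>n::nat. \<exists>z. norm z \<le> 1 / (real n + 1) \<and> e \<le> F z"
      by (metis add_strict_increasing2 of_nat_0_le_iff not_less zero_less_divide_1_iff zero_less_one)
    then obtain z where z: "\<And>n::nat. norm (z n) \<le> 1 / (real n + 1)" "\<And>n. e \<le> F (z n)"
      by metis
    have "z \<longlonglongrightarrow> 0"
      using z(1) by (intro Lim_null_comparison[OF _ LIMSEQ_inverse_real_of_nat] always_eventually allI)
        (simp add: inverse_eq_divide add.commute)
    from assms(1)[OF this] have "\<forall>\<^sub>F n in sequentially. F (z n) < e"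
      using \<open>0 < e\<close> by (rule order_tendstoD)
    then show False using z(2) by (auto simp: eventually_sequentially not_less[symmetric])
  qed
  then show thesis using that by blast
qed

text \<open>
  The mollified function minus $G$ is an average of the differences of $G$ and its translates. By
  Jensen's inequality its energy, and its norm in $L^1$, is at most the supremum of those of the
  differences over small translations.
\<close>

lemma smooth_approximation:
  fixes G :: "real^'n \<Rightarrow> real"
  assumes G: "finite_energy s G" "integrable lborel G" "\<And>x. 0 \<le> G x" "\<And>x. G x \<le> h"
    and e: "0 < e"
  obtains \<rho> :: "real^'n \<Rightarrow> real" where
    "\<And>k. Ck k (smear \<rho> G)" "\<And>x. 0 \<le> smear \<rho> G x" "\<And>x. smear \<rho> G x \<le> h"
    "\<And>x. (\<And>z. norm z \<le> e \<Longrightarrow> G (x + z) = 0) \<Longrightarrow> smear \<rho> G x = 0"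
    "finite_energy s (\<lambda>x. smear \<rho> G x - G x)"
    "gform s (\<lambda>x. smear \<rho> G x - G x) (\<lambda>x. smear \<rho> G x - G x) \<le> e"
    "integrable lborel (\<lambda>x. smear \<rho> G x - G x)" "(\<integral>x. \<bar>smear \<rho> G x - G x\<bar> \<partial>lborel) \<le> e"
proof -
  have [measurable]: "G \<in> borel_measurable borel" using G(1) by (simp add: finite_energy_def)
  have h: "0 \<le> h" using G(3,4)[of 0] by linarith
  obtain d1 where d1: "0 < d1"
    "\<And>z. norm z \<le> d1 \<Longrightarrow> gform s (\<lambda>x. G (x + z) - G x) (\<lambda>x. G (x + z) - G x) < e"
    using sequential_epsilon_delta[of "\<lambda>z. gform s (\<lambda>x. G (x + z) - G x) (\<lambda>x. G (x + z) - G x)" e]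
      tendsto_shift_energy[OF G(1)] e by blast
  obtain d2 where d2: "0 < d2"
    "\<And>z. norm z \<le> d2 \<Longrightarrow> (\<integral>x. \<bar>G (x + z) - G x\<bar> \<partial>lborel) < e"
    using sequential_epsilon_delta[of "\<lambda>z. \<integral>x. \<bar>G (x + z) - G x\<bar> \<partial>lborel" e]
      tendsto_shift_L1[OF G(2)] e by blast
  define r where "r = min e (min d1 d2)"
  have r: "0 < r" using e d1 d2 by (simp add: r_def)
  obtain \<rho> :: "real^'n \<Rightarrow> real" where \<rho>:
    "\<And>k. Ck k \<rho>" "\<And>x. 0 \<le> \<rho> x" "\<And>x. r < norm x \<Longrightarrow> \<rho> x = 0" "integrable lborel \<rho>" "(\<integral>x. \<rho> x \<partial>lborel) = 1"
    using smooth_mollifier_exists[OF r] by blast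
  have [measurable]: "\<rho> \<in> borel_measurable borel"
    using borel_measurable_integrable[OF \<rho>(4)] by simp
  have iG: "integrable lborel (\<lambda>z. \<rho> z * G (x + z))" for x
  proof (rule Bochner_Integration.integrable_bound[OF integrable_mult_right[OF \<rho>(4), of h]])
    show "AE z in lborel. norm (\<rho> z * G (x + z)) \<le> norm (h * \<rho> z)"
      using mult_left_mono[OF G(4) \<rho>(2)] \<rho>(2) G(3) h by (intro AE_I2) (simp add: abs_mult mult.commute[of h])
  qed measurable
  let ?\<phi> = "smear \<rho> G"
  have \<phi>: "?\<phi> x = (\<integral>z. \<rho> z * G (x + z) \<partial>lborel)" for x
    by (rule smear_shift) (auto intro: iG)
  have Ck: "Ck k ?\<phi>" for k by (rule Ck_smear[OF \<rho>(1,3) G(2)])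
  have [measurable]: "?\<phi> \<in> borel_measurable borel"
    using Ck[of 0] by (auto intro: borel_measurable_continuous_onI)
  have \<phi>0: "0 \<le> ?\<phi> x" for x unfolding \<phi> using \<rho>(2) G(3) by (intro integral_nonneg_AE AE_I2) simp
  have \<phi>h: "?\<phi> x \<le> h" for x
  proof -
    have "?\<phi> x \<le> (\<integral>z. h * \<rho> z \<partial>lborel)" unfolding \<phi>
    proof (intro integral_mono iG integrable_mult_right \<rho>(4))
      show "\<rho> z * G (x + z) \<le> h * \<rho> z" for z
        using mult_left_mono[OF G(4) \<rho>(2), of z "x + z"] by (simp only: mult.commute[of h])
    qed
    then show ?thesis by (simp add: \<rho>(5))
  qed
  have \<phi>supp: "?\<phi> x = 0" if "\<And>z. norm z \<le> e \<Longrightarrow> G (x + z) = 0" for x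
  proof -
    have "\<rho> z * G (x + z) = 0" for z
      using that[of z] \<rho>(3)[of z] by (cases "norm z \<le> e") (auto simp: r_def)
    then have "(\<lambda>z. \<rho> z * G (x + z)) = (\<lambda>z. 0)" by auto
    then show ?thesis by (simp only: \<phi>) simp
  qed
  have diff: "?\<phi> x - G x = (\<integral>z. \<rho> z * (G (x + z) - G x) \<partial>lborel)" for x
    using iG \<rho>(4,5) by (simp add: \<phi> right_diff_distrib)
  have i\<rho>X: "integrable lborel (\<lambda>z. \<rho> z * (G (x + z) - G x))" for x
    using iG \<rho>(4) by (simp add: right_diff_distrib)
  let ?d = "\<lambda>x. ?\<phi> x - G x"
  let ?t = "\<lambda>z x. G (x + z) - G x"
  have nn\<rho>: "(\<integral>\<^sup>+z. ennreal (\<rho> z) * ennreal e \<partial>lborel) = ennreal e"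
    using nn_integral_eq_integral[OF \<rho>(4)] \<rho>(2,5) by (simp add: nn_integral_multc)
  have energy: "(\<integral>\<^sup>+p. ennreal ((diff_quot s ?d p)\<^sup>2) \<partial>lborel) \<le> ennreal e"
  proof -
    have pt: "ennreal ((diff_quot s ?d p)\<^sup>2) \<le> (\<integral>\<^sup>+z. ennreal (\<rho> z * (diff_quot s (?t z) p)\<^sup>2) \<partial>lborel)" for p
    proof (cases p)
      case (Pair x y)
      let ?n = "norm (x - y) powr ((real DIM(real^'n) + 2 * s) / 2)"
      have "diff_quot s ?d p = ((\<integral>z. \<rho> z * ?t z x \<partial>lborel) - (\<integral>z. \<rho> z * ?t z y \<partial>lborel)) / ?n"
        by (simp add: Pair diff_quot_def flip: diff)
      also have "\<dots> = (\<integral>z. (\<rho> z * ?t z x - \<rho> z * ?t z y) / ?n \<partial>lborel)"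
        using i\<rho>X by simp
      also have "\<dots> = (\<integral>z. \<rho> z * diff_quot s (?t z) p \<partial>lborel)"
        by (simp add: Pair diff_quot_def right_diff_distrib)
      finally have eq: "diff_quot s ?d p = (\<integral>z. \<rho> z * diff_quot s (?t z) p \<partial>lborel)" .
      have bd: "\<bar>diff_quot s (?t z) p\<bar> \<le> 4 * h / ?n" for z
      proof -
        have "\<bar>?t z x - ?t z y\<bar> \<le> 4 * h"
          using G(3,4)[of "x + z"] G(3,4)[of x] G(3,4)[of "y + z"] G(3,4)[of y] by (simp add: abs_if)
        then show ?thesis by (simp add: Pair diff_quot_def divide_right_mono)
      qed
      have ms: "(\<lambda>z. diff_quot s (?t z) p) \<in> borel_measurable borel"
        unfolding Pair diff_quot_def by measurable
      show ?thesis by (subst eq) (rule ennreal_square_mean_le[OF \<rho>(2,4,5) ms bd])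
    qed
    have m: "(\<lambda>(p, z). ennreal (\<rho> z * (diff_quot s (?t z) p)\<^sup>2)) \<in> borel_measurable (lborel \<Otimes>\<^sub>M lborel)"
    proof -
      have "(\<lambda>(p, z). ennreal (\<rho> z * (diff_quot s (?t z) p)\<^sup>2)) \<in> borel_measurable ((borel \<Otimes>\<^sub>M borel) \<Otimes>\<^sub>M borel)"
        unfolding diff_quot_def by measurable
      then show ?thesis by (simp add: borel_prod lborel_prod)
    qed
    have "(\<integral>\<^sup>+p. ennreal ((diff_quot s ?d p)\<^sup>2) \<partial>lborel)
       \<le> (\<integral>\<^sup>+p. \<integral>\<^sup>+z. ennreal (\<rho> z * (diff_quot s (?t z) p)\<^sup>2) \<partial>lborel \<partial>lborel)"
      by (intro nn_integral_mono pt)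
    also have "\<dots> = (\<integral>\<^sup>+z. \<integral>\<^sup>+p. ennreal (\<rho> z * (diff_quot s (?t z) p)\<^sup>2) \<partial>lborel \<partial>lborel)"
      using lborel_pair.Fubini'[OF m] by simp
    also have "\<dots> \<le> (\<integral>\<^sup>+z. ennreal (\<rho> z) * ennreal e \<partial>lborel)"
    proof (rule nn_integral_mono)
      fix z
      have fe: "finite_energy s (?t z)" by (intro finite_energy_diff finite_energy_shift G(1))
      have [measurable]: "?t z \<in> borel_measurable borel" by measurable
      have "(\<integral>\<^sup>+p. ennreal (\<rho> z * (diff_quot s (?t z) p)\<^sup>2) \<partial>lborel)
          = ennreal (\<rho> z) * (\<integral>\<^sup>+p. ennreal ((diff_quot s (?t z) p)\<^sup>2) \<partial>lborel)"
        using \<rho>(2) by (simp add: ennreal_mult nn_integral_cmult)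
      also have "\<dots> = ennreal (\<rho> z) * ennreal (gform s (?t z) (?t z))"
        by (simp add: ennreal_gform[OF fe])
      also have "\<dots> \<le> ennreal (\<rho> z) * ennreal e"
      proof (cases "norm z \<le> r")
        case True
        then show ?thesis using d1(2)[of z] by (intro mult_left_mono ennreal_leI) (auto simp: r_def)
      qed (simp add: \<rho>(3))
      finally show "(\<integral>\<^sup>+p. ennreal (\<rho> z * (diff_quot s (?t z) p)\<^sup>2) \<partial>lborel) \<le> ennreal (\<rho> z) * ennreal e" .
    qed
    also have "\<dots> = ennreal e" by (rule nn\<rho>)
    finally show ?thesis .
  qed
  have fe: "finite_energy s ?d"
  proof (rule finite_energyI_nn)
    show "?d \<in> borel_measurable borel" by measurable
    show "(\<integral>\<^sup>+p. ennreal ((diff_quot s ?d p)\<^sup>2) \<partial>lborel) < \<infinity>"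
      using energy by (rule order_le_less_trans) simp
  qed
  have ge: "gform s ?d ?d \<le> e" using energy e unfolding ennreal_gform[OF fe] by simp
  have L1: "(\<integral>\<^sup>+x. ennreal \<bar>?d x\<bar> \<partial>lborel) \<le> ennreal e"
  proof -
    have pt: "ennreal \<bar>?d x\<bar> \<le> (\<integral>\<^sup>+z. ennreal (\<rho> z * \<bar>?t z x\<bar>) \<partial>lborel)" for x
    proof -
      have "\<bar>?d x\<bar> \<le> (\<integral>z. \<bar>\<rho> z * ?t z x\<bar> \<partial>lborel)" unfolding diff by (rule integral_abs_bound)
      then have "ennreal \<bar>?d x\<bar> \<le> ennreal (\<integral>z. \<bar>\<rho> z * ?t z x\<bar> \<partial>lborel)" by (rule ennreal_leI)
      also have "\<dots> = (\<integral>\<^sup>+z. ennreal \<bar>\<rho> z * ?t z x\<bar> \<partial>lborel)"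
        by (rule nn_integral_eq_integral[symmetric, OF Bochner_Integration.integrable_abs[OF i\<rho>X]]) simp
      finally show ?thesis using \<rho>(2) by (simp add: abs_mult)
    qed
    have "(\<integral>\<^sup>+x. ennreal \<bar>?d x\<bar> \<partial>lborel) \<le> (\<integral>\<^sup>+x. \<integral>\<^sup>+z. ennreal (\<rho> z * \<bar>?t z x\<bar>) \<partial>lborel \<partial>lborel)"
      by (intro nn_integral_mono pt)
    also have "\<dots> = (\<integral>\<^sup>+z. \<integral>\<^sup>+x. ennreal (\<rho> z * \<bar>?t z x\<bar>) \<partial>lborel \<partial>lborel)"
      by (rule lborel_pair.Fubini'[symmetric]) measurable
    also have "\<dots> \<le> (\<integral>\<^sup>+z. ennreal (\<rho> z) * ennreal e \<partial>lborel)"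
    proof (rule nn_integral_mono)
      fix z
      have i: "integrable lborel (\<lambda>x. \<bar>?t z x\<bar>)" using integrable_lborel_shift[OF G(2)] G(2) by auto
      have "(\<integral>\<^sup>+x. ennreal (\<rho> z * \<bar>?t z x\<bar>) \<partial>lborel) = ennreal (\<rho> z) * (\<integral>\<^sup>+x. ennreal \<bar>?t z x\<bar> \<partial>lborel)"
        using \<rho>(2) by (simp add: ennreal_mult nn_integral_cmult)
      also have "\<dots> = ennreal (\<rho> z) * ennreal (\<integral>x. \<bar>?t z x\<bar> \<partial>lborel)"
        by (simp add: nn_integral_eq_integral[OF i])
      also have "\<dots> \<le> ennreal (\<rho> z) * ennreal e"
      proof (cases "norm z \<le> r")
        case True
        then show ?thesis using d2(2)[of z] by (intro mult_left_mono ennreal_leI) (auto simp: r_def)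
      qed (simp add: \<rho>(3))
      finally show "(\<integral>\<^sup>+x. ennreal (\<rho> z * \<bar>?t z x\<bar>) \<partial>lborel) \<le> ennreal (\<rho> z) * ennreal e" .
    qed
    also have "\<dots> = ennreal e" by (rule nn\<rho>)
    finally show ?thesis .
  qed
  have id: "integrable lborel ?d"
    using L1 by (intro integrableI_bounded) (auto intro: order_le_less_trans)
  have L1': "(\<integral>x. \<bar>?d x\<bar> \<partial>lborel) \<le> e"
    using L1 e nn_integral_eq_integral[OF Bochner_Integration.integrable_abs[OF id]] by simp
  show thesis
    by (rule that[of \<rho>]) (fact Ck \<phi>0 \<phi>h \<phi>supp fe ge id L1')+
qed

text \<open>
  Convergence in $L^1$ is used to pass to a subsequence that converges almost everywhere, so that
  dominated convergence applies to the right-hand side of the weak formulation.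
\<close>

lemma test_functions_approximation:
  fixes G :: "real^'n \<Rightarrow> real"
  assumes G: "finite_energy s G" "\<And>x. 0 \<le> G x" "\<And>x. G x \<le> h"
    and K: "compact K" "K \<subseteq> \<Omega>" "open \<Omega>" "\<And>x. x \<notin> K \<Longrightarrow> G x = 0"
  obtains K' \<phi> where "compact K'" "K' \<subseteq> \<Omega>" "\<And>n. \<phi> n \<in> test_functions \<Omega>"
    "\<And>n x. 0 \<le> \<phi> n x" "\<And>n x. \<phi> n x \<le> h" "\<And>n x. x \<notin> K' \<Longrightarrow> \<phi> n x = 0"
    "\<And>n. finite_energy s (\<phi> n)"
    "(\<lambda>n. gform s (\<lambda>x. \<phi> n x - G x) (\<lambda>x. \<phi> n x - G x)) \<longlonglongrightarrow> 0"
    "AE x in lborel. (\<lambda>n. \<phi> n x) \<longlonglongrightarrow> G x"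
proof -
  have [measurable]: "G \<in> borel_measurable borel" using G(1) by (simp add: finite_energy_def)
  have h: "0 \<le> h" using G(2,3)[of 0] by linarith
  have iG: "integrable lborel G"
  proof (rule Bochner_Integration.integrable_bound)
    have "emeasure lborel K < \<infinity>" using emeasure_bounded_finite[OF compact_imp_bounded[OF K(1)]] by simp
    then show "integrable lborel (\<lambda>x. h * indicator K x)"
      using K(1) by (intro integrable_mult_right) (simp add: integrable_indicator_iff borel_compact)
    show "AE x in lborel. norm (G x) \<le> norm (h * indicator K x)"
      using G(2,3) K(4) h by (intro AE_I2) (auto simp: indicator_def)
  qed simp
  obtain d where d: "0 < d" "(\<Union>x\<in>K. cball x d) \<subseteq> \<Omega>"
    using compact_subset_open_imp_cball_epsilon_subset[OF K(1,3,2)] by blast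
  \<comment> \<open>A common support for mollifications at all scales up to \<open>d\<close>.\<close>
  define K' where "K' = (\<Union>x\<in>K. \<Union>z\<in>cball 0 d. {x + z})"
  have K': "compact K'" unfolding K'_def by (intro compact_sums' K compact_cball)
  have K'\<Omega>: "K' \<subseteq> \<Omega>"
  proof -
    have "x + z \<in> cball x d" if "z \<in> cball 0 d" for x z :: "real^'n"
      using that by (simp add: dist_norm)
    then show ?thesis using d(2) unfolding K'_def by blast
  qed
  define e where "e n = d / (real n + 1)" for n :: nat
  have e: "0 < e n" "e n \<le> d" for n using d(1) by (auto simp: e_def field_simps)
  have elim0: "e \<longlonglongrightarrow> 0"
    using tendsto_mult_right_zero[OF LIMSEQ_inverse_real_of_nat, of d]
    by (simp add: e_def[abs_def] inverse_eq_divide add.commute)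
  define P where "P n \<psi> \<longleftrightarrow> (\<forall>k. Ck k \<psi>) \<and> (\<forall>x. 0 \<le> \<psi> x) \<and> (\<forall>x. \<psi> x \<le> h) \<and>
    (\<forall>x. (\<forall>z. norm z \<le> e n \<longrightarrow> G (x + z) = 0) \<longrightarrow> \<psi> x = 0) \<and>
    finite_energy s (\<lambda>x. \<psi> x - G x) \<and> gform s (\<lambda>x. \<psi> x - G x) (\<lambda>x. \<psi> x - G x) \<le> e n \<and>
    integrable lborel (\<lambda>x. \<psi> x - G x) \<and> (\<integral>x. \<bar>\<psi> x - G x\<bar> \<partial>lborel) \<le> e n" for n \<psi>
  have "\<exists>\<psi>. P n \<psi>" for n
  proof -
    obtain \<rho> :: "real^'n \<Rightarrow> real" where
      "\<And>k. Ck k (smear \<rho> G)" "\<And>x. 0 \<le> smear \<rho> G x" "\<And>x. smear \<rho> G x \<le> h"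
      "\<And>x. (\<And>z. norm z \<le> e n \<Longrightarrow> G (x + z) = 0) \<Longrightarrow> smear \<rho> G x = 0"
      "finite_energy s (\<lambda>x. smear \<rho> G x - G x)"
      "gform s (\<lambda>x. smear \<rho> G x - G x) (\<lambda>x. smear \<rho> G x - G x) \<le> e n"
      "integrable lborel (\<lambda>x. smear \<rho> G x - G x)" "(\<integral>x. \<bar>smear \<rho> G x - G x\<bar> \<partial>lborel) \<le> e n"
      using smooth_approximation[OF G(1) iG G(2,3) e(1)] by blast
    then have "P n (smear \<rho> G)" unfolding P_def by blast
    then show ?thesis by blast
  qed
  then obtain \<psi> where "\<And>n. P n (\<psi> n)" by metis
  then have \<psi>: "\<And>n k. Ck k (\<psi> n)" "\<And>n x. 0 \<le> \<psi> n x" "\<And>n x. \<psi> n x \<le> h"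
    "\<And>n x. \<forall>z. norm z \<le> e n \<longrightarrow> G (x + z) = 0 \<Longrightarrow> \<psi> n x = 0"
    "\<And>n. finite_energy s (\<lambda>x. \<psi> n x - G x)" "\<And>n. gform s (\<lambda>x. \<psi> n x - G x) (\<lambda>x. \<psi> n x - G x) \<le> e n"
    "\<And>n. integrable lborel (\<lambda>x. \<psi> n x - G x)" "\<And>n. (\<integral>x. \<bar>\<psi> n x - G x\<bar> \<partial>lborel) \<le> e n"
    unfolding P_def by blast+
  have supp: "\<psi> n x = 0" if "x \<notin> K'" for n x
  proof (rule \<psi>(4), intro allI impI)
    fix z :: "real^'n" assume z: "norm z \<le> e n"
    show "G (x + z) = 0"
    proof (rule K(4), rule notI)
      assume "x + z \<in> K"
      then have "(x + z) + (- z) \<in> K'" unfolding K'_def using z e(2)[of n]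
        by (intro UN_I[of "x + z"] UN_I[of "- z"]) auto
      then show False using that by simp
    qed
  qed
  have L1: "(\<lambda>n. \<integral>x. norm (\<psi> n x - G x) \<partial>lborel) \<longlonglongrightarrow> 0"
    using \<psi>(8) by (intro tendsto_sandwich[OF _ _ tendsto_const elim0] always_eventually allI) auto
  obtain r where r: "strict_mono r" "AE x in lborel. (\<lambda>n. \<psi> (r n) x - G x) \<longlonglongrightarrow> 0"
    using tendsto_L1_AE_subseq[of lborel "\<lambda>n x. \<psi> n x - G x"] \<psi>(7) L1 by blast
  have E: "(\<lambda>n. gform s (\<lambda>x. \<psi> n x - G x) (\<lambda>x. \<psi> n x - G x)) \<longlonglongrightarrow> 0"
    using \<psi>(6) by (intro tendsto_sandwich[OF _ _ tendsto_const elim0] always_eventually allI gform_nonneg)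
  show thesis
  proof (rule that[of K' "\<lambda>n. \<psi> (r n)"])
    show "\<psi> (r n) \<in> test_functions \<Omega>" for n
    proof -
      have "closure {x. \<psi> (r n) x \<noteq> 0} \<subseteq> K'"
        using supp compact_imp_closed[OF K'] by (intro closure_minimal) auto
      moreover from this have "compact (closure {x. \<psi> (r n) x \<noteq> 0})"
        using K' by (metis closed_closure compact_Int_closed inf.absorb_iff2)
      ultimately show ?thesis using K'\<Omega> \<psi>(1) unfolding test_functions_def by auto
    qed
    show "finite_energy s (\<psi> (r n))" for n
    proof -
      have "finite_energy s (\<lambda>x. G x - (G x - \<psi> (r n) x))"
      proof (rule finite_energy_diff[OF G(1)])
        have [measurable]: "\<psi> (r n) \<in> borel_measurable borel"
          using \<psi>(1)[of 0] by (auto intro: borel_measurable_continuous_onI)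
        show "finite_energy s (\<lambda>x. G x - \<psi> (r n) x)"
          by (rule finite_energy_contraction(1)[OF _ \<psi>(5)[of "r n"]]) auto
      qed
      then show ?thesis by simp
    qed
    show "(\<lambda>n. gform s (\<lambda>x. \<psi> (r n) x - G x) (\<lambda>x. \<psi> (r n) x - G x)) \<longlonglongrightarrow> 0"
      using LIMSEQ_subseq_LIMSEQ[OF E r(1)] by (simp add: comp_def)
    show "AE x in lborel. (\<lambda>n. \<psi> (r n) x) \<longlonglongrightarrow> G x"
      using r(2) by (auto simp: LIM_zero_iff)
  qed (fact K' K'\<Omega> \<psi>(2) \<psi>(3) supp)+
qed

section \<open>Testing with truncations: the role of the Lipschitz boundary\<close>

text \<open>
  The hypotheses on a weak solution in terms of Borel functions, with \<open>w\<close> for $f/u^\gamma$.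
\<close>

locale weak_form =
  fixes s c :: real and \<Omega> :: "(real^'n) set" and u w :: "real^'n \<Rightarrow> real"
  assumes s: "0 < s" "s < 1" and c: "0 < c"
    and \<Omega>: "open \<Omega>" "bounded \<Omega>" "has_lipschitz_boundary \<Omega>"
    and u: "finite_energy s u"
    and w: "w \<in> borel_measurable borel" "\<And>x. 0 \<le> w x"
    and w_loc: "\<And>K. compact K \<Longrightarrow> K \<subseteq> \<Omega> \<Longrightarrow> integrable lborel (\<lambda>x. indicator K x * w x)"
    and weak: "\<And>\<phi>. \<phi> \<in> test_functions \<Omega> \<Longrightarrow> (\<And>x. 0 \<le> \<phi> x) \<Longrightarrow>
       c * gform s u \<phi> = (\<integral>x. w x * \<phi> x \<partial>lborel)"
begin

text \<open>
  The approximating test functions are uniformly bounded and supported in a common compact subset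
  of \<open>\<Omega>\<close>, on which \<open>w\<close> is integrable.
\<close>

lemma weak_compact_support:
  assumes G: "finite_energy s G" "\<And>x. 0 \<le> G x" "\<And>x. G x \<le> h"
    and K: "compact K" "K \<subseteq> \<Omega>" "\<And>x. x \<notin> K \<Longrightarrow> G x = 0"
  shows "c * gform s u G = (\<integral>x. w x * G x \<partial>lborel)" "integrable lborel (\<lambda>x. w x * G x)"
proof -
  have [measurable]: "G \<in> borel_measurable borel" "w \<in> borel_measurable borel"
    using G(1) w by (auto simp: finite_energy_def)
  have h: "0 \<le> h" using G(2,3)[of 0] by linarith
  have dom: "integrable lborel (\<lambda>x. h * (indicator A x * w x))" if "compact A" "A \<subseteq> \<Omega>" for A
    by (intro integrable_mult_right w_loc that)
  have bd: "\<bar>w x * v x\<bar> \<le> \<bar>h * (indicator A x * w x)\<bar>"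
    if "\<And>x. 0 \<le> v x" "\<And>x. v x \<le> h" "\<And>x. x \<notin> A \<Longrightarrow> v x = 0" for A v x
    using that(1,2)[of x] that(3)[of x] w(2)[of x] h
    by (cases "x \<in> A") (auto simp: abs_mult mult.commute[of "w x"] intro!: mult_right_mono)
  show "integrable lborel (\<lambda>x. w x * G x)"
  proof (rule Bochner_Integration.integrable_bound[OF dom[OF K(1,2)]])
    show "AE x in lborel. norm (w x * G x) \<le> norm (h * (indicator K x * w x))"
      unfolding real_norm_def by (intro AE_I2 bd G(2,3) K(3))
  qed simp
  show "c * gform s u G = (\<integral>x. w x * G x \<partial>lborel)"
  proof (rule test_functions_approximation[OF G K(1,2) \<Omega>(1)])
    show "G x = 0" if "x \<notin> K" for x by (rule K(3)[OF that])
  next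
    fix K' and \<phi> :: "nat \<Rightarrow> real^'n \<Rightarrow> real"
    assume \<phi>: "compact K'" "K' \<subseteq> \<Omega>" "\<And>n. \<phi> n \<in> test_functions \<Omega>"
    "\<And>n x. 0 \<le> \<phi> n x" "\<And>n x. \<phi> n x \<le> h" "\<And>n x. x \<notin> K' \<Longrightarrow> \<phi> n x = 0"
    "\<And>n. finite_energy s (\<phi> n)"
    "(\<lambda>n. gform s (\<lambda>x. \<phi> n x - G x) (\<lambda>x. \<phi> n x - G x)) \<longlonglongrightarrow> 0"
    "AE x in lborel. (\<lambda>n. \<phi> n x) \<longlonglongrightarrow> G x"
    have "(\<lambda>n. \<integral>x. w x * \<phi> n x \<partial>lborel) \<longlonglongrightarrow> (\<integral>x. w x * G x \<partial>lborel)"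
    proof (rule integral_dominated_convergence[OF _ _ dom[OF \<phi>(1,2)]])
      show "(\<lambda>x. w x * \<phi> n x) \<in> borel_measurable lborel" for n
        using finite_energy_borel[OF \<phi>(7)[of n]] by simp
      show "AE x in lborel. (\<lambda>n. w x * \<phi> n x) \<longlonglongrightarrow> w x * G x"
        using \<phi>(9) by eventually_elim (rule tendsto_mult_left)
      show "AE x in lborel. norm (w x * \<phi> n x) \<le> h * (indicator K' x * w x)" for n
      proof (rule AE_I2)
        fix x
        have "\<bar>w x * \<phi> n x\<bar> \<le> \<bar>h * (indicator K' x * w x)\<bar>" by (rule bd[OF \<phi>(4,5,6)])
        also have "\<dots> = h * (indicator K' x * w x)" using h w(2)[of x] by simp
        finally show "norm (w x * \<phi> n x) \<le> h * (indicator K' x * w x)" by simp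
      qed
    qed simp
    moreover have "(\<lambda>n. c * gform s u (\<phi> n)) \<longlonglongrightarrow> c * gform s u G"
      by (intro tendsto_mult_left gform_tendsto_right u \<phi>(7) G(1) \<phi>(8))
    ultimately show "c * gform s u G = (\<integral>x. w x * G x \<partial>lborel)"
      using weak[OF \<phi>(3,4)] LIMSEQ_unique by fastforce
  qed
qed

definition admissible :: "(real^'n \<Rightarrow> real) \<Rightarrow> bool" where
  "admissible T \<longleftrightarrow> finite_energy s T \<and> (\<forall>x. 0 \<le> T x) \<and> (\<exists>h. \<forall>x. T x \<le> h) \<and> (\<forall>x. x \<notin> \<Omega> \<longrightarrow> T x = 0)"

text \<open>
  The inequality is stated for nonnegative integrals because \<open>w\<close> need not be integrable up to the
  boundary.
\<close>

definition tested :: "(real^'n \<Rightarrow> real) \<Rightarrow> bool" where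
  "tested T \<longleftrightarrow> ennreal (c * gform s u T) \<le> (\<integral>\<^sup>+x. ennreal (w x * T x) \<partial>lborel)"

lemma tested_compact_support:
  assumes "admissible T" and K: "compact K" "K \<subseteq> \<Omega>" "\<And>x. x \<notin> K \<Longrightarrow> T x = 0"
  shows "tested T"
proof -
  obtain h where h: "\<And>x. T x \<le> h" using assms(1) by (auto simp: admissible_def)
  have T: "finite_energy s T" "\<And>x. 0 \<le> T x" using assms(1) by (auto simp: admissible_def)
  have "ennreal (\<integral>x. w x * T x \<partial>lborel) = (\<integral>\<^sup>+x. ennreal (w x * T x) \<partial>lborel)"
    using T(2) w(2) by (intro nn_integral_eq_integral[symmetric] weak_compact_support[OF T h K]) auto
  then show ?thesis using weak_compact_support(1)[OF T h K] by (simp add: tested_def)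
qed

text \<open>
  In the chart, \<open>\<Omega>\<close> lies above a graph in the direction \<open>\<nu>\<close>, and hence a small positive multiple of \<open>\<nu>\<close>
  moves the part of \<open>closure \<Omega>\<close> in a smaller ball into \<open>\<Omega>\<close>. The minimum of \<open>T\<close> and its translate has compact support in \<open>\<Omega>\<close>,
  lies below \<open>T\<close>, and converges to \<open>T\<close> in energy.
\<close>

lemma tested_chart:
  assumes T: "admissible T"
    and chart: "0 < r" "norm \<nu> = 1" "L-lipschitz_on {y. y \<bullet> \<nu> = 0} g"
       "\<Omega> \<inter> ball x0 r = {y \<in> ball x0 r. g (y - (y \<bullet> \<nu>) *\<^sub>R \<nu>) < y \<bullet> \<nu>}"
    and supp: "\<And>y. r / 2 \<le> dist y x0 \<Longrightarrow> T y = 0"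
  shows "tested T"
proof -
  obtain h where h: "\<And>x. T x \<le> h" using T by (auto simp: admissible_def)
  have T1: "finite_energy s T" "\<And>x. 0 \<le> T x" "\<And>x. x \<notin> \<Omega> \<Longrightarrow> T x = 0" using T by (auto simp: admissible_def)
  have [measurable]: "T \<in> borel_measurable borel" using T1(1) by (simp add: finite_energy_def)
  have [measurable]: "w \<in> borel_measurable borel" by (rule w)
  have \<nu>\<nu>: "\<nu> \<bullet> \<nu> = 1" using chart(2) by (simp add: norm_eq_1)
  define \<pi> where "\<pi> y = y - (y \<bullet> \<nu>) *\<^sub>R \<nu>" for y
  have \<pi>mem: "\<pi> y \<in> {y. y \<bullet> \<nu> = 0}" for y by (simp add: \<pi>_def inner_diff_left \<nu>\<nu>)
  have \<pi>_shift: "\<pi> (y + t *\<^sub>R \<nu>) = \<pi> y" for y t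
    by (simp add: \<pi>_def inner_add_left \<nu>\<nu> algebra_simps)
  have chart': "y \<in> \<Omega> \<longleftrightarrow> g (\<pi> y) < y \<bullet> \<nu>" if "y \<in> ball x0 r" for y
    using chart(4) that unfolding \<pi>_def by blast
  have g_cont: "continuous_on UNIV (\<lambda>y. g (\<pi> y))"
  proof (rule continuous_on_compose2[OF lipschitz_on_continuous_on[OF chart(3)]])
    show "continuous_on UNIV \<pi>" unfolding \<pi>_def by (intro continuous_intros)
  qed (use \<pi>mem in auto)
  have closed_chart: "g (\<pi> y) \<le> y \<bullet> \<nu>" if y: "y \<in> closure \<Omega>" "y \<in> ball x0 r" for y
  proof -
    have "y \<in> closure (\<Omega> \<inter> ball x0 r)"
      using y open_Int_closure_subset[OF open_ball, of x0 r \<Omega>] by (auto simp: Int_commute)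
    also have "closure (\<Omega> \<inter> ball x0 r) \<subseteq> {y. g (\<pi> y) \<le> y \<bullet> \<nu>}"
      using chart' by (intro closure_minimal closed_Collect_le g_cont continuous_intros) (auto intro: less_imp_le)
    finally show ?thesis by simp
  qed
  define \<epsilon> where "\<epsilon> n = r / 4 / (real n + 1)" for n :: nat
  have \<epsilon>: "0 < \<epsilon> n" "\<epsilon> n < r / 2" for n
  proof -
    show "0 < \<epsilon> n" using chart(1) by (simp add: \<epsilon>_def)
    have "\<epsilon> n \<le> r / 4 / 1" unfolding \<epsilon>_def using chart(1) by (intro divide_left_mono) auto
    then show "\<epsilon> n < r / 2" using chart(1) by simp
  qed
  have \<epsilon>lim: "\<epsilon> \<longlonglongrightarrow> 0"
    using tendsto_mult_right_zero[OF LIMSEQ_inverse_real_of_nat, of "r / 4"]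
    by (simp add: \<epsilon>_def[abs_def] inverse_eq_divide add.commute)
  define z where "z n = - (\<epsilon> n *\<^sub>R \<nu>)" for n
  have zlim: "z \<longlonglongrightarrow> 0" unfolding z_def using tendsto_minus[OF tendsto_scaleR[OF \<epsilon>lim tendsto_const[of \<nu>]]] by simp
  \<comment> \<open>The minimum keeps the function below \<open>T\<close>, which the right-hand side requires.\<close>
  define G where "G n x = min (T (x + z n)) (T x)" for n x
  define K where "K n = (\<lambda>y. y + \<epsilon> n *\<^sub>R \<nu>) ` (closure \<Omega> \<inter> cball x0 (r / 2))" for n
  have Kc: "compact (K n)" for n
    unfolding K_def by (intro compact_continuous_image continuous_intros closed_Int_compact) auto
  have K\<Omega>: "K n \<subseteq> \<Omega>" for n
  proof
    fix x assume "x \<in> K n"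
    then obtain y where y: "y \<in> closure \<Omega>" "y \<in> cball x0 (r / 2)" "x = y + \<epsilon> n *\<^sub>R \<nu>" by (auto simp: K_def)
    have "dist x0 x \<le> dist x0 y + dist y x" by (rule dist_triangle)
    also have "dist y x = \<epsilon> n" using y(3) chart(2) \<epsilon>(1)[of n] by (simp add: dist_norm)
    also have "dist x0 y + \<epsilon> n < r" using y(2) \<epsilon>(2)[of n] by simp
    finally have "x \<in> ball x0 r" by simp
    moreover have "y \<in> ball x0 r" using y(2) chart(1) by simp
    then have "g (\<pi> y) \<le> y \<bullet> \<nu>" using closed_chart y(1) by blast
    then have "g (\<pi> x) < x \<bullet> \<nu>"
      unfolding y(3) \<pi>_shift using \<epsilon>(1)[of n] by (simp add: inner_add_left \<nu>\<nu>)
    ultimately show "x \<in> \<Omega>" using chart' by blast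
  qed
  have Gsupp: "G n x = 0" if "x \<notin> K n" for n x
  proof -
    have "T (x + z n) = 0"
    proof (rule ccontr)
      assume "T (x + z n) \<noteq> 0"
      then have "x + z n \<in> closure \<Omega> \<inter> cball x0 (r / 2)"
        using T1(3)[of "x + z n"] supp[of "x + z n"] closure_subset[of \<Omega>] by (force simp: dist_commute)
      then have "x \<in> K n" unfolding K_def by (rule rev_image_eqI) (simp add: z_def)
      then show False using that by simp
    qed
    then show ?thesis using T1(2)[of x] by (simp add: G_def)
  qed
  have [measurable]: "G n \<in> borel_measurable borel" for n unfolding G_def by measurable
  have GE: "finite_energy s (G n)" for n
  proof (rule finite_energy_dominated(1)[OF _ finite_energy_shift[OF T1(1), of "z n"] T1(1), of _ 1 1])
    fix x y
    have "\<bar>min a b - min a' b'\<bar> \<le> max \<bar>a - a'\<bar> \<bar>b - b'\<bar>" for a b a' b' :: real by linarith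
    then have "(min a b - min a' b')\<^sup>2 \<le> (max \<bar>a - a'\<bar> \<bar>b - b'\<bar>)\<^sup>2" for a b a' b' :: real
      using power_mono[of "\<bar>min a b - min a' b'\<bar>" "max \<bar>a - a'\<bar> \<bar>b - b'\<bar>" 2] by simp
    moreover have "(max \<bar>p\<bar> \<bar>q\<bar>)\<^sup>2 \<le> p\<^sup>2 + q\<^sup>2" for p q :: real by (simp add: max_def)
    ultimately show "(G n x - G n y)\<^sup>2 \<le> 1 * (T (x + z n) - T (y + z n))\<^sup>2 + 1 * (T x - T y)\<^sup>2"
      unfolding G_def mult_1 by (rule order_trans)
  qed auto
  have Gadm: "admissible (G n)" for n
    unfolding admissible_def
  proof (intro conjI exI[of _ h] allI impI GE)
    show "0 \<le> G n x" "G n x \<le> h" for x using T1(2)[of x] T1(2)[of "x + z n"] h[of x] by (auto simp: G_def)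
    show "G n x = 0" if "x \<notin> \<Omega>" for x using that K\<Omega> by (auto intro: Gsupp)
  qed
  have "(\<lambda>n. gform s (\<lambda>x. G n x - T x) (\<lambda>x. G n x - T x)) \<longlonglongrightarrow> 0"
  proof (rule tendsto_sandwich[OF _ _ tendsto_const tendsto_shift_energy[OF T1(1) zlim]])
    show "\<forall>\<^sub>F n in sequentially. gform s (\<lambda>x. G n x - T x) (\<lambda>x. G n x - T x)
      \<le> gform s (\<lambda>x. T (x + z n) - T x) (\<lambda>x. T (x + z n) - T x)"
    proof (intro always_eventually allI finite_energy_contraction(2))
      show "finite_energy s (\<lambda>x. T (x + z n) - T x)" for n
        by (intro finite_energy_diff finite_energy_shift T1(1))
      show "\<bar>G n x - T x - (G n y - T y)\<bar> \<le> \<bar>T (x + z n) - T x - (T (y + z n) - T y)\<bar>" for n x y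
        unfolding G_def by linarith
    qed measurable
  qed (simp add: gform_nonneg)
  then have "(\<lambda>n. gform s u (G n)) \<longlonglongrightarrow> gform s u T"
    by (intro gform_tendsto_right u GE T1(1))
  then have "(\<lambda>n. ennreal (c * gform s u (G n))) \<longlonglongrightarrow> ennreal (c * gform s u T)"
    by (intro tendsto_ennrealI tendsto_mult_left)
  moreover have "ennreal (c * gform s u (G n)) \<le> (\<integral>\<^sup>+x. ennreal (w x * T x) \<partial>lborel)" for n
  proof -
    have "ennreal (c * gform s u (G n)) \<le> (\<integral>\<^sup>+x. ennreal (w x * G n x) \<partial>lborel)"
      using tested_compact_support[OF Gadm Kc K\<Omega> Gsupp] by (simp add: tested_def)
    also have "\<dots> \<le> (\<integral>\<^sup>+x. ennreal (w x * T x) \<partial>lborel)"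
      using w(2) by (intro nn_integral_mono ennreal_leI mult_left_mono) (auto simp: G_def)
    finally show ?thesis .
  qed
  ultimately show ?thesis unfolding tested_def by (intro LIMSEQ_le_const2) auto
qed

lemma tested_local:
  assumes x: "x \<in> closure \<Omega>"
  obtains \<rho> where "0 < \<rho>" "\<And>T. admissible T \<Longrightarrow> (\<And>y. 2 * \<rho> \<le> dist y x \<Longrightarrow> T y = 0) \<Longrightarrow> tested T"
proof (cases "x \<in> \<Omega>")
  case True
  then obtain r where r: "0 < r" "cball x r \<subseteq> \<Omega>" using \<Omega>(1) open_contains_cball by blast
  show thesis
  proof (rule that[of "r / 2"])
    fix T assume T: "admissible T" "\<And>y. 2 * (r / 2) \<le> dist y x \<Longrightarrow> T y = 0"
    show "tested T"
      by (rule tested_compact_support[OF T(1) compact_cball r(2)]) (use T(2) in \<open>auto simp: dist_commute\<close>)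
  qed (use r in simp)
next
  case False
  then have xf: "x \<in> frontier \<Omega>" using x \<Omega>(1) by (simp add: frontier_def interior_open)
  then obtain r \<nu> L g where chart: "r > 0" "norm \<nu> = 1" "L-lipschitz_on {y. y \<bullet> \<nu> = 0} g"
    "\<Omega> \<inter> ball x r = {y \<in> ball x r. g (y - (y \<bullet> \<nu>) *\<^sub>R \<nu>) < y \<bullet> \<nu>}"
    using \<Omega>(3) unfolding has_lipschitz_boundary_def by blast
  show thesis
  proof (rule that[of "r / 4"])
    fix T assume T: "admissible T" "\<And>y. 2 * (r / 4) \<le> dist y x \<Longrightarrow> T y = 0"
    show "tested T" by (rule tested_chart[OF T(1) chart]) (use T(2) in simp)
  qed (use chart in simp)
qed

text \<open>
  The increments of a product are controlled by those of the factors because both are bounded.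
\<close>

lemma admissible_bump_split:
  assumes T: "admissible T" and \<rho>: "0 < \<rho>"
  shows "admissible (\<lambda>y. bump x \<rho> y * T y)" "admissible (\<lambda>y. T y - bump x \<rho> y * T y)"
proof -
  obtain h where h: "\<And>x. T x \<le> h" using T by (auto simp: admissible_def)
  have T1: "finite_energy s T" "\<And>x. 0 \<le> T x" "\<And>x. x \<notin> \<Omega> \<Longrightarrow> T x = 0" using T by (auto simp: admissible_def)
  have [measurable]: "T \<in> borel_measurable borel" using T1(1) by (simp add: finite_energy_def)
  let ?\<eta> = "bump x \<rho>"
  have le: "?\<eta> y * T y \<le> T y" for y using bump_bounds[of x \<rho> y] T1(2)[of y] by (simp add: mult_left_le_one_le)
  have E: "finite_energy s (\<lambda>y. ?\<eta> y * T y)"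
  proof (rule finite_energy_dominated(1)[OF _ T1(1) finite_energy_bump[OF s \<rho>], of _ 2 "2 * h\<^sup>2" x])
    fix a b
    have 2: "(p + q)\<^sup>2 \<le> 2 * p\<^sup>2 + 2 * q\<^sup>2" for p q :: real
      using zero_le_power2[of "p - q"] by (simp add: power2_sum power2_diff)
    have 3: "(p * q)\<^sup>2 \<le> r\<^sup>2 * q\<^sup>2" if "0 \<le> p" "p \<le> r" for p q r :: real
      unfolding power_mult_distrib using that by (intro mult_right_mono power_mono) auto
    have "?\<eta> a * T a - ?\<eta> b * T b = ?\<eta> a * (T a - T b) + T b * (?\<eta> a - ?\<eta> b)" by (simp add: algebra_simps)
    then have "(?\<eta> a * T a - ?\<eta> b * T b)\<^sup>2 \<le> 2 * (?\<eta> a * (T a - T b))\<^sup>2 + 2 * (T b * (?\<eta> a - ?\<eta> b))\<^sup>2"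
      using 2 by simp
    also have "\<dots> \<le> 2 * (1\<^sup>2 * (T a - T b)\<^sup>2) + 2 * (h\<^sup>2 * (?\<eta> a - ?\<eta> b)\<^sup>2)"
      by (intro add_mono mult_left_mono 3 bump_bounds T1(2) h) auto
    finally show "(?\<eta> a * T a - ?\<eta> b * T b)\<^sup>2 \<le> 2 * (T a - T b)\<^sup>2 + 2 * h\<^sup>2 * (?\<eta> a - ?\<eta> b)\<^sup>2" by simp
  qed auto
  show "admissible (\<lambda>y. ?\<eta> y * T y)"
    unfolding admissible_def
    using E T1 bump_bounds[of x \<rho>] order_trans[OF le h] by (intro conjI exI[of _ h]) auto
  show "admissible (\<lambda>y. T y - ?\<eta> y * T y)"
    unfolding admissible_def
  proof (intro conjI exI[of _ h] allI impI finite_energy_diff T1(1) E)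
    fix y
    show "0 \<le> T y - ?\<eta> y * T y" using le[of y] by simp
    show "T y - ?\<eta> y * T y \<le> h" using h[of y] T1(2)[of y] bump_bounds(1)[of x \<rho> y]
      mult_nonneg_nonneg[of "?\<eta> y" "T y"] by linarith
    show "T y - ?\<eta> y * T y = 0" if "y \<notin> \<Omega>" using T1(3)[OF that] by simp
  qed
qed

text \<open>
  The form is linear and the integral against \<open>w\<close> is additive in the test function.
\<close>

lemma tested_split:
  assumes T: "admissible T" and \<rho>: "0 < \<rho>"
    and 1: "tested (\<lambda>y. bump x \<rho> y * T y)" and 2: "tested (\<lambda>y. T y - bump x \<rho> y * T y)"
  shows "tested T"
proof -
  let ?A = "\<lambda>y. bump x \<rho> y * T y"
  let ?B = "\<lambda>y. T y - bump x \<rho> y * T y"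
  have adm: "admissible ?A" "admissible ?B" by (rule admissible_bump_split[OF T \<rho>])+
  then have AB: "finite_energy s ?A" "\<And>y. 0 \<le> ?A y" "\<And>y. 0 \<le> ?B y" and TE: "finite_energy s T"
    using T unfolding admissible_def by blast+
  have [measurable]: "T \<in> borel_measurable borel" using TE by (simp add: finite_energy_def)
  have [measurable]: "w \<in> borel_measurable borel" by (rule w)
  have "c * gform s u T = c * gform s u ?A + c * gform s u ?B"
    unfolding gform_diff_right[OF u TE AB(1)] by (simp add: distrib_left[symmetric])
  then have "ennreal (c * gform s u T) \<le> ennreal (c * gform s u ?A) + ennreal (c * gform s u ?B)"
    by (cases "0 \<le> c * gform s u ?A"; cases "0 \<le> c * gform s u ?B")
      (auto simp: ennreal_neg simp flip: ennreal_plus intro!: ennreal_leI)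
  also have "\<dots> \<le> (\<integral>\<^sup>+x. ennreal (w x * ?A x) \<partial>lborel) + (\<integral>\<^sup>+x. ennreal (w x * ?B x) \<partial>lborel)"
    using 1 2 unfolding tested_def by (rule add_mono)
  also have "\<dots> = (\<integral>\<^sup>+x. ennreal (w x * ?A x) + ennreal (w x * ?B x) \<partial>lborel)"
    by (rule nn_integral_add[symmetric]) measurable
  also have "\<dots> = (\<integral>\<^sup>+x. ennreal (w x * T x) \<partial>lborel)"
  proof (rule nn_integral_cong)
    fix x
    have "ennreal (w x * ?A x) + ennreal (w x * ?B x) = ennreal (w x * ?A x + w x * ?B x)"
      by (rule ennreal_plus[symmetric]; rule mult_nonneg_nonneg[OF w(2)]; rule AB)
    then show "ennreal (w x * ?A x) + ennreal (w x * ?B x) = ennreal (w x * T x)"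
      by (simp add: algebra_simps)
  qed
  finally show ?thesis unfolding tested_def .
qed

text \<open>
  Finitely many balls on which testing is possible cover \<open>closure \<Omega>\<close>. The cut-offs are split off one
  after the other: what remains vanishes on one more ball of the cover.
\<close>

lemma admissible_tested:
  assumes "admissible T"
  shows "tested T"
proof -
  have "\<exists>\<rho>. \<forall>x\<in>closure \<Omega>. 0 < \<rho> x \<and>
      (\<forall>T. admissible T \<longrightarrow> (\<forall>y. 2 * \<rho> x \<le> dist y x \<longrightarrow> T y = 0) \<longrightarrow> tested T)"
    by (rule bchoice) (metis tested_local)
  then obtain \<rho> where \<rho>: "\<And>x. x \<in> closure \<Omega> \<Longrightarrow> 0 < \<rho> x"
    "\<And>x T. x \<in> closure \<Omega> \<Longrightarrow> admissible T \<Longrightarrow> (\<And>y. 2 * \<rho> x \<le> dist y x \<Longrightarrow> T y = 0) \<Longrightarrow> tested T"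
    by blast
  have comp: "compact (closure \<Omega>)" using \<Omega>(2) by (simp add: compact_closure)
  have "closure \<Omega> \<subseteq> (\<Union>x\<in>closure \<Omega>. ball x (\<rho> x))" using \<rho>(1) by fastforce
  then obtain D where D: "D \<subseteq> closure \<Omega>" "finite D" "closure \<Omega> \<subseteq> (\<Union>x\<in>D. ball x (\<rho> x))"
    using compactE_image[OF comp, of "closure \<Omega>" "\<lambda>x. ball x (\<rho> x)"] by auto
  have "tested T" if "finite E" "E \<subseteq> closure \<Omega>" "admissible T" "\<And>y. y \<notin> (\<Union>x\<in>E. ball x (\<rho> x)) \<Longrightarrow> T y = 0" for E T
    using that
  proof (induction E arbitrary: T rule: finite_induct)
    case empty
    then have "T = (\<lambda>x. 0)" by auto
    then show ?case by (simp add: tested_def gform_def diff_quot_def split_beta)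
  next
    case (insert x E)
    have x: "x \<in> closure \<Omega>" and r: "0 < \<rho> x" using insert \<rho>(1) by auto
    note adm = admissible_bump_split[OF insert.prems(2) r, of x]
    have "tested (\<lambda>y. bump x (\<rho> x) y * T y)"
      by (rule \<rho>(2)[OF x adm(1)]) (simp add: bump_eq_0[OF r])
    moreover have "tested (\<lambda>y. T y - bump x (\<rho> x) y * T y)"
    proof (rule insert.IH[OF _ adm(2)])
      fix y assume y: "y \<notin> (\<Union>x\<in>E. ball x (\<rho> x))"
      show "T y - bump x (\<rho> x) y * T y = 0"
      proof (cases "y \<in> ball x (\<rho> x)")
        case True
        then show ?thesis using bump_eq_1[OF r, of y x] by (simp add: dist_commute)
      next
        case False
        then show ?thesis using insert.prems(3)[of y] y by simp
      qed
    qed (use insert.prems in auto)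
    ultimately show ?case by (rule tested_split[OF insert.prems(2) r])
  qed
  from this[OF D(2,1) assms] show ?thesis
    using assms D(3) closure_subset[of \<Omega>] unfolding admissible_def by blast
qed

end

section \<open>Superlevel sets of a solution\<close>

lemma gform_truncation_le:
  assumes u: "finite_energy s u" and T: "finite_energy s T"
    and le: "\<And>x y. (T x - T y)\<^sup>2 \<le> (u x - u y) * (T x - T y)"
  shows "gform s T T \<le> gform s u T"
  unfolding gform_def
proof (rule integral_mono[OF integrable_diff_quot_mult[OF T T] integrable_diff_quot_mult[OF u T]])
  show "diff_quot s T p * diff_quot s T p \<le> diff_quot s u p * diff_quot s T p" for p
    using le by (cases p) (auto simp: diff_quot_mult power2_eq_square intro!: divide_right_mono)
qed

text \<open>
  If $b \le 2a$ this is the mean value theorem; otherwise $k = b/2$ and both sides are comparable to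
  $b^{\gamma+1}$. The choice of $k$ keeps $k$ positive even when $a = 0$.
\<close>

lemma powr_increment_le:
  fixes a b k \<gamma> :: real
  assumes "0 < \<gamma>" "0 \<le> a" "a < b" and k: "k = max a (b / 2)"
  shows "b powr (\<gamma> + 1) - a powr (\<gamma> + 1) \<le> ((\<gamma> + 1) * 2 powr (\<gamma> + 1)) * ((b - k) * k powr \<gamma>)"
proof (cases "b / 2 \<le> a")
  case True
  then have ka: "k = a" and a: "0 < a" using k assms by auto
  have "\<exists>z. z > a \<and> z < b \<and> b powr (\<gamma> + 1) - a powr (\<gamma> + 1) = (b - a) * ((\<gamma> + 1) * z powr \<gamma>)"
  proof (rule MVT2[OF assms(3)])
    show "DERIV (\<lambda>x. x powr (\<gamma> + 1)) x :> (\<gamma> + 1) * x powr \<gamma>" if "a \<le> x" "x \<le> b" for x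
      using that a by (auto intro!: derivative_eq_intros)
  qed
  then obtain z where z: "a < z" "z < b" "b powr (\<gamma> + 1) - a powr (\<gamma> + 1) = (b - a) * ((\<gamma> + 1) * z powr \<gamma>)"
    by blast
  have "z powr \<gamma> \<le> (2 * a) powr \<gamma>" using z a True assms by (intro powr_mono2) auto
  also have "\<dots> = 2 powr \<gamma> * a powr \<gamma>" using a by (simp add: powr_mult)
  also have "\<dots> \<le> 2 powr (\<gamma> + 1) * a powr \<gamma>" by (intro mult_right_mono powr_mono) auto
  finally have "(b - a) * ((\<gamma> + 1) * z powr \<gamma>) \<le> (b - a) * ((\<gamma> + 1) * (2 powr (\<gamma> + 1) * a powr \<gamma>))"
    using assms by (intro mult_left_mono) auto
  then show ?thesis unfolding z(3) ka by (simp add: mult_ac)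
next
  case False
  then have kb: "k = b / 2" and b: "0 < b" using k assms by auto
  have le: "b powr (\<gamma> + 1) - a powr (\<gamma> + 1) \<le> (\<gamma> + 1) * b powr (\<gamma> + 1)"
  proof -
    have "1 * b powr (\<gamma> + 1) \<le> (\<gamma> + 1) * b powr (\<gamma> + 1)" using assms by (intro mult_right_mono) auto
    moreover have "0 \<le> a powr (\<gamma> + 1)" by simp
    ultimately show ?thesis by linarith
  qed
  have "b powr (\<gamma> + 1) = (2 * k) powr (\<gamma> + 1)" by (simp add: kb)
  also have "\<dots> = 2 powr (\<gamma> + 1) * ((b - k) * k powr \<gamma>)"
  proof -
    have "0 < k" "b - k = k" using b kb by auto
    then show ?thesis by (simp add: powr_mult powr_add mult.commute)
  qed
  finally have eq: "(\<gamma> + 1) * b powr (\<gamma> + 1) = ((\<gamma> + 1) * 2 powr (\<gamma> + 1)) * ((b - k) * k powr \<gamma>)"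
    by (simp only: mult.assoc)
  show ?thesis using le unfolding eq .
qed

text \<open>
  The constants, here and below, are written out so that their dependence on the parameters is
  visible and no solution or datum enters them.
\<close>

definition level_const :: "nat \<Rightarrow> real \<Rightarrow> real \<Rightarrow> real" where
  "level_const N s c = 1 / (c * (unit_ball_vol (real N) / 2) powr (1 + 2 * s / real N))"

locale singular_solution = weak_form s c \<Omega> u w
  for s c :: real and \<Omega> :: "(real^'n) set" and u w +
  fixes \<gamma> :: real and f :: "real^'n \<Rightarrow> real"
  assumes \<gamma>: "0 < \<gamma>"
    and f: "integrable lborel f" "\<And>x. 0 \<le> f x"
    and u_nonneg: "\<And>x. 0 \<le> u x" and u_supp: "\<And>x. x \<notin> \<Omega> \<Longrightarrow> u x = 0"
    and w_eq: "\<And>x. w x = f x / u x powr \<gamma>"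
begin

lemma u_borel[measurable]: "u \<in> borel_measurable borel"
  using u by (simp add: finite_energy_def)

lemma f_borel[measurable]: "f \<in> borel_measurable borel"
  using borel_measurable_integrable[OF f(1)] by simp

lemma integrable_f_level: "integrable lborel (\<lambda>x. f x * indicator {x. k < u x} x)"
  using f by (intro Bochner_Integration.integrable_bound[OF f(1)]) (auto simp: indicator_def)

text \<open>
  Both bounds for the energy of the truncation of \<open>u\<close> between the levels \<open>k\<close> and \<open>l\<close>, from below by
  its plateau and from above by the equation.
\<close>

lemma level_estimate:
  assumes kl: "0 < k" "k < l" and \<mu>: "0 < \<mu>" "emeasure lborel {x. k < u x} \<le> ennreal \<mu>"
    and m: "0 \<le> m" "ennreal m \<le> emeasure lborel {x. l \<le> u x}"
  shows "(l - k) * k powr \<gamma> * m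
    \<le> level_const CARD('n) s c * \<mu> powr (2 * s / CARD('n)) * (\<integral>x. f x * indicator {x. k < u x} x \<partial>lborel)"
proof -
  define T where "T x = min (max (u x - k) 0) (l - k)" for x
  define I where "I = (\<integral>x. f x * indicator {x. k < u x} x \<partial>lborel)"
  define \<kappa> where "\<kappa> = (unit_ball_vol (real CARD('n)) / 2) powr (1 + 2 * s / CARD('n))"
  have "0 < unit_ball_vol (real CARD('n)) / 2" by simp
  then have \<kappa>: "0 < \<kappa>" unfolding \<kappa>_def powr_gt_zero by (metis less_irrefl)
  have [measurable]: "T \<in> borel_measurable borel" unfolding T_def by measurable
  have TE: "finite_energy s T"
    by (rule finite_energy_contraction(1)[OF _ u]) (auto simp: T_def)
  have adm: "admissible T"
    unfolding admissible_def
  proof (intro conjI exI[of _ "l - k"] allI impI TE)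
    show "T x = 0" if "x \<notin> \<Omega>" for x using u_supp[OF that] kl by (simp add: T_def)
  qed (use kl in \<open>auto simp: T_def\<close>)
  have "(l - k)\<^sup>2 * m * \<kappa> * \<mu> powr (- 2 * s / CARD('n)) \<le> gform s T T"
    unfolding \<kappa>_def
  proof -
    have sub: "{x. l \<le> u x} \<subseteq> {x. k < u x}" using kl by auto
    show "(l - k)\<^sup>2 * m * (unit_ball_vol (real CARD('n)) / 2) powr (1 + 2 * s / CARD('n))
        * \<mu> powr (- 2 * s / CARD('n)) \<le> gform s T T"
      using gform_lower_bound[OF s(1) TE _ \<mu>(1), of "l - k" "{x. k < u x}" "{x. l \<le> u x}" m] kl \<mu> m sub
      by (auto simp: T_def)
  qed
  also have "gform s T T \<le> gform s u T"
  proof (rule gform_truncation_le[OF u TE])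
    fix x y
    have mono: "(b - a)\<^sup>2 \<le> (q - p) * (b - a)" if "0 \<le> b - a" "b - a \<le> q - p" for a b p q :: real
      using mult_right_mono[OF that(2,1)] by (simp add: power2_eq_square)
    show "(T x - T y)\<^sup>2 \<le> (u x - u y) * (T x - T y)"
    proof (cases "u y \<le> u x")
      case True
      then show ?thesis by (intro mono) (auto simp: T_def)
    next
      case False
      then have "(T y - T x)\<^sup>2 \<le> (u y - u x) * (T y - T x)" by (intro mono) (auto simp: T_def)
      then show ?thesis by (simp add: power2_commute algebra_simps)
    qed
  qed
  finally have low: "(l - k)\<^sup>2 * m * \<kappa> * \<mu> powr (- 2 * s / CARD('n)) \<le> gform s u T" .
  have "ennreal (c * gform s u T) \<le> (\<integral>\<^sup>+x. ennreal (w x * T x) \<partial>lborel)"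
    using admissible_tested[OF adm] by (simp add: tested_def)
  also have "\<dots> \<le> (\<integral>\<^sup>+x. ennreal ((l - k) * k powr (- \<gamma>) * (f x * indicator {x. k < u x} x)) \<partial>lborel)"
  proof (intro nn_integral_mono ennreal_leI)
    fix x
    show "w x * T x \<le> (l - k) * k powr (- \<gamma>) * (f x * indicator {x. k < u x} x)"
    proof (cases "k < u x")
      case True
      have "w x \<le> f x / k powr \<gamma>"
        unfolding w_eq using True kl \<gamma> f(2) by (intro divide_left_mono powr_mono2 mult_pos_pos) auto
      then have "w x * T x \<le> f x / k powr \<gamma> * (l - k)"
        using kl f(2)[of x] by (intro mult_mono) (auto simp: T_def)
      then show ?thesis using True by (simp add: powr_minus_divide mult_ac)
    next
      case False
      then show ?thesis using kl by (simp add: T_def)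
    qed
  qed
  also have "\<dots> = ennreal ((l - k) * k powr (- \<gamma>) * I)"
    using kl f(2) integrable_f_level[of k] unfolding I_def
    by (subst nn_integral_eq_integral) auto
  finally have up: "c * gform s u T \<le> (l - k) * k powr (- \<gamma>) * I"
    using kl f(2) by (subst (asm) ennreal_le_iff) (auto simp: I_def intro!: mult_nonneg_nonneg integral_nonneg_AE AE_I2)
  have "c * ((l - k)\<^sup>2 * m * \<kappa> * \<mu> powr (- 2 * s / CARD('n))) \<le> (l - k) * k powr (- \<gamma>) * I"
    using mult_left_mono[OF low, of c] c up by linarith
  then have "(l - k) * (c * ((l - k) * m * \<kappa> * \<mu> powr (- 2 * s / CARD('n)))) \<le> (l - k) * (k powr (- \<gamma>) * I)"
    by (simp add: power2_eq_square mult_ac)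
  then have "c * ((l - k) * m * \<kappa> * \<mu> powr (- 2 * s / CARD('n))) \<le> k powr (- \<gamma>) * I"
    using kl by simp
  then have "(k powr \<gamma> * \<mu> powr (2 * s / CARD('n)) / (c * \<kappa>)) * (c * ((l - k) * m * \<kappa> * \<mu> powr (- 2 * s / CARD('n))))
     \<le> (k powr \<gamma> * \<mu> powr (2 * s / CARD('n)) / (c * \<kappa>)) * (k powr (- \<gamma>) * I)"
    using c \<kappa> by (intro mult_left_mono) auto
  moreover have "(k powr \<gamma> * \<mu> powr (2 * s / CARD('n)) / (c * \<kappa>)) * (c * ((l - k) * m * \<kappa> * \<mu> powr (- 2 * s / CARD('n))))
     = (l - k) * k powr \<gamma> * m"
    using c \<kappa> \<mu> by (simp add: powr_minus field_simps)
  moreover have "(k powr \<gamma> * \<mu> powr (2 * s / CARD('n)) / (c * \<kappa>)) * (k powr (- \<gamma>) * I)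
     = level_const CARD('n) s c * \<mu> powr (2 * s / CARD('n)) * I"
  proof -
    have "level_const CARD('n) s c = 1 / (c * \<kappa>)" by (simp add: level_const_def \<kappa>_def)
    then show ?thesis using kl c \<kappa> by (simp add: powr_minus)
  qed
  ultimately show ?thesis by (simp add: I_def)
qed

definition quantile :: "real \<Rightarrow> real" where
  "quantile \<mu> = Inf {t. 0 \<le> t \<and> emeasure lborel {x. t < u x} \<le> ennreal \<mu>}"

lemma emeasure_level_finite: "0 \<le> t \<Longrightarrow> emeasure lborel {x. t < u x} < \<infinity>"
proof -
  assume "0 \<le> t"
  then have "{x. t < u x} \<subseteq> \<Omega>" using u_supp by force
  then have "emeasure lborel {x. t < u x} \<le> emeasure lborel \<Omega>" using \<Omega>(1) by (intro emeasure_mono) auto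
  also have "\<dots> < \<infinity>" using emeasure_bounded_finite[OF \<Omega>(2)] by simp
  finally show ?thesis .
qed

lemma quantile_set_nonempty:
  assumes "0 < \<mu>"
  shows "{t. 0 \<le> t \<and> emeasure lborel {x. t < u x} \<le> ennreal \<mu>} \<noteq> {}"
proof -
  have "(\<lambda>n::nat. emeasure lborel {x. real n < u x}) \<longlonglongrightarrow> emeasure lborel (\<Inter>n::nat. {x. real n < u x})"
    using emeasure_level_finite by (intro Lim_emeasure_decseq) (auto simp: decseq_def less_top)
  also have "(\<Inter>n::nat. {x. real n < u x}) = {}"
  proof -
    have "\<exists>n::nat. u x \<le> real n" for x by (rule real_arch_simple)
    then show ?thesis by (metis (mono_tags, lifting) INT_iff UNIV_I equals0I mem_Collect_eq not_less)
  qed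
  finally have "(\<lambda>n::nat. emeasure lborel {x. real n < u x}) \<longlonglongrightarrow> 0" by simp
  then have "\<forall>\<^sub>F n in sequentially. emeasure lborel {x. real n < u x} < ennreal \<mu>"
    using assms by (intro order_tendstoD) auto
  then obtain n :: nat where "emeasure lborel {x. real n < u x} < ennreal \<mu>"
    by (auto simp: eventually_sequentially)
  then have "real n \<in> {t. 0 \<le> t \<and> emeasure lborel {x. t < u x} \<le> ennreal \<mu>}"
    by (simp add: less_imp_le)
  then show ?thesis by blast
qed

lemma quantile_nonneg: "0 < \<mu> \<Longrightarrow> 0 \<le> quantile \<mu>"
  unfolding quantile_def using quantile_set_nonempty by (intro cInf_greatest) auto

lemma quantile_le: "0 \<le> t \<Longrightarrow> emeasure lborel {x. t < u x} \<le> ennreal \<mu> \<Longrightarrow> quantile \<mu> \<le> t"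
  unfolding quantile_def by (intro cInf_lower) (auto intro!: bdd_belowI[of _ 0])

text \<open>
  The superlevel sets for levels above the quantile increase to this one.
\<close>

lemma emeasure_above_quantile:
  assumes "0 < \<mu>"
  shows "emeasure lborel {x. quantile \<mu> < u x} \<le> ennreal \<mu>"
proof -
  let ?t = "quantile \<mu>"
  have "emeasure lborel {x. ?t + 1 / (real n + 1) < u x} \<le> ennreal \<mu>" for n :: nat
  proof -
    have "?t < ?t + 1 / (real n + 1)" by simp
    then obtain t where t: "0 \<le> t" "emeasure lborel {x. t < u x} \<le> ennreal \<mu>" "t < ?t + 1 / (real n + 1)"
      unfolding quantile_def using cInf_lessD[OF quantile_set_nonempty[OF assms]] by blast
    have "emeasure lborel {x. ?t + 1 / (real n + 1) < u x} \<le> emeasure lborel {x. t < u x}"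
      using t(3) by (intro emeasure_mono) auto
    then show ?thesis using t(2) by simp
  qed
  moreover have "(\<Union>n::nat. {x. ?t + 1 / (real n + 1) < u x}) = {x. ?t < u x}"
  proof (intro equalityI subsetI)
    fix x assume "x \<in> {x. ?t < u x}"
    then have "0 < u x - ?t" by simp
    then obtain n :: nat where "inverse (real (Suc n)) < u x - ?t" using reals_Archimedean by blast
    then show "x \<in> (\<Union>n::nat. {x. ?t + 1 / (real n + 1) < u x})"
      by (auto simp: inverse_eq_divide add.commute intro!: exI[of _ n])
  next
    fix x assume "x \<in> (\<Union>n::nat. {x. ?t + 1 / (real n + 1) < u x})"
    then obtain n :: nat where "?t + 1 / (real n + 1) < u x" by auto
    moreover have "0 < 1 / (real n + 1)" by simp
    ultimately have "?t < u x" by linarith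
    then show "x \<in> {x. ?t < u x}" by simp
  qed
  moreover have "(SUP n::nat. emeasure lborel {x. ?t + 1 / (real n + 1) < u x})
      = emeasure lborel (\<Union>n::nat. {x. ?t + 1 / (real n + 1) < u x})"
  proof (rule SUP_emeasure_incseq)
    have "1 / (real n + 1) \<le> 1 / (real m + 1)" if "m \<le> n" for m n :: nat
      using that by (intro divide_left_mono) auto
    then show "incseq (\<lambda>n::nat. {x. ?t + 1 / (real n + 1) < u x})"
      by (force simp: incseq_def)
  qed auto
  ultimately show ?thesis by (metis (no_types, lifting) SUP_least)
qed

text \<open>
  The superlevel sets for levels below the quantile decrease to this one. A positive quantile is
  needed for such levels to exist.
\<close>

lemma emeasure_at_quantile:
  assumes "0 < quantile \<mu>"
  shows "ennreal \<mu> \<le> emeasure lborel {x. quantile \<mu> \<le> u x}"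
proof -
  let ?t = "quantile \<mu>"
  define \<tau> where "\<tau> n = ?t * (1 - 1 / (real n + 1))" for n :: nat
  have \<tau>: "0 \<le> \<tau> n" "\<tau> n < ?t" for n using assms by (auto simp: \<tau>_def field_simps)
  have \<tau>_lim: "\<tau> \<longlonglongrightarrow> ?t"
  proof -
    have "(\<lambda>n. ?t * (1 - inverse (real (Suc n)))) \<longlonglongrightarrow> ?t * (1 - 0)"
      by (intro tendsto_intros LIMSEQ_inverse_real_of_nat)
    then show ?thesis by (simp add: \<tau>_def[abs_def] inverse_eq_divide add.commute)
  qed
  have \<tau>_mono: "\<tau> m \<le> \<tau> n" if "m \<le> n" for m n
    unfolding \<tau>_def using assms that by (intro mult_left_mono diff_left_mono divide_left_mono) auto
  have "(\<lambda>n. emeasure lborel {x. \<tau> n < u x}) \<longlonglongrightarrow> emeasure lborel (\<Inter>n. {x. \<tau> n < u x})"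
    using emeasure_level_finite[OF \<tau>(1)] \<tau>_mono
    by (intro Lim_emeasure_decseq) (auto simp: decseq_def less_top intro: le_less_trans)
  also have "(\<Inter>n. {x. \<tau> n < u x}) = {x. ?t \<le> u x}"
  proof (intro equalityI subsetI)
    fix x assume "x \<in> (\<Inter>n. {x. \<tau> n < u x})"
    then have "\<tau> n \<le> u x" for n by (auto intro: less_imp_le)
    then show "x \<in> {x. ?t \<le> u x}" using LIMSEQ_le_const2[OF \<tau>_lim] by auto
  next
    fix x assume "x \<in> {x. ?t \<le> u x}"
    then show "x \<in> (\<Inter>n. {x. \<tau> n < u x})" using \<tau>(2) by (auto intro: less_le_trans)
  qed
  finally have lim: "(\<lambda>n. emeasure lborel {x. \<tau> n < u x}) \<longlonglongrightarrow> emeasure lborel {x. ?t \<le> u x}" .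
  have "ennreal \<mu> \<le> emeasure lborel {x. \<tau> n < u x}" for n
    using quantile_le[OF \<tau>(1), of n \<mu>] \<tau>(2)[of n] by (meson linear not_less)
  then show ?thesis using LIMSEQ_le_const[OF lim] by blast
qed

text \<open>
  Halving the measure makes the measure of the higher plateau comparable to that of the lower
  superlevel set, so the two measures in the level estimate combine to the power $2s/N - 1$.
\<close>

lemma quantile_increment:
  assumes \<mu>: "0 < \<mu>"
  shows "quantile (\<mu> / 2) powr (\<gamma> + 1) - quantile \<mu> powr (\<gamma> + 1)
     \<le> ((\<gamma> + 1) * 2 powr (\<gamma> + 1)) * (2 * level_const CARD('n) s c) * \<mu> powr (2 * s / CARD('n) - 1)
        * (\<integral>x. f x * indicator {x. quantile \<mu> < u x} x \<partial>lborel)"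
    and "quantile \<mu> \<le> quantile (\<mu> / 2)"
proof -
  let ?a = "quantile \<mu>" and ?b = "quantile (\<mu> / 2)"
  let ?F = "\<lambda>k. \<integral>x. f x * indicator {x. k < u x} x \<partial>lborel"
  have a: "0 \<le> ?a" and b: "0 \<le> ?b" using \<mu> by (auto intro: quantile_nonneg)
  show mono: "?a \<le> ?b"
  proof (rule quantile_le[OF b])
    have "emeasure lborel {x. ?b < u x} \<le> ennreal (\<mu> / 2)" using \<mu> by (intro emeasure_above_quantile) auto
    also have "\<dots> \<le> ennreal \<mu>" using \<mu> by (intro ennreal_leI) auto
    finally show "emeasure lborel {x. ?b < u x} \<le> ennreal \<mu>" .
  qed
  have F0: "0 \<le> ?F k" for k using f(2) by (intro integral_nonneg_AE AE_I2) simp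
  have LC: "0 \<le> level_const CARD('n) s c" using c by (simp add: level_const_def)
  show "?b powr (\<gamma> + 1) - ?a powr (\<gamma> + 1)
     \<le> ((\<gamma> + 1) * 2 powr (\<gamma> + 1)) * (2 * level_const CARD('n) s c) * \<mu> powr (2 * s / CARD('n) - 1) * ?F ?a"
  proof (cases "?a < ?b")
    case False
    then have "?b powr (\<gamma> + 1) - ?a powr (\<gamma> + 1) \<le> 0" using mono by simp
    also have "0 \<le> ((\<gamma> + 1) * 2 powr (\<gamma> + 1)) * (2 * level_const CARD('n) s c) * \<mu> powr (2 * s / CARD('n) - 1) * ?F ?a"
      using F0 LC \<gamma> by (intro mult_nonneg_nonneg) auto
    finally show ?thesis .
  next
    case True
    \<comment> \<open>Starting at \<open>?b / 2\<close> when \<open>?a\<close> is much smaller keeps \<open>k powr \<gamma>\<close> comparable to \<open>?b powr \<gamma>\<close>.\<close>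
    define k where "k = max ?a (?b / 2)"
    have k: "0 < k" "k < ?b" "?a \<le> k" using True a by (auto simp: k_def)
    have 1: "emeasure lborel {x. k < u x} \<le> ennreal \<mu>"
      by (rule order_trans[OF emeasure_mono emeasure_above_quantile[OF \<mu>]]) (use k in auto)
    have 2: "ennreal (\<mu> / 2) \<le> emeasure lborel {x. ?b \<le> u x}"
      using True a by (intro emeasure_at_quantile) auto
    have "(?b - k) * k powr \<gamma> * (\<mu> / 2) \<le> level_const CARD('n) s c * \<mu> powr (2 * s / CARD('n)) * ?F k"
      using \<mu> by (intro level_estimate k 1 2) auto
    also have "\<dots> \<le> level_const CARD('n) s c * \<mu> powr (2 * s / CARD('n)) * ?F ?a"
    proof (rule mult_left_mono)
      show "?F k \<le> ?F ?a"
      proof (rule integral_mono[OF integrable_f_level integrable_f_level])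
        show "f x * indicator {x. k < u x} x \<le> f x * indicator {x. ?a < u x} x" for x
          using f(2)[of x] k(3) by (auto simp: indicator_def)
      qed
    qed (use LC in simp)
    finally have "(2 / \<mu>) * ((?b - k) * k powr \<gamma> * (\<mu> / 2)) \<le> (2 / \<mu>) * (level_const CARD('n) s c * \<mu> powr (2 * s / CARD('n)) * ?F ?a)"
      using \<mu> by (intro mult_left_mono) auto
    moreover have "(2 / \<mu>) * ((?b - k) * k powr \<gamma> * (\<mu> / 2)) = (?b - k) * k powr \<gamma>"
      using \<mu> by simp
    moreover have "(2 / \<mu>) * (level_const CARD('n) s c * \<mu> powr (2 * s / CARD('n)) * ?F ?a)
        = 2 * level_const CARD('n) s c * \<mu> powr (2 * s / CARD('n) - 1) * ?F ?a"
      using \<mu> by (simp add: powr_diff)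
    ultimately have "(?b - k) * k powr \<gamma> \<le> 2 * level_const CARD('n) s c * \<mu> powr (2 * s / CARD('n) - 1) * ?F ?a"
      by simp
    then have "((\<gamma> + 1) * 2 powr (\<gamma> + 1)) * ((?b - k) * k powr \<gamma>)
       \<le> ((\<gamma> + 1) * 2 powr (\<gamma> + 1)) * (2 * level_const CARD('n) s c * \<mu> powr (2 * s / CARD('n) - 1) * ?F ?a)"
      using \<gamma> by (intro mult_left_mono) auto
    moreover have "?b powr (\<gamma> + 1) - ?a powr (\<gamma> + 1) \<le> ((\<gamma> + 1) * 2 powr (\<gamma> + 1)) * ((?b - k) * k powr \<gamma>)"
      by (rule powr_increment_le[OF \<gamma> a True k_def])
    ultimately show ?thesis by (simp add: mult.assoc)
  qed
qed

end

section \<open>Recursions along dyadic levels\<close>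

text \<open>
  Convexity of the power, applied to $x$ and $y/(1-\theta)$. In a recursion $x_{j+1} \le \theta x_j + y_j$ this
  keeps the factor $\theta < 1$ when passing to $r$-th powers.
\<close>

lemma powr_convex_combination_le:
  fixes x y \<theta> r :: real
  assumes xy: "0 \<le> x" "0 \<le> y" and \<theta>: "0 < \<theta>" "\<theta> < 1" and r: "1 \<le> r"
  shows "(\<theta> * x + y) powr r \<le> \<theta> * x powr r + (1 - \<theta>) powr (1 - r) * y powr r"
proof -
  have small: "\<theta> powr r \<le> \<theta>" using \<theta> r powr_mono'[of 1 r \<theta>] by simp
  consider "x = 0" | "y = 0" | "0 < x" "0 < y" using xy by linarith
  then show ?thesis
  proof cases
    case 1
    have "1 \<le> (1 - \<theta>) powr (1 - r)"
      using \<theta> r powr_mono'[of "1 - r" 0 "1 - \<theta>"] by simp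
    then have "1 * y powr r \<le> (1 - \<theta>) powr (1 - r) * y powr r" by (intro mult_right_mono) auto
    then show ?thesis using 1 by simp
  next
    case 2
    have "\<theta> powr r * x powr r \<le> \<theta> * x powr r" using small by (intro mult_right_mono) auto
    then show ?thesis using 2 \<theta> xy by (simp add: powr_mult)
  next
    case 3
    have "(\<theta> * x + (1 - \<theta>) * (y / (1 - \<theta>))) powr r \<le> \<theta> * x powr r + (1 - \<theta>) * (y / (1 - \<theta>)) powr r"
      using convex_onD[OF powr_convex[OF r], of "1 - \<theta>" x "y / (1 - \<theta>)"] 3 \<theta> by simp
    moreover have "(1 - \<theta>) * (y / (1 - \<theta>)) powr r = (1 - \<theta>) powr (1 - r) * y powr r"
      using 3 \<theta> by (simp add: powr_divide powr_diff)
    ultimately show ?thesis using \<theta> by simp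
  qed
qed

lemma sum_le_of_forward_recursion:
  fixes x y :: "nat \<Rightarrow> real"
  assumes \<theta>: "0 \<le> \<theta>" "\<theta> < 1" and x: "x 0 = 0" "\<And>j. 0 \<le> x j" and rec: "\<And>j. x (Suc j) \<le> \<theta> * x j + y j"
  shows "(\<Sum>j\<le>n. x j) \<le> (\<Sum>j<n. y j) / (1 - \<theta>)"
proof -
  have "(\<Sum>j\<le>n. x j) = (\<Sum>j<n. x (Suc j))"
    using x(1) by (simp add: lessThan_Suc_atMost[symmetric] sum.lessThan_Suc_shift del: sum.lessThan_Suc)
  also have "\<dots> \<le> (\<Sum>j<n. \<theta> * x j + y j)" by (intro sum_mono rec)
  also have "\<dots> = \<theta> * (\<Sum>j<n. x j) + (\<Sum>j<n. y j)" by (simp add: sum.distrib sum_distrib_left)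
  also have "\<dots> \<le> \<theta> * (\<Sum>j\<le>n. x j) + (\<Sum>j<n. y j)"
    using \<theta> x(2) by (intro add_right_mono mult_left_mono sum_mono2) auto
  finally have "(1 - \<theta>) * (\<Sum>j\<le>n. x j) \<le> (\<Sum>j<n. y j)" by (simp add: algebra_simps)
  then show ?thesis using \<theta> by (simp add: pos_le_divide_eq mult.commute)
qed

lemma sum_le_of_backward_recursion:
  fixes x y :: "nat \<Rightarrow> real"
  assumes \<theta>: "0 \<le> \<theta>" "\<theta> < 1" and x: "\<And>j. 0 \<le> x j" "\<And>j. x j \<le> b" and rec: "\<And>j. x j \<le> \<theta> * x (Suc j) + y j"
  shows "(\<Sum>j<n. x j) \<le> (b + (\<Sum>j<n. y j)) / (1 - \<theta>)"
proof -
  have b: "0 \<le> b" using x order_trans by blast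
  have "(\<Sum>j<n. x j) \<le> (\<Sum>j<n. \<theta> * x (Suc j) + y j)" by (intro sum_mono rec)
  also have "\<dots> = \<theta> * (\<Sum>j<n. x (Suc j)) + (\<Sum>j<n. y j)" by (simp add: sum.distrib sum_distrib_left)
  also have "(\<Sum>j<n. x (Suc j)) \<le> (\<Sum>j<Suc n. x j)"
    using x(1)[of 0] by (simp add: sum.lessThan_Suc_shift del: sum.lessThan_Suc)
  also have "(\<Sum>j<Suc n. x j) \<le> (\<Sum>j<n. x j) + b" using x(2)[of n] by simp
  finally have "(\<Sum>j<n. x j) \<le> \<theta> * ((\<Sum>j<n. x j) + b) + (\<Sum>j<n. y j)"
    using \<theta> by (simp add: mult_left_mono)
  moreover have "\<theta> * b \<le> 1 * b" using \<theta> b by (intro mult_right_mono) auto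
  ultimately have "(1 - \<theta>) * (\<Sum>j<n. x j) \<le> b + (\<Sum>j<n. y j)" by (simp add: algebra_simps)
  then show ?thesis using \<theta> by (simp add: pos_le_divide_eq mult.commute)
qed

text \<open>
  Below $\tau$ the first term suffices, above $\tau$ the second. Integrating and choosing $\tau$
  optimally gives Hoelder's inequality against an indicator function, up to the factor $2$.
\<close>

lemma le_add_powr:
  fixes x \<tau> r :: real
  assumes "0 \<le> x" "0 < \<tau>" "1 \<le> r"
  shows "x \<le> \<tau> + \<tau> powr (1 - r) * x powr r"
proof (cases "x \<le> \<tau>")
  case False
  then have "\<tau> powr (r - 1) \<le> x powr (r - 1)" using assms by (intro powr_mono2) auto
  then have "\<tau> powr (1 - r) * \<tau> powr (r - 1) * x \<le> \<tau> powr (1 - r) * x powr (r - 1) * x"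
    using assms by (intro mult_right_mono mult_left_mono) auto
  moreover have "\<tau> powr (1 - r) * \<tau> powr (r - 1) = 1"
    using assms by (simp flip: powr_add)
  moreover have "x powr (r - 1) * x = x powr r"
    using assms False by (simp add: powr_diff)
  ultimately show ?thesis using assms by (simp add: mult.assoc)
qed (use assms in \<open>simp add: add_increasing2\<close>)

lemma powr_balance:
  fixes m E r :: real
  assumes "0 < m" "0 < E" "1 \<le> r"
  defines "\<tau> \<equiv> (E / m) powr (1 / r)"
  shows "\<tau> * m + \<tau> powr (1 - r) * E = 2 * (E powr (1 / r) * m powr (1 - 1 / r))"
proof -
  have 1: "\<tau> * m = E powr (1 / r) * m powr (1 - 1 / r)"
    using assms by (simp add: \<tau>_def powr_divide powr_diff)
  have "\<tau> powr (1 - r) = \<tau> powr 1 / \<tau> powr r" by (simp add: powr_diff)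
  also have "\<tau> powr r = E / m" using assms by (simp add: \<tau>_def powr_powr)
  finally have "\<tau> powr (1 - r) * E = \<tau> * m" using assms by (simp add: \<tau>_def)
  then show ?thesis using 1 by simp
qed

lemma sum_le_powr_mean:
  fixes x :: "nat \<Rightarrow> real"
  assumes x: "\<And>j. 0 \<le> x j" and r: "1 \<le> r" and S: "(\<Sum>j<n. x j powr r) \<le> S" "0 < S" and n: "0 < n"
  shows "(\<Sum>j<n. x j) \<le> 2 * (S powr (1 / r) * real n powr (1 - 1 / r))"
proof -
  define \<tau> where "\<tau> = (S / real n) powr (1 / r)"
  have \<tau>: "0 < \<tau>" using S n by (simp add: \<tau>_def)
  have "(\<Sum>j<n. x j) \<le> (\<Sum>j<n. \<tau> + \<tau> powr (1 - r) * x j powr r)"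
    by (intro sum_mono le_add_powr x \<tau> r)
  also have "\<dots> = \<tau> * real n + \<tau> powr (1 - r) * (\<Sum>j<n. x j powr r)"
    by (simp add: sum.distrib sum_distrib_left mult.commute)
  also have "\<dots> \<le> \<tau> * real n + \<tau> powr (1 - r) * S" using S by (intro add_left_mono mult_left_mono) auto
  also have "\<dots> = 2 * (S powr (1 / r) * real n powr (1 - 1 / r))"
    unfolding \<tau>_def using n S r by (intro powr_balance) auto
  finally show ?thesis .
qed

lemma integral_le_powr_mean:
  fixes f :: "'a \<Rightarrow> real"
  assumes A: "A \<in> sets M" "emeasure M A \<le> ennreal m" "0 < m" and r: "1 \<le> r"
    and f: "\<And>x. 0 \<le> f x" "integrable M (\<lambda>x. f x powr r)" "integrable M f"
  shows "(\<integral>x. f x * indicator A x \<partial>M)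
     \<le> 2 * ((\<integral>x. f x powr r * indicator A x \<partial>M) powr (1 / r) * m powr (1 - 1 / r))"
proof -
  define E where "E = (\<integral>x. f x powr r * indicator A x \<partial>M)"
  have [measurable]: "A \<in> sets M" by (rule A)
  have [measurable]: "f \<in> borel_measurable M" by (rule borel_measurable_integrable[OF f(3)])
  have i1: "integrable M (\<lambda>x. f x * indicator A x)" and i2: "integrable M (\<lambda>x. f x powr r * indicator A x)"
    using integrable_mult_indicator[OF A(1) f(3)] integrable_mult_indicator[OF A(1) f(2)]
    by (simp_all add: mult.commute)
  have i3: "integrable M (indicator A :: _ \<Rightarrow> real)"
    using A by (auto simp: integrable_indicator_iff intro: order_le_less_trans)
  have E0: "0 \<le> E" unfolding E_def by (intro integral_nonneg_AE AE_I2) simp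
  show ?thesis
  proof (cases "E = 0")
    case True
    then have "AE x in M. f x powr r * indicator A x = 0"
      using integral_nonneg_eq_0_iff_AE[OF i2] unfolding E_def by simp
    then have "AE x in M. f x * indicator A x = 0" by eventually_elim (auto simp: indicator_def)
    then have "(\<integral>x. f x * indicator A x \<partial>M) = 0" by (rule integral_eq_zero_AE)
    then show ?thesis by simp
  next
    case False
    then have E: "0 < E" using E0 by simp
    define \<tau> where "\<tau> = (E / m) powr (1 / r)"
    have \<tau>: "0 < \<tau>" using E A by (simp add: \<tau>_def)
    have mA: "(\<integral>x. indicator A x \<partial>M) \<le> m"
      using A by (simp add: measure_def enn2real_le_iff enn2real_leI)
    have "(\<integral>x. f x * indicator A x \<partial>M)
       \<le> (\<integral>x. \<tau> * indicator A x + \<tau> powr (1 - r) * (f x powr r * indicator A x) \<partial>M)"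
    proof (rule integral_mono[OF i1])
      show "integrable M (\<lambda>x. \<tau> * indicator A x + \<tau> powr (1 - r) * (f x powr r * indicator A x))"
        by (intro Bochner_Integration.integrable_add integrable_mult_right i2 i3)
      show "f x * indicator A x \<le> \<tau> * indicator A x + \<tau> powr (1 - r) * (f x powr r * indicator A x)" for x
        using le_add_powr[OF f(1) \<tau> r, of x] by (simp add: indicator_def)
    qed
    also have "\<dots> = \<tau> * (\<integral>x. indicator A x \<partial>M) + \<tau> powr (1 - r) * E"
      using i2 i3 by (simp add: E_def)
    also have "\<dots> \<le> \<tau> * m + \<tau> powr (1 - r) * E"
      using mA \<tau> by (intro add_right_mono mult_left_mono) auto
    also have "\<dots> = 2 * (E powr (1 / r) * m powr (1 - 1 / r))"
      unfolding \<tau>_def by (rule powr_balance[OF A(3) E r])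
    finally show ?thesis by (simp add: E_def)
  qed
qed

definition level_sum_const :: "real \<Rightarrow> real" where
  "level_sum_const r =
     (2 powr r + (1 - 2 powr (- (1 - 1 / r))) powr (1 - r) * 2 powr r) / (1 - 2 powr (- (1 - 1 / r)))"

definition subcritical_const :: "real \<Rightarrow> real \<Rightarrow> real \<Rightarrow> real \<Rightarrow> real" where
  "subcritical_const A M r \<beta> =
     (1 - 2 powr (- \<beta>)) powr (1 - 1 / \<beta>) * (A * M powr (- \<beta>)) powr (1 / \<beta>) * 2 powr (1 / \<beta> - r)
       * level_sum_const r / (1 - 2 powr (- \<beta>))"

text \<open>
  What the argument uses of a solution: \<open>v j\<close> is the power $\gamma + 1$ of the $j$-th quantile, \<open>F j\<close> is
  the mass of the data above that quantile, and \<open>G j\<close> is the part of \<open>E\<close>, the integral of the $r$-th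
  power of the data, carried by the shell between two consecutive quantiles.
\<close>

locale level_sequence =
  fixes v F G :: "nat \<Rightarrow> real" and A M a r E :: real
  assumes A: "0 \<le> A" and M: "0 < M" and r: "1 < r" and E: "0 \<le> E"
    and v0: "v 0 = 0" and v: "\<And>j. v (Suc j) \<le> v j + A * (M / 2 ^ j) powr (- a) * F j" "\<And>j. 0 \<le> v j"
    and F: "\<And>j. 0 \<le> F j" "\<And>j. F j \<le> F (Suc j) + 2 * (G j powr (1 / r) * (M / 2 ^ j) powr (1 - 1 / r))"
       "\<And>j. F j \<le> 2 * (E powr (1 / r) * (M / 2 ^ j) powr (1 - 1 / r))"
    and G: "\<And>j. 0 \<le> G j" "\<And>n. (\<Sum>j<n. G j) \<le> E"
begin

text \<open>
  The mass relative to the power of the measure that Hoelder's inequality gives; it obeys a backward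
  recursion with a factor below one.
\<close>

definition H :: "nat \<Rightarrow> real" where
  "H j = F j / (M / 2 ^ j) powr (1 - 1 / r)"

lemma Mj: "0 < M / 2 ^ j" using M by simp

lemma H_nonneg: "0 \<le> H j" by (simp add: H_def F)

lemma H_le: "H j \<le> 2 * E powr (1 / r)"
  using F(3)[of j] Mj[of j] by (simp add: H_def divide_le_eq mult_ac)

lemma H_rec: "H j \<le> 2 powr (- (1 - 1 / r)) * H (Suc j) + 2 * G j powr (1 / r)"
proof -
  have e: "(M / 2 ^ j) powr (1 - 1 / r) = 2 powr (1 - 1 / r) * (M / 2 ^ Suc j) powr (1 - 1 / r)"
    using M by (simp flip: powr_mult)
  have "H j \<le> (F (Suc j) + 2 * (G j powr (1 / r) * (M / 2 ^ j) powr (1 - 1 / r))) / (M / 2 ^ j) powr (1 - 1 / r)"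
    unfolding H_def by (intro divide_right_mono F) simp
  also have "\<dots> = F (Suc j) / (M / 2 ^ j) powr (1 - 1 / r) + 2 * G j powr (1 / r)"
    using M by (simp add: add_divide_distrib)
  also have "F (Suc j) / (M / 2 ^ j) powr (1 - 1 / r) = 2 powr (- (1 - 1 / r)) * H (Suc j)"
    unfolding H_def e powr_minus by (simp add: field_simps)
  finally show ?thesis .
qed

lemma ratio_bounds: "0 < 2 powr (- (1 - 1 / r))" "2 powr (- (1 - 1 / r)) < (1::real)"
proof -
  have "2 powr (- (1 - 1 / r)) < 2 powr (0::real)"
    using r by (intro powr_less_mono) (auto simp: divide_less_eq)
  then show "2 powr (- (1 - 1 / r)) < (1::real)" by simp
qed simp

lemma level_sum_const_nonneg: "0 \<le> level_sum_const r"
  unfolding level_sum_const_def using ratio_bounds by (intro divide_nonneg_nonneg add_nonneg_nonneg mult_nonneg_nonneg) auto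

text \<open>
  The sequence \<open>H\<close> is bounded, which closes the backward recursion for finite sums of $r$-th powers.
\<close>

lemma sum_H: "(\<Sum>j<n. H j powr r) \<le> level_sum_const r * E"
proof -
  let ?\<theta> = "2 powr (- (1 - 1 / r))"
  have "(\<Sum>j<n. H j powr r) \<le> (2 powr r * E + (\<Sum>j<n. (1 - ?\<theta>) powr (1 - r) * (2 powr r * G j))) / (1 - ?\<theta>)"
  proof (rule sum_le_of_backward_recursion)
    show "H j powr r \<le> 2 powr r * E" for j
      using powr_mono2[OF _ H_nonneg H_le, of r j] r E by (simp add: powr_mult powr_powr)
    show "H j powr r \<le> ?\<theta> * H (Suc j) powr r + (1 - ?\<theta>) powr (1 - r) * (2 powr r * G j)" for j
    proof -
      have "H j powr r \<le> (?\<theta> * H (Suc j) + 2 * G j powr (1 / r)) powr r"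
        using r by (intro powr_mono2 H_nonneg H_rec) auto
      also have "\<dots> \<le> ?\<theta> * H (Suc j) powr r + (1 - ?\<theta>) powr (1 - r) * (2 * G j powr (1 / r)) powr r"
        using ratio_bounds r by (intro powr_convex_combination_le H_nonneg) auto
      also have "(2 * G j powr (1 / r)) powr r = 2 powr r * G j"
        using r G(1)[of j] by (simp add: powr_mult powr_powr)
      finally show ?thesis .
    qed
  qed (use ratio_bounds in auto)
  also have "\<dots> \<le> (2 powr r * E + (1 - ?\<theta>) powr (1 - r) * (2 powr r * E)) / (1 - ?\<theta>)"
    unfolding sum_distrib_left[symmetric]
    using ratio_bounds G(2)[of n] by (intro divide_right_mono add_left_mono mult_left_mono) auto
  also have "\<dots> = level_sum_const r * E" by (simp add: level_sum_const_def add_divide_distrib distrib_right)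
  finally show ?thesis .
qed

lemma v_step: "v (Suc j) \<le> v j + A * (M / 2 ^ j) powr (1 - 1 / r - a) * H j"
proof -
  have "(M / 2 ^ j) powr (- a) * F j = (M / 2 ^ j) powr (1 - 1 / r - a) * H j"
  proof -
    have "(M / 2 ^ j) powr (1 - 1 / r - a) = (M / 2 ^ j) powr (- a) * (M / 2 ^ j) powr (1 - 1 / r)"
      unfolding powr_add[symmetric] by (simp add: add.commute)
    then show ?thesis using M by (simp add: H_def)
  qed
  then show ?thesis using v(1)[of j] by (simp add: mult.assoc)
qed

text \<open>
  In the critical case the increments of \<open>v\<close> are multiples of \<open>H\<close>, whose $r$-th powers are summable, so
  Hoelder's inequality for sums of $n$ terms yields the growth.
\<close>

lemma critical_growth:
  assumes a: "a = 1 - 1 / r"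
  shows "v n \<le> A * 2 * (level_sum_const r + 1) powr (1 / r) * E powr (1 / r) * real n powr (1 - 1 / r)"
proof (cases "n = 0 \<or> E = 0")
  case True
  have "v n = 0" if "E = 0"
  proof -
    have "H j = 0" for j using H_le[of j] H_nonneg[of j] that by simp
    then have "v (Suc j) \<le> v j" for j using v_step[of j] by simp
    then have "v n \<le> v 0" by (induction n) (auto intro: order_trans)
    then show ?thesis using v0 v(2)[of n] by simp
  qed
  then show ?thesis using True v0 A by auto
next
  case False
  have E': "0 < E" using False E by simp
  have "v n \<le> A * (\<Sum>j<n. H j)"
  proof (induction n)
    case (Suc n)
    then show ?case using v_step[of n] a M by (simp add: distrib_left)
  qed (simp add: v0)
  also have "(\<Sum>j<n. H j) \<le> 2 * (((level_sum_const r + 1) * E) powr (1 / r) * real n powr (1 - 1 / r))"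
  proof (rule sum_le_powr_mean[OF H_nonneg])
    show "(\<Sum>j<n. H j powr r) \<le> (level_sum_const r + 1) * E" using sum_H[of n] E by (simp add: distrib_right)
    show "0 < (level_sum_const r + 1) * E" using E' level_sum_const_nonneg by (intro mult_pos_pos) auto
  qed (use False r in auto)
  also have "((level_sum_const r + 1) * E) powr (1 / r) = (level_sum_const r + 1) powr (1 / r) * E powr (1 / r)"
    using E level_sum_const_nonneg by (simp add: powr_mult)
  finally show ?thesis using A by (simp add: mult_left_mono mult.assoc)
qed

text \<open>
  The weights $2^{-j}$ turn the growing coefficients into a forward recursion with the factor
  $2^{-\beta} < 1$. Its inhomogeneity \<open>H\<close> is summable to the power $r$ and bounded, hence summable to the
  larger power $1/\beta$.
\<close>

lemma subcritical_sum:
  assumes \<beta>: "0 < \<beta>" "\<beta> = a - (1 - 1 / r)" and br: "r \<le> 1 / \<beta>"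
  shows "(\<Sum>j\<le>n. v j powr (1 / \<beta>) / 2 ^ j) \<le> subcritical_const A M r \<beta> * E powr (1 / (\<beta> * r))"
proof -
  define q where "q = 1 / \<beta>"
  have rq: "r \<le> q" using br by (simp add: q_def)
  have "1 < q" using rq r by linarith
  then have q: "r \<le> q" "1 < q" "0 < q" using rq by auto
  have q\<beta>: "q * \<beta> = 1" using \<beta>(1) by (simp add: q_def)
  define \<theta> where "\<theta> = 2 powr (- \<beta>)"
  have \<theta>: "0 < \<theta>" "\<theta> < 1" using \<beta> powr_less_mono[of "-\<beta>" 0 2] by (auto simp: \<theta>_def)
  define b where "b j = \<theta> ^ j * v j" for j
  have b_powr: "b j powr q = v j powr q / 2 ^ j" for j
  proof -
    have "\<theta> ^ j = 2 powr (- \<beta> * real j)" by (simp add: \<theta>_def powr_power mult.commute)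
    then have "(\<theta> ^ j) powr q = 2 powr (- (q * \<beta>) * real j)" by (simp add: powr_powr mult_ac)
    then have "(\<theta> ^ j) powr q = 1 / 2 ^ j" unfolding q\<beta> by (simp add: powr_minus powr_realpow divide_simps)
    then show ?thesis using v(2)[of j] \<theta> by (simp add: b_def powr_mult)
  qed
  define B where "B = A * M powr (- \<beta>)"
  have B: "0 \<le> B" using A by (simp add: B_def)
  have rec: "b (Suc j) \<le> \<theta> * b j + B * H j" for j
  proof -
    have "(M / 2 ^ j) powr (1 - 1 / r - a) = (M / 2 ^ j) powr (- \<beta>)" by (simp add: \<beta>(2))
    also have "\<dots> = M powr (- \<beta>) / (2 ^ j) powr (- \<beta>)" using M by (simp add: powr_divide)
    also have "(2 ^ j) powr (- \<beta>) = \<theta> ^ j"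
      by (simp add: \<theta>_def powr_power powr_powr mult.commute flip: powr_realpow)
    finally have e: "\<theta> ^ j * (M / 2 ^ j) powr (1 - 1 / r - a) = M powr (- \<beta>)" using \<theta> by simp
    have "b (Suc j) \<le> \<theta> ^ Suc j * (v j + A * (M / 2 ^ j) powr (1 - 1 / r - a) * H j)"
      unfolding b_def using v_step[of j] \<theta> by (intro mult_left_mono) auto
    also have "\<dots> = \<theta> * b j + \<theta> * (A * (\<theta> ^ j * (M / 2 ^ j) powr (1 - 1 / r - a)) * H j)"
      by (simp add: b_def algebra_simps)
    also have "\<dots> = \<theta> * b j + \<theta> * (B * H j)" unfolding e B_def by simp
    also have "\<dots> \<le> \<theta> * b j + 1 * (B * H j)"
      using \<theta> B H_nonneg[of j] by (intro add_left_mono mult_right_mono) auto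
    finally show ?thesis by simp
  qed
  have s1: "(\<Sum>j\<le>n. b j powr q) \<le> (\<Sum>j<n. (1 - \<theta>) powr (1 - q) * (B * H j) powr q) / (1 - \<theta>)"
  proof (rule sum_le_of_forward_recursion)
    show "b (Suc j) powr q \<le> \<theta> * b j powr q + (1 - \<theta>) powr (1 - q) * (B * H j) powr q" for j
    proof -
      have "b (Suc j) powr q \<le> (\<theta> * b j + B * H j) powr q"
        using q \<theta> v(2)[of "Suc j"] by (intro powr_mono2 rec) (auto simp: b_def)
      also have "\<dots> \<le> \<theta> * b j powr q + (1 - \<theta>) powr (1 - q) * (B * H j) powr q"
        using q \<theta> v(2)[of j] B H_nonneg[of j] by (intro powr_convex_combination_le) (auto simp: b_def)
      finally show ?thesis .
    qed
  qed (use \<theta> q v0 in \<open>auto simp: b_def\<close>)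
  have s2: "(\<Sum>j<n. (1 - \<theta>) powr (1 - q) * (B * H j) powr q)
     \<le> (1 - \<theta>) powr (1 - q) * (B powr q * (2 powr (q - r) * E powr ((q - r) / r) * (level_sum_const r * E)))"
  proof -
    have "(B * H j) powr q \<le> B powr q * (2 powr (q - r) * E powr ((q - r) / r) * H j powr r)" for j
    proof -
      have "H j powr q = H j powr (q - r) * H j powr r" by (simp flip: powr_add)
      also have "\<dots> \<le> (2 * E powr (1 / r)) powr (q - r) * H j powr r"
        using q by (intro mult_right_mono powr_mono2 H_nonneg H_le) auto
      also have "(2 * E powr (1 / r)) powr (q - r) = 2 powr (q - r) * E powr ((q - r) / r)"
        by (simp add: powr_mult powr_powr)
      finally show ?thesis using B H_nonneg[of j] by (simp add: powr_mult mult_left_mono)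
    qed
    then have "(\<Sum>j<n. (1 - \<theta>) powr (1 - q) * (B * H j) powr q)
      \<le> (\<Sum>j<n. (1 - \<theta>) powr (1 - q) * (B powr q * (2 powr (q - r) * E powr ((q - r) / r) * H j powr r)))"
      by (intro sum_mono mult_left_mono) auto
    also have "\<dots> = (1 - \<theta>) powr (1 - q) * (B powr q * (2 powr (q - r) * E powr ((q - r) / r) * (\<Sum>j<n. H j powr r)))"
      by (simp only: sum_distrib_left)
    also have "\<dots> \<le> (1 - \<theta>) powr (1 - q) * (B powr q * (2 powr (q - r) * E powr ((q - r) / r) * (level_sum_const r * E)))"
      by (intro mult_left_mono sum_H) auto
    finally show ?thesis .
  qed
  have s3: "E powr ((q - r) / r) * (level_sum_const r * E) = level_sum_const r * E powr (q / r)"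
  proof (cases "E = 0")
    case False
    then have "E powr ((q - r) / r) * E = E powr (q / r)" using r E
      by (simp add: diff_divide_distrib powr_diff)
    then show ?thesis by simp
  qed simp
  have "(\<Sum>j\<le>n. b j powr q)
     \<le> (1 - \<theta>) powr (1 - q) * (B powr q * (2 powr (q - r) * E powr ((q - r) / r) * (level_sum_const r * E))) / (1 - \<theta>)"
    by (rule order_trans[OF s1 divide_right_mono[OF s2]]) (use \<theta> in simp)
  also have "\<dots> = (1 - \<theta>) powr (1 - q) * (B powr q * (2 powr (q - r) * (level_sum_const r * E powr (q / r)))) / (1 - \<theta>)"
    by (simp only: mult.assoc s3)
  also have "\<dots> = subcritical_const A M r \<beta> * E powr (1 / (\<beta> * r))"
    by (simp add: subcritical_const_def q_def B_def \<theta>_def mult_ac)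
  finally show ?thesis unfolding b_powr by (simp add: q_def)
qed

end

text \<open>
  The increments form a geometric series.
\<close>

lemma supercritical_bound:
  fixes v F :: "nat \<Rightarrow> real" and A M a P Q :: real
  assumes "0 \<le> A" "0 < M" "a < P" "v 0 = 0" "0 \<le> Q"
    and v: "\<And>j. v (Suc j) \<le> v j + A * (M / 2 ^ j) powr (- a) * F j"
    and F: "\<And>j. F j \<le> Q * (M / 2 ^ j) powr P"
  shows "v n \<le> A * M powr (P - a) / (1 - 2 powr (- (P - a))) * Q"
proof -
  define \<theta> where "\<theta> = 2 powr (- (P - a))"
  have \<theta>: "0 < \<theta>" "\<theta> < 1" using assms powr_less_mono[of "-(P - a)" 0 2] by (auto simp: \<theta>_def)
  have step: "v (Suc j) \<le> v j + (A * M powr (P - a) * Q) * \<theta> ^ j" for j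
  proof -
    have "(M / 2 ^ j) powr (- a) * (M / 2 ^ j) powr P = (M / 2 ^ j) powr (P - a)"
      by (simp flip: powr_add)
    also have "\<dots> = M powr (P - a) * \<theta> ^ j"
    proof -
      have "(2 ^ j) powr (P - a) = 2 powr (real j * (P - a))" by (simp add: powr_powr flip: powr_realpow)
      moreover have "\<theta> ^ j = 1 / 2 powr (real j * (P - a))"
        by (simp add: \<theta>_def powr_power powr_minus_divide[symmetric] right_diff_distrib)
      ultimately show ?thesis using assms by (simp add: powr_divide)
    qed
    finally have e: "(M / 2 ^ j) powr (- a) * (M / 2 ^ j) powr P = M powr (P - a) * \<theta> ^ j" .
    have "A * (M / 2 ^ j) powr (- a) * F j \<le> A * (M / 2 ^ j) powr (- a) * (Q * (M / 2 ^ j) powr P)"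
      using assms F by (intro mult_left_mono) auto
    also have "\<dots> = A * Q * ((M / 2 ^ j) powr (- a) * (M / 2 ^ j) powr P)" by simp
    finally show ?thesis using v[of j] unfolding e by (simp add: mult_ac)
  qed
  have "v n \<le> (A * M powr (P - a) * Q) * (\<Sum>j<n. \<theta> ^ j)"
  proof (induction n)
    case (Suc n)
    then show ?case using step[of n] by (simp add: distrib_left)
  qed (simp add: assms)
  also have "(\<Sum>j<n. \<theta> ^ j) \<le> 1 / (1 - \<theta>)"
    using \<theta> by (simp add: sum_gp_strict divide_right_mono)
  then have "(A * M powr (P - a) * Q) * (\<Sum>j<n. \<theta> ^ j) \<le> (A * M powr (P - a) * Q) * (1 / (1 - \<theta>))"
    using assms by (intro mult_left_mono) auto
  finally show ?thesis by (simp add: \<theta>_def)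
qed

section \<open>Bounds in terms of the distribution of the data\<close>

definition step_const :: "nat \<Rightarrow> real \<Rightarrow> real \<Rightarrow> real \<Rightarrow> real" where
  "step_const N s c \<gamma> = (\<gamma> + 1) * 2 powr (\<gamma> + 1) * (2 * level_const N s c)"

lemma exp_scaled_le:
  fixes \<theta> x :: real
  assumes "0 \<le> \<theta>" "\<theta> \<le> 1"
  shows "exp (\<theta> * x) - 1 \<le> \<theta> * (exp x - 1)"
proof -
  have "convex_on UNIV (exp :: real \<Rightarrow> real)"
    by (intro convex_on_realI[where f' = exp]) (auto intro!: derivative_eq_intros)
  from convex_onD[OF this, of \<theta> 0 x] assms
  show ?thesis by (simp add: algebra_simps)
qed

context singular_solution
begin

context
  fixes M :: real
  assumes M: "0 < M" "emeasure lborel \<Omega> \<le> ennreal M"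
begin

definition level :: "nat \<Rightarrow> real" where
  "level j = quantile (M / 2 ^ j)"

lemma level_nonneg: "0 \<le> level j"
  unfolding level_def using M by (intro quantile_nonneg) simp

lemma level_0: "level 0 = 0"
proof -
  have "emeasure lborel {x. 0 < u x} \<le> emeasure lborel \<Omega>"
    using u_supp \<Omega>(1) by (intro emeasure_mono) force+
  then have "quantile M \<le> 0" using M(2) by (intro quantile_le) auto
  then show ?thesis using level_nonneg[of 0] by (simp add: level_def)
qed

lemma level_Suc: "level j \<le> level (Suc j)"
  using quantile_increment(2)[of "M / 2 ^ j"] M by (simp add: level_def mult.commute)

lemma level_mono: "i \<le> j \<Longrightarrow> level i \<le> level j"
  by (rule lift_Suc_mono_le[of level]) (auto intro: level_Suc)

lemma emeasure_above_level: "emeasure lborel {x. level j < u x} \<le> ennreal (M / 2 ^ j)"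
  unfolding level_def using M by (intro emeasure_above_quantile) simp

definition mass :: "nat \<Rightarrow> real" where
  "mass j = (\<integral>x. f x * indicator {x. level j < u x} x \<partial>lborel)"

lemma mass_nonneg: "0 \<le> mass j"
  unfolding mass_def using f(2) by (intro integral_nonneg_AE AE_I2) simp

lemma step_const_nonneg: "0 \<le> step_const CARD('n) s c \<gamma>"
  using \<gamma> c by (simp add: step_const_def level_const_def)

lemma level_step:
  "level (Suc j) powr (\<gamma> + 1) \<le> level j powr (\<gamma> + 1)
     + step_const CARD('n) s c \<gamma> * (M / 2 ^ j) powr (- (1 - 2 * s / CARD('n))) * mass j"
  using quantile_increment(1)[of "M / 2 ^ j"] M
  by (simp add: level_def mass_def step_const_def mult.commute[of 2 "2 ^ j"])

lemma AE_below_some_level: "AE x in lborel. \<exists>j. u x \<le> level j"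
proof -
  have "emeasure lborel (\<Inter>j. {x. level j < u x}) \<le> 0"
  proof (rule ennreal_le_epsilon)
    fix e :: real assume e: "0 < e"
    have "(\<lambda>j. M * (1 / 2) ^ j) \<longlonglongrightarrow> M * 0"
      by (intro tendsto_mult_left LIMSEQ_power_zero) simp
    then have "\<forall>\<^sub>F j in sequentially. M * (1 / 2) ^ j < e" using e by (intro order_tendstoD) auto
    then obtain j :: nat where j: "M / 2 ^ j < e" by (auto simp: eventually_sequentially power_divide)
    have "emeasure lborel (\<Inter>j. {x. level j < u x}) \<le> emeasure lborel {x. level j < u x}"
      by (intro emeasure_mono) auto
    also have "\<dots> \<le> ennreal (M / 2 ^ j)" by (rule emeasure_above_level)
    also have "\<dots> \<le> ennreal e" using j by (intro ennreal_leI) simp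
    finally show "emeasure lborel (\<Inter>j. {x. level j < u x}) \<le> 0 + ennreal e" by simp
  qed
  then have "(\<Inter>j. {x. level j < u x}) \<in> null_sets lborel" by (auto simp: null_sets_def)
  from AE_not_in[OF this] show ?thesis by eventually_elim (auto simp: not_less)
qed

text \<open>
  Between two consecutive quantiles \<open>\<Psi> (u x)\<close> is at most the value at the upper one, and almost every
  point lies below some quantile.
\<close>

lemma nn_integral_le_levels:
  assumes mono: "\<And>a b. 0 \<le> a \<Longrightarrow> a \<le> b \<Longrightarrow> \<Psi> a \<le> \<Psi> b" and \<Psi>0: "\<Psi> 0 = 0"
    and B: "\<And>n. (\<Sum>j<n. M / 2 ^ j * \<Psi> (level (Suc j))) \<le> B"
  shows "(\<integral>\<^sup>+x. ennreal (\<Psi> (u x)) \<partial>lborel) \<le> ennreal B"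
proof -
  have \<Psi>_nonneg: "0 \<le> \<Psi> a" if "0 \<le> a" for a using mono[OF order_refl that] \<Psi>0 by simp
  have "AE x in lborel. ennreal (\<Psi> (u x)) \<le> (\<Sum>j. ennreal (\<Psi> (level (Suc j))) * indicator {x. level j < u x} x)"
    using AE_below_some_level
  proof eventually_elim
    case (elim x)
    define j where "j = (LEAST j. u x \<le> level j)"
    have j: "u x \<le> level j" unfolding j_def using elim by (rule LeastI_ex)
    show ?case
    proof (cases j)
      case 0
      then have "u x = 0" using j level_0 u_nonneg[of x] by simp
      then show ?thesis by (simp add: \<Psi>0)
    next
      case (Suc i)
      have i: "level i < u x"
        using not_less_Least[of i "\<lambda>j. u x \<le> level j"] Suc by (simp add: j_def not_le)
      have "ennreal (\<Psi> (u x)) \<le> ennreal (\<Psi> (level (Suc i))) * indicator {x. level i < u x} x"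
        using i j Suc by (simp add: ennreal_leI mono[OF u_nonneg])
      also have "\<dots> \<le> (\<Sum>j. ennreal (\<Psi> (level (Suc j))) * indicator {x. level j < u x} x)"
        by (rule ennreal_le_suminf)
      finally show ?thesis .
    qed
  qed
  then have "(\<integral>\<^sup>+x. ennreal (\<Psi> (u x)) \<partial>lborel)
    \<le> (\<integral>\<^sup>+x. (\<Sum>j. ennreal (\<Psi> (level (Suc j))) * indicator {x. level j < u x} x) \<partial>lborel)"
    by (rule nn_integral_mono_AE)
  also have "\<dots> = (\<Sum>j. \<integral>\<^sup>+x. ennreal (\<Psi> (level (Suc j))) * indicator {x. level j < u x} x \<partial>lborel)"
    by (rule nn_integral_suminf) measurable
  also have "\<dots> = (\<Sum>j. ennreal (\<Psi> (level (Suc j))) * emeasure lborel {x. level j < u x})"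
    by (intro suminf_cong nn_integral_cmult_indicator) measurable
  also have "\<dots> \<le> (\<Sum>j. ennreal (M / 2 ^ j * \<Psi> (level (Suc j))))"
  proof (rule suminf_le)
    fix j
    have "ennreal (\<Psi> (level (Suc j))) * emeasure lborel {x. level j < u x}
       \<le> ennreal (\<Psi> (level (Suc j))) * ennreal (M / 2 ^ j)"
      by (intro mult_left_mono emeasure_above_level) simp
    also have "\<dots> = ennreal (M / 2 ^ j * \<Psi> (level (Suc j)))"
      using M \<Psi>_nonneg[OF level_nonneg] by (simp add: mult.commute flip: ennreal_mult)
    finally show "ennreal (\<Psi> (level (Suc j))) * emeasure lborel {x. level j < u x}
       \<le> ennreal (M / 2 ^ j * \<Psi> (level (Suc j)))" .
  qed auto
  also have "\<dots> \<le> ennreal B"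
  proof (rule suminf_le_const)
    fix n
    have "(\<Sum>j<n. ennreal (M / 2 ^ j * \<Psi> (level (Suc j)))) = ennreal (\<Sum>j<n. M / 2 ^ j * \<Psi> (level (Suc j)))"
      using M \<Psi>_nonneg[OF level_nonneg] by (intro sum_ennreal mult_nonneg_nonneg) auto
    also have "\<dots> \<le> ennreal B" by (intro ennreal_leI B)
    finally show "(\<Sum>j<n. ennreal (M / 2 ^ j * \<Psi> (level (Suc j)))) \<le> ennreal B" .
  qed simp
  finally show ?thesis .
qed

lemma bounded_of_mass_decay:
  assumes P: "1 - 2 * s / CARD('n) < P" and Q: "0 \<le> Q" and F: "\<And>j. mass j \<le> Q * (M / 2 ^ j) powr P"
  defines "K \<equiv> step_const CARD('n) s c \<gamma> * M powr (P - (1 - 2 * s / CARD('n)))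
    / (1 - 2 powr (- (P - (1 - 2 * s / CARD('n)))))"
  shows "AE x in lborel. u x \<le> (K * Q) powr (1 / (\<gamma> + 1))"
proof -
  have le: "level j \<le> (K * Q) powr (1 / (\<gamma> + 1))" for j
  proof -
    have "level j powr (\<gamma> + 1) \<le> K * Q"
      unfolding K_def
      by (rule supercritical_bound[OF step_const_nonneg M(1) P _ Q level_step F]) (simp add: level_0)
    then have "(level j powr (\<gamma> + 1)) powr (1 / (\<gamma> + 1)) \<le> (K * Q) powr (1 / (\<gamma> + 1))"
      using \<gamma> by (intro powr_mono2) auto
    then show ?thesis using \<gamma> level_nonneg[of j] by (simp add: powr_powr)
  qed
  show ?thesis using AE_below_some_level by eventually_elim (use le in \<open>auto intro: order_trans\<close>)
qed

context
  fixes r :: real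
  assumes r: "1 < r" and fr: "integrable lborel (\<lambda>x. f x powr r)"
begin

lemma mass_le: "mass j \<le> 2 * ((\<integral>x. f x powr r \<partial>lborel) powr (1 / r) * (M / 2 ^ j) powr (1 - 1 / r))"
proof -
  let ?A = "{x. level j < u x}"
  have i: "integrable lborel (\<lambda>x. f x powr r * indicator ?A x)"
    by (rule Bochner_Integration.integrable_bound[OF fr]) (auto simp: indicator_def)
  have "mass j \<le> 2 * ((\<integral>x. f x powr r * indicator ?A x \<partial>lborel) powr (1 / r) * (M / 2 ^ j) powr (1 - 1 / r))"
    unfolding mass_def using r M f fr emeasure_above_level by (intro integral_le_powr_mean) auto
  also have "(\<integral>x. f x powr r * indicator ?A x \<partial>lborel) \<le> (\<integral>x. f x powr r \<partial>lborel)"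
    by (rule integral_mono[OF i fr]) (auto simp: indicator_def)
  then have "(\<integral>x. f x powr r * indicator ?A x \<partial>lborel) powr (1 / r) \<le> (\<integral>x. f x powr r \<partial>lborel) powr (1 / r)"
    using r by (intro powr_mono2 integral_nonneg_AE AE_I2) auto
  then have "2 * ((\<integral>x. f x powr r * indicator ?A x \<partial>lborel) powr (1 / r) * (M / 2 ^ j) powr (1 - 1 / r))
     \<le> 2 * ((\<integral>x. f x powr r \<partial>lborel) powr (1 / r) * (M / 2 ^ j) powr (1 - 1 / r))"
    by (intro mult_left_mono mult_right_mono) auto
  finally show ?thesis .
qed

definition shell :: "nat \<Rightarrow> real" where
  "shell j = (\<integral>x. f x powr r * indicator {x. level j < u x \<and> u x \<le> level (Suc j)} x \<partial>lborel)"

lemma integrable_shell: "integrable lborel (\<lambda>x. f x powr r * indicator {x. a < u x \<and> u x \<le> b} x)"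
  by (rule Bochner_Integration.integrable_bound[OF fr]) (auto simp: indicator_def)

lemma sum_shell: "(\<Sum>j<n. shell j) \<le> (\<integral>x. f x powr r \<partial>lborel)"
proof -
  have "(\<Sum>j<n. shell j) = (\<integral>x. f x powr r * indicator {x. level 0 < u x \<and> u x \<le> level n} x \<partial>lborel)"
  proof (induction n)
    case 0
    have "{x. level 0 < u x \<and> u x \<le> level 0} = {}" by auto
    then show ?case by simp
  next
    case (Suc n)
    have "(\<integral>x. f x powr r * indicator {x. level 0 < u x \<and> u x \<le> level (Suc n)} x \<partial>lborel)
       = (\<integral>x. f x powr r * indicator {x. level 0 < u x \<and> u x \<le> level n} x
          + f x powr r * indicator {x. level n < u x \<and> u x \<le> level (Suc n)} x \<partial>lborel)"
      using level_mono[of 0 n] level_Suc[of n]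
      by (intro Bochner_Integration.integral_cong refl) (auto simp: indicator_def)
    then show ?case using Suc integrable_shell by (simp add: shell_def)
  qed
  also have "\<dots> \<le> (\<integral>x. f x powr r \<partial>lborel)"
    by (rule integral_mono[OF integrable_shell fr]) (auto simp: indicator_def)
  finally show ?thesis .
qed

lemma mass_Suc: "mass j \<le> mass (Suc j) + 2 * (shell j powr (1 / r) * (M / 2 ^ j) powr (1 - 1 / r))"
proof -
  let ?D = "{x. level j < u x \<and> u x \<le> level (Suc j)}"
  have i: "integrable lborel (\<lambda>x. f x * indicator ?D x)"
    using f by (intro Bochner_Integration.integrable_bound[OF f(1)]) (auto simp: indicator_def)
  have "mass j = (\<integral>x. f x * indicator {x. level (Suc j) < u x} x + f x * indicator ?D x \<partial>lborel)"
    unfolding mass_def using level_Suc[of j]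
    by (intro Bochner_Integration.integral_cong refl) (auto simp: indicator_def)
  also have "\<dots> = mass (Suc j) + (\<integral>x. f x * indicator ?D x \<partial>lborel)"
    unfolding mass_def using i integrable_f_level by simp
  also have "(\<integral>x. f x * indicator ?D x \<partial>lborel) \<le> 2 * (shell j powr (1 / r) * (M / 2 ^ j) powr (1 - 1 / r))"
    unfolding shell_def
  proof (rule integral_le_powr_mean)
    show "emeasure lborel ?D \<le> ennreal (M / 2 ^ j)"
      by (rule order_trans[OF emeasure_mono emeasure_above_level]) auto
  qed (use r M f fr in auto)
  finally show ?thesis by simp
qed

text \<open>
  The shells are disjoint, so their shares of the integral of \<open>f powr r\<close> sum to at most the whole.
\<close>

lemma level_sequence_levels:
  "level_sequence (\<lambda>j. level j powr (\<gamma> + 1)) mass shell (step_const CARD('n) s c \<gamma>) M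
     (1 - 2 * s / CARD('n)) r (\<integral>x. f x powr r \<partial>lborel)"
proof
  show "0 \<le> shell j" for j unfolding shell_def by (intro integral_nonneg_AE AE_I2) simp
  show "0 \<le> (\<integral>x. f x powr r \<partial>lborel)" by (intro integral_nonneg_AE AE_I2) simp
qed (use M r level_0 step_const_nonneg level_step mass_nonneg mass_Suc mass_le sum_shell in auto)

lemma subcritical_integral_bound:
  assumes \<beta>: "\<beta> = 1 / r - 2 * s / CARD('n)" "0 < \<beta>"
  shows "(\<integral>\<^sup>+x. ennreal (u x powr ((\<gamma> + 1) / \<beta>)) \<partial>lborel)
    \<le> ennreal (2 * M * (subcritical_const (step_const CARD('n) s c \<gamma>) M r \<beta>
          * (\<integral>x. f x powr r \<partial>lborel) powr (1 / (\<beta> * r))))"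
proof (rule nn_integral_le_levels[where \<Psi> = "\<lambda>t. t powr ((\<gamma> + 1) / \<beta>)"])
  interpret level_sequence "\<lambda>j. level j powr (\<gamma> + 1)" mass shell "step_const CARD('n) s c \<gamma>" M
     "1 - 2 * s / CARD('n)" r "\<integral>x. f x powr r \<partial>lborel"
    by (rule level_sequence_levels)
  fix n
  have "1 / (1 / r) \<le> 1 / \<beta>" using \<beta> s r by (intro divide_left_mono) auto
  then have r\<beta>: "r \<le> 1 / \<beta>" by simp
  have "(\<Sum>j<n. M / 2 ^ j * level (Suc j) powr ((\<gamma> + 1) / \<beta>))
      = 2 * M * (\<Sum>j<n. (level (Suc j) powr (\<gamma> + 1)) powr (1 / \<beta>) / 2 ^ Suc j)"
    by (simp add: sum_distrib_left powr_powr mult.commute)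
  also have "(\<Sum>j<n. (level (Suc j) powr (\<gamma> + 1)) powr (1 / \<beta>) / 2 ^ Suc j)
      \<le> (\<Sum>j\<le>n. (level j powr (\<gamma> + 1)) powr (1 / \<beta>) / 2 ^ j)"
    unfolding lessThan_Suc_atMost[symmetric] sum.lessThan_Suc_shift by simp
  also have "\<dots> \<le> subcritical_const (step_const CARD('n) s c \<gamma>) M r \<beta> * (\<integral>x. f x powr r \<partial>lborel) powr (1 / (\<beta> * r))"
    using \<beta> r\<beta> by (intro subcritical_sum) auto
  finally show "(\<Sum>j<n. M / 2 ^ j * level (Suc j) powr ((\<gamma> + 1) / \<beta>))
     \<le> 2 * M * (subcritical_const (step_const CARD('n) s c \<gamma>) M r \<beta>
          * (\<integral>x. f x powr r \<partial>lborel) powr (1 / (\<beta> * r)))"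
    using M by (simp add: mult_left_mono)
qed (use \<gamma> \<beta> in \<open>auto intro!: powr_mono2\<close>)

text \<open>
  Above the $n$-th quantile the measure decays like $2^{-n}$, while the hypothesis on \<open>k\<close> makes the
  exponent grow at most like $n \theta \ln(3/2)$. The series has ratio $3/4$, and convexity of the
  exponential function extracts the small factor \<open>\<theta>\<close>.
\<close>

lemma critical_exponential_bound:
  assumes crit: "2 * s / CARD('n) = 1 / r" and k: "0 < k" and \<theta>: "0 < \<theta>" "\<theta> \<le> 1" "6 * M * \<theta> \<le> 1"
    and p': "p' = r / (r - 1)"
    and le: "(step_const CARD('n) s c \<gamma> * 2 * (level_sum_const r + 1) powr (1 / r))
        * (\<integral>x. f x powr r \<partial>lborel) powr (1 / r) \<le> (\<theta> * ln (3 / 2)) powr (1 / p') * k powr (\<gamma> + 1)"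
  shows "(\<integral>\<^sup>+x. ennreal (exp (\<bar>u x / k\<bar> powr ((\<gamma> + 1) * p')) - 1) \<partial>lborel) \<le> 1"
proof -
  have p'1: "1 / p' = 1 - 1 / r" "0 < p'" using r by (auto simp: p' field_simps)
  interpret level_sequence "\<lambda>j. level j powr (\<gamma> + 1)" mass shell "step_const CARD('n) s c \<gamma>" M
     "1 - 2 * s / CARD('n)" r "\<integral>x. f x powr r \<partial>lborel"
    by (rule level_sequence_levels)
  have lev: "\<bar>level n / k\<bar> powr ((\<gamma> + 1) * p') \<le> \<theta> * (real n * ln (3 / 2))" for n
  proof -
    have "level n powr (\<gamma> + 1)
       \<le> (step_const CARD('n) s c \<gamma> * 2 * (level_sum_const r + 1) powr (1 / r))
          * (\<integral>x. f x powr r \<partial>lborel) powr (1 / r) * real n powr (1 - 1 / r)"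
      using critical_growth[of n] crit by simp
    also have "\<dots> \<le> ((\<theta> * ln (3 / 2)) powr (1 / p') * k powr (\<gamma> + 1)) * real n powr (1 - 1 / r)"
      by (intro mult_right_mono le) simp
    finally have "level n powr (\<gamma> + 1) / k powr (\<gamma> + 1) \<le> (\<theta> * ln (3 / 2)) powr (1 / p') * real n powr (1 / p')"
      using k p'1 by (simp add: divide_le_eq mult_ac)
    also have "\<dots> = (\<theta> * ln (3 / 2) * real n) powr (1 / p')"
      using \<theta> by (simp add: powr_mult)
    also have "level n powr (\<gamma> + 1) / k powr (\<gamma> + 1) = (level n / k) powr (\<gamma> + 1)"
      using k level_nonneg[of n] by (simp add: powr_divide)
    finally have "((level n / k) powr (\<gamma> + 1)) powr p' \<le> ((\<theta> * ln (3 / 2) * real n) powr (1 / p')) powr p'"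
      using p'1 by (intro powr_mono2) auto
    then show ?thesis using p'1(2) \<theta> k level_nonneg[of n] by (simp add: powr_powr mult_ac)
  qed
  have "(\<integral>\<^sup>+x. ennreal (exp (\<bar>u x / k\<bar> powr ((\<gamma> + 1) * p')) - 1) \<partial>lborel) \<le> ennreal (6 * M * \<theta>)"
  proof (rule nn_integral_le_levels[where \<Psi> = "\<lambda>t. exp (\<bar>t / k\<bar> powr ((\<gamma> + 1) * p')) - 1"])
    fix a b :: real assume "0 \<le> a" "a \<le> b"
    then show "exp (\<bar>a / k\<bar> powr ((\<gamma> + 1) * p')) - 1 \<le> exp (\<bar>b / k\<bar> powr ((\<gamma> + 1) * p')) - 1"
      using k p'1 \<gamma> by (auto intro!: powr_mono2 divide_right_mono)
  next
    fix n
    have "(\<Sum>j<n. M / 2 ^ j * (exp (\<bar>level (Suc j) / k\<bar> powr ((\<gamma> + 1) * p')) - 1))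
       \<le> (\<Sum>j<n. (3 / 2 * M * \<theta>) * (3 / 4) ^ j)"
    proof (rule sum_mono)
      fix j
      have "exp (\<bar>level (Suc j) / k\<bar> powr ((\<gamma> + 1) * p')) - 1 \<le> exp (\<theta> * (real (Suc j) * ln (3 / 2))) - 1"
        using lev[of "Suc j"] by simp
      also have "\<dots> \<le> \<theta> * (exp (real (Suc j) * ln (3 / 2)) - 1)"
        using \<theta> by (intro exp_scaled_le) auto
      also have "exp (real (Suc j) * ln (3 / 2)) = (3 / 2) ^ Suc j"
        by (subst exp_of_nat_mult) simp
      also have "\<theta> * ((3 / 2) ^ Suc j - 1) \<le> \<theta> * (3 / 2) ^ Suc j" using \<theta> by simp
      finally have "M / 2 ^ j * (exp (\<bar>level (Suc j) / k\<bar> powr ((\<gamma> + 1) * p')) - 1) \<le> M / 2 ^ j * (\<theta> * (3 / 2) ^ Suc j)"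
        using M by (intro mult_left_mono) auto
      also have "\<dots> = (3 / 2 * M * \<theta>) * ((3 / 2) ^ j / 2 ^ j)" by simp
      also have "(3 / 2) ^ j / 2 ^ j = (3 / 4 :: real) ^ j" by (simp flip: power_divide)
      finally show "M / 2 ^ j * (exp (\<bar>level (Suc j) / k\<bar> powr ((\<gamma> + 1) * p')) - 1) \<le> (3 / 2 * M * \<theta>) * (3 / 4) ^ j" .
    qed
    also have "\<dots> = (3 / 2 * M * \<theta>) * (\<Sum>j<n. (3 / 4) ^ j)" by (simp add: sum_distrib_left)
    also have "(\<Sum>j<n. (3 / 4 :: real) ^ j) \<le> 4" by (simp add: sum_gp_strict)
    then have "(3 / 2 * M * \<theta>) * (\<Sum>j<n. (3 / 4) ^ j) \<le> (3 / 2 * M * \<theta>) * 4"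
      using M \<theta> by (intro mult_left_mono) auto
    finally show "(\<Sum>j<n. M / 2 ^ j * (exp (\<bar>level (Suc j) / k\<bar> powr ((\<gamma> + 1) * p')) - 1)) \<le> 6 * M * \<theta>"
      by simp
  qed simp
  also have "\<dots> \<le> ennreal 1" using \<theta>(3) by (rule ennreal_leI)
  finally show ?thesis by simp
qed

end

end

end

section \<open>Borel representatives\<close>

lemma sigma_finite_lebesgue: "sigma_finite_measure (lebesgue :: 'a::euclidean_space measure)"
proof -
  obtain A :: "'a set set" where A: "countable A" "A \<subseteq> sets lborel" "\<Union>A = space lborel" "\<forall>a\<in>A. emeasure lborel a \<noteq> \<infinity>"
    using lborel.sigma_finite_countable by blast
  show ?thesis
    by (rule sigma_finite_measure.intro, intro exI[of _ A]) (use A in auto)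
qed

lemma measurable_lebesgue_pair:
  "(\<lambda>p. p) \<in> (lebesgue \<Otimes>\<^sub>M lebesgue) \<rightarrow>\<^sub>M (borel :: ('a::euclidean_space \<times> 'a) measure)"
proof -
  have id: "(\<lambda>x. x) \<in> lebesgue \<rightarrow>\<^sub>M (borel :: 'a measure)"
    by (rule measurable_completion) simp
  have "(\<lambda>p. (fst p, snd p)) \<in> (lebesgue \<Otimes>\<^sub>M lebesgue) \<rightarrow>\<^sub>M ((borel :: 'a measure) \<Otimes>\<^sub>M (borel :: 'a measure))"
    by (rule measurable_Pair[OF measurable_compose[OF measurable_fst id]
          measurable_compose[OF measurable_snd id]])
  then show ?thesis by (simp add: borel_prod)
qed

text \<open>
  The product of two completed measures lies between the product measure and its completion; on
  Borel sets it is the product measure.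
\<close>

lemma distr_lebesgue_pair:
  "distr (lebesgue \<Otimes>\<^sub>M lebesgue) borel (\<lambda>p. p) = (lborel :: ('a::euclidean_space \<times> 'a) measure)"
proof (rule measure_eqI)
  interpret L: sigma_finite_measure "lebesgue :: 'a measure" by (rule sigma_finite_lebesgue)
  fix S :: "('a \<times> 'a) set" assume "S \<in> sets (distr (lebesgue \<Otimes>\<^sub>M lebesgue) borel (\<lambda>p. p))"
  then have S: "S \<in> sets borel" by simp
  then have S2: "S \<in> sets (lborel \<Otimes>\<^sub>M lborel)" unfolding lborel_prod sets_lborel .
  have SL: "S \<in> sets (lebesgue \<Otimes>\<^sub>M lebesgue)"
    using measurable_sets[OF measurable_lebesgue_pair S] by (simp add: space_pair_measure)
  have sl: "Pair x -` S \<in> sets lborel" for x using sets_Pair1[OF S2] .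
  have "emeasure (distr (lebesgue \<Otimes>\<^sub>M lebesgue) borel (\<lambda>p. p)) S = emeasure (lebesgue \<Otimes>\<^sub>M lebesgue) S"
    using S by (subst emeasure_distr[OF measurable_lebesgue_pair]) (auto simp: space_pair_measure)
  also have "\<dots> = (\<integral>\<^sup>+x. emeasure lebesgue (Pair x -` S) \<partial>lebesgue)"
    by (rule L.emeasure_pair_measure_alt[OF SL])
  also have "\<dots> = (\<integral>\<^sup>+x. emeasure lborel (Pair x -` S) \<partial>lborel)"
    using sl by (simp add: nn_integral_completion emeasure_completion)
  also have "\<dots> = emeasure (lborel \<Otimes>\<^sub>M lborel) S"
    by (rule lborel.emeasure_pair_measure_alt[OF S2, symmetric])
  finally show "emeasure (distr (lebesgue \<Otimes>\<^sub>M lebesgue) borel (\<lambda>p. p)) S = emeasure lborel S"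
    by (simp add: lborel_prod)
qed simp

text \<open>
  Changing a function on a null set changes it on a null set of either coordinate of the product.
\<close>

lemma AE_lebesgue_pair:
  fixes P :: "'a::euclidean_space \<Rightarrow> bool"
  assumes "AE x in lborel. P x"
  shows "AE p in lebesgue \<Otimes>\<^sub>M lebesgue. P (fst p) \<and> P (snd p)"
proof -
  obtain N where N: "{x. \<not> P x} \<subseteq> N" "N \<in> null_sets lborel"
    using assms by (auto elim!: AE_E simp: null_sets_def)
  have [measurable]: "N \<in> sets borel" using N(2) by auto
  have notN: "AE x in lborel. x \<notin> N" by (rule AE_not_in[OF N(2)])
  have "AE p in (lborel \<Otimes>\<^sub>M lborel). fst p \<notin> N \<and> snd p \<notin> N"
  proof (rule lborel_pair.AE_pair_measure)
    show "AE x in lborel. AE y in lborel. fst (x, y) \<notin> N \<and> snd (x, y) \<notin> N"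
      using notN by eventually_elim (use notN in simp)
  qed measurable
  then have "AE p in (lborel :: ('a \<times> 'a) measure). fst p \<notin> N \<and> snd p \<notin> N"
    unfolding lborel_prod .
  then have "AE p in distr (lebesgue \<Otimes>\<^sub>M lebesgue) borel (\<lambda>p::'a\<times>'a. p). fst p \<notin> N \<and> snd p \<notin> N"
    unfolding distr_lebesgue_pair .
  moreover have "{p \<in> space borel. fst p \<notin> N \<and> snd p \<notin> N} \<in> sets (borel :: ('a \<times> 'a) measure)"
    unfolding borel_prod[symmetric] by measurable
  ultimately have "AE p in lebesgue \<Otimes>\<^sub>M lebesgue. fst p \<notin> N \<and> snd p \<notin> N"
    by (simp only: AE_distr_iff[OF measurable_lebesgue_pair])
  then show ?thesis by eventually_elim (use N(1) in auto)
qed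

lemma nn_integral_lebesgue_pair:
  fixes h :: "'a::euclidean_space \<times> 'a \<Rightarrow> ennreal"
  assumes "h \<in> borel_measurable borel"
  shows "(\<integral>\<^sup>+p. h p \<partial>(lebesgue \<Otimes>\<^sub>M lebesgue)) = (\<integral>\<^sup>+p. h p \<partial>lborel)"
  using nn_integral_distr[OF measurable_lebesgue_pair, of h] assms by (simp add: distr_lebesgue_pair)

lemma integral_lebesgue_pair:
  fixes h :: "'a::euclidean_space \<times> 'a \<Rightarrow> real"
  assumes "h \<in> borel_measurable borel"
  shows "(\<integral>p. h p \<partial>(lebesgue \<Otimes>\<^sub>M lebesgue)) = (\<integral>p. h p \<partial>lborel)"
  using integral_distr[OF measurable_lebesgue_pair, of h] assms by (simp add: distr_lebesgue_pair)

lemma nn_integral_lebesgue_on_eq: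
  fixes g :: "real \<Rightarrow> real" and v v' :: "'a::euclidean_space \<Rightarrow> real"
  assumes "\<Omega> \<in> sets lebesgue" "AE x in lborel. x \<in> \<Omega> \<longrightarrow> v x = v' x" "\<And>x. x \<notin> \<Omega> \<Longrightarrow> g (v' x) = 0"
  shows "(\<integral>\<^sup>+x. ennreal (g (v x)) \<partial>lebesgue_on \<Omega>) = (\<integral>\<^sup>+x. ennreal (g (v' x)) \<partial>lborel)"
proof -
  have "(\<integral>\<^sup>+x. ennreal (g (v x)) \<partial>lebesgue_on \<Omega>) = (\<integral>\<^sup>+x. ennreal (g (v x)) * indicator \<Omega> x \<partial>lborel)"
    using assms(1) by (subst nn_integral_restrict_space) (auto simp: nn_integral_completion)
  also have "\<dots> = (\<integral>\<^sup>+x. ennreal (g (v' x)) \<partial>lborel)"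
    using assms(2) by (intro nn_integral_cong_AE, eventually_elim) (auto simp: assms(3) indicator_def)
  finally show ?thesis .
qed

lemma ex_borel_representative:
  fixes f :: "'a::euclidean_space \<Rightarrow> real"
  assumes \<Omega>: "open \<Omega>" and f: "f \<in> borel_measurable (lebesgue_on \<Omega>)" "AE x in lborel. x \<in> \<Omega> \<longrightarrow> 0 \<le> f x"
  obtains f' where "f' \<in> borel_measurable borel" "\<And>x. 0 \<le> f' x" "\<And>x. x \<notin> \<Omega> \<Longrightarrow> f' x = 0"
    "AE x in lborel. x \<in> \<Omega> \<longrightarrow> f x = f' x"
proof -
  have [measurable]: "\<Omega> \<in> sets borel" using \<Omega> by simp
  have "(\<lambda>x. indicator \<Omega> x *\<^sub>R f x) \<in> borel_measurable lebesgue"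
    using f(1) \<Omega> by (subst (asm) borel_measurable_restrict_space_iff) auto
  from completion_ex_borel_measurable_real[OF this]
  obtain f0 where "f0 \<in> borel_measurable lborel" and f0: "AE x in lborel. indicator \<Omega> x *\<^sub>R f x = f0 x"
    by (elim bexE)
  then have [measurable]: "f0 \<in> borel_measurable borel" by simp
  show thesis
  proof (rule that[of "\<lambda>x. if x \<in> \<Omega> then max 0 (f0 x) else 0"])
    show "AE x in lborel. x \<in> \<Omega> \<longrightarrow> f x = (if x \<in> \<Omega> then max 0 (f0 x) else 0)"
      using f(2) f0 by eventually_elim auto
  qed auto
qed

text \<open>
  The representatives differ from the given functions on null sets only. Since null sets of one
  variable give null sets of the product, the energy, the local integrability and the equation carry over.
\<close>

lemma weak_solution_representative:
  fixes f u :: "real^'n \<Rightarrow> real"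
  assumes s: "0 < s" "s < 1" and \<Omega>: "open \<Omega>" "bounded \<Omega>" "has_lipschitz_boundary \<Omega>"
    and f: "f \<in> borel_measurable (lebesgue_on \<Omega>)" "AE x in lebesgue. x \<in> \<Omega> \<longrightarrow> 0 \<le> f x"
    and u: "u \<in> X0 s \<Omega>" and ws: "weak_solution s \<gamma> f \<Omega> u"
  obtains u' f' where
    "weak_form s (frac_laplace_const CARD('n) s / 2) \<Omega> u' (\<lambda>x. f' x / u' x powr \<gamma>)"
    "\<And>x. 0 \<le> u' x" "\<And>x. x \<notin> \<Omega> \<Longrightarrow> u' x = 0" "AE x in lborel. u x = u' x"
    "f' \<in> borel_measurable borel" "\<And>x. 0 \<le> f' x" "\<And>x. x \<notin> \<Omega> \<Longrightarrow> f' x = 0"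
    "AE x in lborel. x \<in> \<Omega> \<longrightarrow> f x = f' x"
proof -
  have \<Omega>b[measurable]: "\<Omega> \<in> sets borel" using \<Omega> by simp
  have u_leb[measurable]: "u \<in> borel_measurable lebesgue"
    and u_en: "gagliardo_energy s UNIV u < \<infinity>"
    and u0: "AE x in lborel. x \<notin> \<Omega> \<longrightarrow> u x = 0" and upos: "AE x in lborel. x \<in> \<Omega> \<longrightarrow> 0 < u x"
    using u ws by (auto simp: X0_def Hs_def Lp_space_def weak_solution_def AE_completion_iff)
  have u_on: "u \<in> borel_measurable (lebesgue_on \<Omega>)" by (rule measurable_restrict_space1[OF u_leb])
  have "AE x in lborel. x \<in> \<Omega> \<longrightarrow> 0 \<le> u x" using upos by eventually_elim auto
  from ex_borel_representative[OF \<Omega>(1) u_on this]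
  obtain u' where u': "u' \<in> borel_measurable borel" "\<And>x. 0 \<le> u' x" "\<And>x. x \<notin> \<Omega> \<Longrightarrow> u' x = 0"
    "AE x in lborel. x \<in> \<Omega> \<longrightarrow> u x = u' x" by blast
  have "AE x in lborel. x \<in> \<Omega> \<longrightarrow> 0 \<le> f x" using f(2) by (simp add: AE_completion_iff)
  from ex_borel_representative[OF \<Omega>(1) f(1) this]
  obtain f' where f': "f' \<in> borel_measurable borel" "\<And>x. 0 \<le> f' x" "\<And>x. x \<notin> \<Omega> \<Longrightarrow> f' x = 0"
    "AE x in lborel. x \<in> \<Omega> \<longrightarrow> f x = f' x" by blast
  have uu': "AE x in lborel. u x = u' x"
    using u0 u'(4) by eventually_elim (use u'(3) in auto)
  have [measurable]: "u' \<in> borel_measurable borel" "f' \<in> borel_measurable borel" by (fact u'(1) f'(1))+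
  define w where "w x = f' x / u' x powr \<gamma>" for x
  have [measurable]: "w \<in> borel_measurable borel" unfolding w_def by measurable
  have w0: "0 \<le> w x" for x using f'(2) by (simp add: w_def)
  have ww: "AE x in lborel. x \<in> \<Omega> \<longrightarrow> f x / u x powr \<gamma> = w x"
    using uu' f'(4) by eventually_elim (auto simp: w_def)
  have pair_eq: "AE p in lebesgue \<Otimes>\<^sub>M lebesgue. u (fst p) = u' (fst p) \<and> u (snd p) = u' (snd p)"
    by (rule AE_lebesgue_pair[OF uu'])
  let ?c = "frac_laplace_const CARD('n) s / 2"
  have dq: "diff_quot s v p * diff_quot s v' p
     = (v (fst p) - v (snd p)) * (v' (fst p) - v' (snd p)) / norm (fst p - snd p) powr (real CARD('n) + 2 * s)"
    for v v' :: "real^'n \<Rightarrow> real" and p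
    using diff_quot_mult[of s v "fst p" "snd p" v'] by simp
  have E: "finite_energy s u'"
  proof (rule finite_energyI_nn[OF u'(1)])
    have "(\<integral>\<^sup>+p. ennreal ((diff_quot s u' p)\<^sup>2) \<partial>lborel)
       = (\<integral>\<^sup>+p. ennreal ((diff_quot s u' p)\<^sup>2) \<partial>(lebesgue \<Otimes>\<^sub>M lebesgue))"
      by (rule nn_integral_lebesgue_pair[symmetric]) measurable
    also have "\<dots> = gagliardo_energy s UNIV u"
      unfolding gagliardo_energy_def lebesgue_on_UNIV_eq
      by (intro nn_integral_cong_AE, use pair_eq in eventually_elim)
        (simp add: split_beta power2_eq_square dq)
    finally show "(\<integral>\<^sup>+p. ennreal ((diff_quot s u' p)\<^sup>2) \<partial>lborel) < \<infinity>" using u_en by simp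
  qed
  have loc: "integrable lborel (\<lambda>x. indicator K x * w x)" if K: "compact K" "K \<subseteq> \<Omega>" for K
  proof -
    have Kb[measurable]: "K \<in> sets borel" using K by (simp add: borel_compact)
    have "(\<lambda>x. f x / u x powr \<gamma>) \<in> Lp_space 1 K"
      using ws K by (auto simp: weak_solution_def L1_loc_def)
    then have i: "integrable (lebesgue_on K) (\<lambda>x. \<bar>f x / u x powr \<gamma>\<bar>)"
      by (simp add: Lp_space_def)
    have "integrable lebesgue (\<lambda>x. indicator K x * \<bar>f x / u x powr \<gamma>\<bar>)"
      using i Kb by (subst (asm) integrable_restrict_space) auto
    moreover have "AE x in lebesgue. indicator K x * \<bar>f x / u x powr \<gamma>\<bar> = indicator K x * w x"
      unfolding AE_completion_iff using ww
    proof eventually_elim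
      case (elim x)
      then show ?case using K(2) w0[of x] by (cases "x \<in> K") (auto simp del: abs_divide)
    qed
    moreover have "(\<lambda>x. indicator K x * w x) \<in> borel_measurable lebesgue"
      by (rule measurable_completion) measurable
    ultimately have "integrable lebesgue (\<lambda>x. indicator K x * w x)"
      using integrable_cong_AE_imp by blast
    then show ?thesis by (subst (asm) integrable_completion) auto
  qed
  have weak: "?c * gform s u' \<phi> = (\<integral>x. w x * \<phi> x \<partial>lborel)"
    if \<phi>: "\<phi> \<in> test_functions \<Omega>" "\<And>x. 0 \<le> \<phi> x" for \<phi>
  proof -
    have "Ck 0 \<phi>" using \<phi>(1) by (auto simp: test_functions_def)
    then have [measurable]: "\<phi> \<in> borel_measurable borel" by (auto intro: borel_measurable_continuous_onI)
    have \<phi>_leb: "\<phi> \<in> borel_measurable lebesgue" by (rule measurable_completion) simp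
    have "gform s u' \<phi> = (\<integral>p. diff_quot s u' p * diff_quot s \<phi> p \<partial>(lebesgue \<Otimes>\<^sub>M lebesgue))"
      unfolding gform_def by (rule integral_lebesgue_pair[symmetric]) measurable
    also have "\<dots> = (\<integral>(x, y). (u x - u y) * (\<phi> x - \<phi> y) / norm (x - y) powr (real CARD('n) + 2 * s)
             \<partial>(lebesgue \<Otimes>\<^sub>M lebesgue))"
    proof (rule integral_cong_AE)
      show "(\<lambda>p. diff_quot s u' p * diff_quot s \<phi> p) \<in> borel_measurable (lebesgue \<Otimes>\<^sub>M lebesgue)"
        by (rule measurable_compose[OF measurable_lebesgue_pair, of "\<lambda>p. diff_quot s u' p * diff_quot s \<phi> p"]) measurable
      have "(\<lambda>p. (\<phi> (fst p) - \<phi> (snd p)) / norm (fst p - snd p) powr (real CARD('n) + 2 * s))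
         \<in> borel_measurable (borel :: ((real^'n) \<times> (real^'n)) measure)"
        unfolding borel_prod[symmetric] by measurable
      from measurable_compose[OF measurable_lebesgue_pair this]
      have "(\<lambda>p. (u (fst p) - u (snd p)) * ((\<phi> (fst p) - \<phi> (snd p)) / norm (fst p - snd p) powr (real CARD('n) + 2 * s)))
         \<in> borel_measurable (lebesgue \<Otimes>\<^sub>M lebesgue)"
        using measurable_compose[OF measurable_fst u_leb] measurable_compose[OF measurable_snd u_leb]
        by (intro borel_measurable_times borel_measurable_diff) auto
      then show "(\<lambda>(x, y). (u x - u y) * (\<phi> x - \<phi> y) / norm (x - y) powr (real CARD('n) + 2 * s))
         \<in> borel_measurable (lebesgue \<Otimes>\<^sub>M lebesgue)"
        by (simp add: split_beta)
      show "AE p in lebesgue \<Otimes>\<^sub>M lebesgue. diff_quot s u' p * diff_quot s \<phi> p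
        = (case p of (x, y) \<Rightarrow> (u x - u y) * (\<phi> x - \<phi> y) / norm (x - y) powr (real CARD('n) + 2 * s))"
        using pair_eq by eventually_elim (simp add: split_beta dq)
    qed
    finally have "?c * gform s u' \<phi> = (\<integral>x. f x / u x powr \<gamma> * \<phi> x \<partial>lebesgue_on \<Omega>)"
      using ws \<phi> by (simp add: weak_solution_def)
    also have "\<dots> = (\<integral>x. w x * \<phi> x \<partial>lebesgue_on \<Omega>)"
    proof (rule integral_cong_AE)
      show "(\<lambda>x. f x / u x powr \<gamma> * \<phi> x) \<in> borel_measurable (lebesgue_on \<Omega>)"
        using f(1) u_on measurable_restrict_space1[OF \<phi>_leb] by measurable
      show "(\<lambda>x. w x * \<phi> x) \<in> borel_measurable (lebesgue_on \<Omega>)"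
        by (intro measurable_restrict_space1 measurable_completion) measurable
      show "AE x in lebesgue_on \<Omega>. f x / u x powr \<gamma> * \<phi> x = w x * \<phi> x"
        using ww \<Omega>b by (subst AE_restrict_space_iff) (auto simp: AE_completion_iff elim!: eventually_mono
            simp del: times_divide_eq_left)
    qed
    also have "\<dots> = (\<integral>x. indicator \<Omega> x *\<^sub>R (w x * \<phi> x) \<partial>lebesgue)"
      using \<Omega>b by (intro integral_restrict_space) auto
    also have "\<dots> = (\<integral>x. w x * \<phi> x \<partial>lebesgue)"
      by (intro Bochner_Integration.integral_cong refl) (auto simp: indicator_def w_def f'(3))
    also have "\<dots> = (\<integral>x. w x * \<phi> x \<partial>lborel)" by (rule integral_completion) measurable
    finally show ?thesis .
  qed
  have c: "0 < ?c"
    unfolding frac_laplace_const_def using s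
    by (intro divide_pos_pos mult_pos_pos Gamma_real_pos powr_gt_zero[THEN iffD2]) auto
  have "weak_form s ?c \<Omega> u' (\<lambda>x. f' x / u' x powr \<gamma>)"
    unfolding w_def[symmetric]
    by (rule weak_form.intro) (use s c \<Omega> E w0 loc weak in auto)
  then show thesis
    by (rule that[OF _ u'(2,3) uu' f'])
qed

section \<open>Regularity of weak solutions\<close>

lemma Lp_space_finiteI:
  assumes u: "u \<in> borel_measurable (lebesgue_on \<Omega>)" and q: "0 < q" and B: "0 \<le> B"
    and le: "(\<integral>\<^sup>+x. ennreal (\<bar>u x\<bar> powr q) \<partial>lebesgue_on \<Omega>) \<le> ennreal B"
  shows "u \<in> Lp_space (ereal q) \<Omega>" "Lp_norm (ereal q) \<Omega> u \<le> B powr (1 / q)"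
proof -
  have i: "integrable (lebesgue_on \<Omega>) (\<lambda>x. \<bar>u x\<bar> powr q)"
    using u le by (intro integrableI_bounded) (auto intro: order_le_less_trans)
  then show "u \<in> Lp_space (ereal q) \<Omega>" using u by (simp add: Lp_space_def)
  have "(\<integral>x. \<bar>u x\<bar> powr q \<partial>lebesgue_on \<Omega>) \<le> B"
    using le B by (simp add: nn_integral_eq_integral[OF i])
  then have "(\<integral>x. \<bar>u x\<bar> powr q \<partial>lebesgue_on \<Omega>) powr (1 / q) \<le> B powr (1 / q)"
    using q by (intro powr_mono2 integral_nonneg_AE AE_I2) auto
  then show "Lp_norm (ereal q) \<Omega> u \<le> B powr (1 / q)" by (simp add: Lp_norm_def)
qed

lemma Lp_space_inftyI:
  assumes u: "u \<in> borel_measurable (lebesgue_on \<Omega>)" and B: "0 \<le> B"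
    and le: "AE x in lebesgue_on \<Omega>. \<bar>u x\<bar> \<le> B"
  shows "u \<in> Lp_space \<infinity> \<Omega>" "Lp_norm \<infinity> \<Omega> u \<le> B"
proof -
  have e: "esssup (lebesgue_on \<Omega>) (\<lambda>x. ennreal \<bar>u x\<bar>) \<le> ennreal B"
    using u le by (intro esssup_I) (auto elim!: eventually_mono intro: ennreal_leI)
  then show "u \<in> Lp_space \<infinity> \<Omega>" using u by (auto simp: Lp_space_def intro: order_le_less_trans)
  show "Lp_norm \<infinity> \<Omega> u \<le> B" using e B by (auto simp: Lp_norm_def intro: enn2real_leI)
qed

context
  fixes \<Omega> :: "(real^'n) set" and s \<gamma> :: real
  assumes s: "0 < s" "s < 1" and \<gamma>: "0 < \<gamma>"
    and \<Omega>: "open \<Omega>" "bounded \<Omega>" "has_lipschitz_boundary \<Omega>"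
begin

text \<open>
  The added one makes this positive for every domain, and makes the factor \<open>1 / (6 * vol)\<close> of the
  critical case at most one.
\<close>

definition vol :: real where "vol = measure lborel \<Omega> + 1"

lemma vol: "1 \<le> vol" "0 < vol" "emeasure lborel \<Omega> \<le> ennreal vol"
proof -
  show "1 \<le> vol" "0 < vol" by (auto simp: vol_def add_nonneg_pos)
  have "emeasure lborel \<Omega> = ennreal (measure lborel \<Omega>)"
    using emeasure_bounded_finite[OF \<Omega>(2)] by (intro emeasure_eq_ennreal_measure) auto
  also have "\<dots> \<le> ennreal vol" by (intro ennreal_leI) (simp add: vol_def)
  finally show "emeasure lborel \<Omega> \<le> ennreal vol" .
qed

lemma \<Omega>_lebesgue: "\<Omega> \<in> sets lebesgue"
  using \<Omega>(1) by auto

lemma integrable_indicator_domain: "integrable lborel (indicator \<Omega> :: _ \<Rightarrow> real)"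
  using \<Omega>(1) emeasure_bounded_finite[OF \<Omega>(2)] by (simp add: integrable_indicator_iff)

definition solves :: "ereal \<Rightarrow> (real^'n \<Rightarrow> real) \<Rightarrow> (real^'n \<Rightarrow> real) \<Rightarrow> bool" where
  "solves p f u \<longleftrightarrow> f \<in> Lp_space p \<Omega> \<and> (AE x in lebesgue. x \<in> \<Omega> \<longrightarrow> f x \<ge> 0) \<and>
     u \<in> X0 s \<Omega> \<and> weak_solution s \<gamma> f \<Omega> u"

lemma solves_measurable: "solves p f u \<Longrightarrow> u \<in> borel_measurable (lebesgue_on \<Omega>)"
  by (auto simp: solves_def weak_solution_def Lp_space_def)

lemma solves_representative:
  assumes "solves p f u"
  obtains u' f' where
    "weak_form s (frac_laplace_const CARD('n) s / 2) \<Omega> u' (\<lambda>x. f' x / u' x powr \<gamma>)"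
    "\<And>x. 0 \<le> u' x" "\<And>x. x \<notin> \<Omega> \<Longrightarrow> u' x = 0" "AE x in lborel. u x = u' x"
    "f' \<in> borel_measurable borel" "\<And>x. 0 \<le> f' x" "\<And>x. x \<notin> \<Omega> \<Longrightarrow> f' x = 0"
    "AE x in lborel. x \<in> \<Omega> \<longrightarrow> f x = f' x"
proof (rule weak_solution_representative[OF s \<Omega>])
  show "f \<in> borel_measurable (lebesgue_on \<Omega>)" "AE x in lebesgue. x \<in> \<Omega> \<longrightarrow> 0 \<le> f x"
    "u \<in> X0 s \<Omega>" "weak_solution s \<gamma> f \<Omega> u"
    using assms by (auto simp: solves_def Lp_space_def)
qed (rule that)

text \<open>
  Since \<open>\<Omega>\<close> is bounded, the data are integrable along with their \<open>r\<close>-th power.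
\<close>

lemma solves_finite_exponent:
  fixes r :: real
  assumes r: "1 < r" and sol: "solves (ereal r) f u"
  obtains u' f' where
    "singular_solution s (frac_laplace_const CARD('n) s / 2) \<Omega> u' (\<lambda>x. f' x / u' x powr \<gamma>) \<gamma> f'"
    "\<And>x. x \<notin> \<Omega> \<Longrightarrow> u' x = 0" "AE x in lborel. u x = u' x"
    "integrable lborel (\<lambda>x. f' x powr r)"
    "Lp_norm (ereal r) \<Omega> f = (\<integral>x. f' x powr r \<partial>lborel) powr (1 / r)"
proof (rule solves_representative[OF sol])
  fix u' f' :: "real^'n \<Rightarrow> real"
  assume wf: "weak_form s (frac_laplace_const CARD('n) s / 2) \<Omega> u' (\<lambda>x. f' x / u' x powr \<gamma>)"
    and u': "\<And>x. 0 \<le> u' x" "\<And>x. x \<notin> \<Omega> \<Longrightarrow> u' x = 0" "AE x in lborel. u x = u' x"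
    and f': "f' \<in> borel_measurable borel" "\<And>x. 0 \<le> f' x" "\<And>x. x \<notin> \<Omega> \<Longrightarrow> f' x = 0"
      "AE x in lborel. x \<in> \<Omega> \<longrightarrow> f x = f' x"
  have [measurable]: "f' \<in> borel_measurable borel" by (rule f'(1))
  have fi: "integrable (lebesgue_on \<Omega>) (\<lambda>x. \<bar>f x\<bar> powr r)"
    using sol by (simp add: solves_def Lp_space_def)
  have eq: "(\<integral>\<^sup>+x. ennreal (\<bar>f x\<bar> powr r) \<partial>lebesgue_on \<Omega>) = (\<integral>\<^sup>+x. ennreal (f' x powr r) \<partial>lborel)"
    using nn_integral_lebesgue_on_eq[OF \<Omega>_lebesgue f'(4), of "\<lambda>t. \<bar>t\<bar> powr r"] f'(2,3) by simp
  have fr: "integrable lborel (\<lambda>x. f' x powr r)"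
  proof (rule integrableI_bounded)
    show "(\<integral>\<^sup>+x. ennreal (norm (f' x powr r)) \<partial>lborel) < \<infinity>"
      by (simp add: eq[symmetric] nn_integral_eq_integral[OF fi])
  qed measurable
  have "ennreal (\<integral>x. \<bar>f x\<bar> powr r \<partial>lebesgue_on \<Omega>) = ennreal (\<integral>x. f' x powr r \<partial>lborel)"
    using eq nn_integral_eq_integral[OF fi] nn_integral_eq_integral[OF fr] by simp
  then have norm: "Lp_norm (ereal r) \<Omega> f = (\<integral>x. f' x powr r \<partial>lborel) powr (1 / r)"
    by (simp add: Lp_norm_def integral_nonneg_AE)
  have f1: "integrable lborel f'"
  proof (rule Bochner_Integration.integrable_bound[OF Bochner_Integration.integrable_add[OF integrable_indicator_domain fr]])
    show "AE x in lborel. norm (f' x) \<le> norm (indicator \<Omega> x + f' x powr r)"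
    proof (rule AE_I2)
      fix x
      show "norm (f' x) \<le> norm (indicator \<Omega> x + f' x powr r)"
        using le_add_powr[of "f' x" 1 r] f'(2,3)[of x] r by (cases "x \<in> \<Omega>") auto
    qed
  qed measurable
  have "singular_solution s (frac_laplace_const CARD('n) s / 2) \<Omega> u' (\<lambda>x. f' x / u' x powr \<gamma>) \<gamma> f'"
    by (intro singular_solution.intro wf singular_solution_axioms.intro \<gamma> f1 f'(2) u'(1,2) refl)
  then show thesis by (rule that[OF _ u'(2,3) fr norm])
qed

lemma subcritical_regularity:
  fixes r :: real
  assumes r: "1 < r" "r < CARD('n) / (2 * s)"
  shows "\<exists>C>0. \<forall>f u. solves (ereal r) f u \<longrightarrow>
    u \<in> Lp_space (ereal (CARD('n) * r * (\<gamma> + 1) / (CARD('n) - 2 * s * r))) \<Omega> \<and>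
    Lp_norm (ereal (CARD('n) * r * (\<gamma> + 1) / (CARD('n) - 2 * s * r))) \<Omega> u
      \<le> C * Lp_norm (ereal r) \<Omega> f powr (1 / (\<gamma> + 1))"
proof -
  define c where "c = frac_laplace_const CARD('n) s / 2"
  define \<beta> where "\<beta> = 1 / r - 2 * s / CARD('n)"
  define q where "q = (\<gamma> + 1) / \<beta>"
  have \<beta>: "0 < \<beta>" using r s by (simp add: \<beta>_def field_simps)
  have q: "0 < q" using \<beta> \<gamma> by (simp add: q_def)
  have q_eq: "CARD('n) * r * (\<gamma> + 1) / (CARD('n) - 2 * s * r) = q"
  proof -
    have "\<beta> = (CARD('n) - 2 * s * r) / (CARD('n) * r)" using r by (simp add: \<beta>_def field_simps)
    then show ?thesis by (simp add: q_def mult.commute)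
  qed
  define K where "K = max 0 (2 * vol * subcritical_const (step_const CARD('n) s c \<gamma>) vol r \<beta>)"
  have "u \<in> Lp_space (ereal q) \<Omega> \<and>
      Lp_norm (ereal q) \<Omega> u \<le> (K powr (1 / q) + 1) * Lp_norm (ereal r) \<Omega> f powr (1 / (\<gamma> + 1))"
    if sol: "solves (ereal r) f u" for f u
  proof (rule solves_finite_exponent[OF r(1) sol])
    fix u' f' :: "real^'n \<Rightarrow> real"
    assume ss: "singular_solution s (frac_laplace_const CARD('n) s / 2) \<Omega> u' (\<lambda>x. f' x / u' x powr \<gamma>) \<gamma> f'"
      and u': "\<And>x. x \<notin> \<Omega> \<Longrightarrow> u' x = 0" "AE x in lborel. u x = u' x"
      and fr: "integrable lborel (\<lambda>x. f' x powr r)"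
      and norm: "Lp_norm (ereal r) \<Omega> f = (\<integral>x. f' x powr r \<partial>lborel) powr (1 / r)"
    interpret singular_solution s c \<Omega> u' "\<lambda>x. f' x / u' x powr \<gamma>" \<gamma> f'
      using ss unfolding c_def .
    let ?E = "\<integral>x. f' x powr r \<partial>lborel"
    have "(\<integral>\<^sup>+x. ennreal (\<bar>u x\<bar> powr q) \<partial>lebesgue_on \<Omega>) = (\<integral>\<^sup>+x. ennreal (\<bar>u' x\<bar> powr q) \<partial>lborel)"
      using u' by (intro nn_integral_lebesgue_on_eq[OF \<Omega>_lebesgue]) (auto elim!: eventually_mono)
    also have "\<dots> = (\<integral>\<^sup>+x. ennreal (u' x powr ((\<gamma> + 1) / \<beta>)) \<partial>lborel)"
      using u_nonneg by (simp add: q_def)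
    also have "\<dots> \<le> ennreal (2 * vol * (subcritical_const (step_const CARD('n) s c \<gamma>) vol r \<beta> * ?E powr (1 / (\<beta> * r))))"
      by (rule subcritical_integral_bound[OF vol(2,3) r(1) fr \<beta>_def \<beta>])
    also have "\<dots> \<le> ennreal (K * ?E powr (1 / (\<beta> * r)))"
      unfolding K_def mult.assoc[symmetric] by (intro ennreal_leI mult_right_mono) auto
    finally have le: "(\<integral>\<^sup>+x. ennreal (\<bar>u x\<bar> powr q) \<partial>lebesgue_on \<Omega>) \<le> ennreal (K * ?E powr (1 / (\<beta> * r)))" .
    have K0: "0 \<le> K" by (simp add: K_def)
    have "(K * ?E powr (1 / (\<beta> * r))) powr (1 / q) = K powr (1 / q) * (?E powr (1 / (\<beta> * r))) powr (1 / q)"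
      using K0 by (simp add: powr_mult)
    also have "(?E powr (1 / (\<beta> * r))) powr (1 / q) = Lp_norm (ereal r) \<Omega> f powr (1 / (\<gamma> + 1))"
      using \<beta> by (simp add: norm powr_powr q_def mult.commute)
    also have "K powr (1 / q) * \<dots> \<le> (K powr (1 / q) + 1) * \<dots>" by (intro mult_right_mono) auto
    finally show ?thesis
      using Lp_space_finiteI[OF solves_measurable[OF sol] q _ le] K0 by (auto intro: order_trans)
  qed
  then show ?thesis unfolding q_eq by (intro exI[of _ "K powr (1 / q) + 1"]) (auto simp: add_nonneg_pos)
qed

text \<open>
  Each \<open>k\<close> above the claimed bound has modular at most one; taking the infimum over such \<open>k\<close> covers the
  case of vanishing data, in which the bound itself is zero.
\<close>

lemma critical_regularity:
  fixes r p' :: real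
  assumes r: "1 < r" "r = CARD('n) / (2 * s)" and p': "p' = r / (r - 1)"
    and \<Phi>: "\<Phi> = (\<lambda>t::real. exp (\<bar>t\<bar> powr ((\<gamma> + 1) * p')) - 1)"
  shows "\<exists>C>0. \<forall>f u. solves (ereal r) f u \<longrightarrow>
    u \<in> orlicz_space \<Phi> \<Omega> \<and> luxemburg_norm \<Phi> \<Omega> u \<le> C * Lp_norm (ereal r) \<Omega> f powr (1 / (\<gamma> + 1))"
proof -
  define c where "c = frac_laplace_const CARD('n) s / 2"
  have crit: "2 * s / CARD('n) = 1 / r" using r s by simp
  \<comment> \<open>Six times the volume is the sum of the series that bounds the modular for \<open>\<theta> = 1\<close>.\<close>
  define \<theta> where "\<theta> = 1 / (6 * vol)"
  have \<theta>: "0 < \<theta>" "\<theta> \<le> 1" "6 * vol * \<theta> \<le> 1" using vol by (auto simp: \<theta>_def)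
  define D where "D = (\<theta> * ln (3 / 2)) powr (1 / p')"
  have D: "0 < D" using \<theta> by (simp add: D_def)
  define K where "K = step_const CARD('n) s c \<gamma> * 2 * (level_sum_const r + 1) powr (1 / r)"
  define C where "C = (\<bar>K\<bar> / D) powr (1 / (\<gamma> + 1)) + 1"
  have C: "0 < C" by (simp add: C_def add_nonneg_pos)
  have CK: "K \<le> D * C powr (\<gamma> + 1)"
  proof -
    have "\<bar>K\<bar> / D = ((\<bar>K\<bar> / D) powr (1 / (\<gamma> + 1))) powr (\<gamma> + 1)" using \<gamma> D by (simp add: powr_powr)
    also have "\<dots> \<le> C powr (\<gamma> + 1)" using \<gamma> by (intro powr_mono2) (auto simp: C_def)
    finally have "\<bar>K\<bar> \<le> D * C powr (\<gamma> + 1)" using D by (simp add: divide_le_eq mult.commute)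
    then show ?thesis by simp
  qed
  have "u \<in> orlicz_space \<Phi> \<Omega> \<and> luxemburg_norm \<Phi> \<Omega> u \<le> C * Lp_norm (ereal r) \<Omega> f powr (1 / (\<gamma> + 1))"
    if sol: "solves (ereal r) f u" for f u
  proof (rule solves_finite_exponent[OF r(1) sol])
    fix u' f' :: "real^'n \<Rightarrow> real"
    assume ss: "singular_solution s (frac_laplace_const CARD('n) s / 2) \<Omega> u' (\<lambda>x. f' x / u' x powr \<gamma>) \<gamma> f'"
      and u': "\<And>x. x \<notin> \<Omega> \<Longrightarrow> u' x = 0" "AE x in lborel. u x = u' x"
      and fr: "integrable lborel (\<lambda>x. f' x powr r)"
      and norm: "Lp_norm (ereal r) \<Omega> f = (\<integral>x. f' x powr r \<partial>lborel) powr (1 / r)"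
    interpret singular_solution s c \<Omega> u' "\<lambda>x. f' x / u' x powr \<gamma>" \<gamma> f'
      using ss unfolding c_def .
    define X where "X = Lp_norm (ereal r) \<Omega> f powr (1 / (\<gamma> + 1))"
    have X: "0 \<le> X" "X powr (\<gamma> + 1) = (\<integral>x. f' x powr r \<partial>lborel) powr (1 / r)"
      using \<gamma> by (auto simp: X_def norm powr_powr)
    have modular: "(\<integral>\<^sup>+x. ennreal (\<Phi> (u x / k)) \<partial>lebesgue_on \<Omega>) \<le> 1" if k: "0 < k" "C * X \<le> k" for k
    proof -
      have "K * (\<integral>x. f' x powr r \<partial>lborel) powr (1 / r) \<le> (D * C powr (\<gamma> + 1)) * X powr (\<gamma> + 1)"
        unfolding X(2) by (intro mult_right_mono CK) simp
      also have "\<dots> = D * (C * X) powr (\<gamma> + 1)" using C X by (simp add: powr_mult)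
      also have "\<dots> \<le> D * k powr (\<gamma> + 1)"
        using D C X k \<gamma> by (intro mult_left_mono powr_mono2) auto
      finally have le: "K * (\<integral>x. f' x powr r \<partial>lborel) powr (1 / r) \<le> D * k powr (\<gamma> + 1)" .
      have "(\<integral>\<^sup>+x. ennreal (\<Phi> (u x / k)) \<partial>lebesgue_on \<Omega>) = (\<integral>\<^sup>+x. ennreal (\<Phi> (u' x / k)) \<partial>lborel)"
        using u' by (intro nn_integral_lebesgue_on_eq[OF \<Omega>_lebesgue]) (auto elim!: eventually_mono simp: \<Phi>)
      also have "\<dots> \<le> 1"
        unfolding \<Phi>
        by (rule critical_exponential_bound[OF vol(2,3) r(1) fr crit k(1) \<theta> p' le[unfolded K_def D_def]])
      finally show ?thesis .
    qed
    have "luxemburg_norm \<Phi> \<Omega> u \<le> C * X"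
    proof (rule field_le_epsilon)
      fix e :: real assume e: "0 < e"
      have k: "0 < C * X + e" using C X e by (simp add: add_nonneg_pos)
      show "luxemburg_norm \<Phi> \<Omega> u \<le> C * X + e"
        unfolding luxemburg_norm_def
        using modular[OF k] k e by (intro cInf_lower) (auto intro!: bdd_belowI[of _ 0])
    qed
    moreover have "u \<in> orlicz_space \<Phi> \<Omega>"
      unfolding orlicz_space_def
    proof (intro CollectI conjI solves_measurable[OF sol] exI[of _ "C * X + 1"])
      show k: "0 < C * X + 1" using C X by (simp add: add_nonneg_pos)
      show "(\<integral>\<^sup>+x. ennreal (\<Phi> (u x / (C * X + 1))) \<partial>lebesgue_on \<Omega>) < \<infinity>"
        using modular[OF k] by (auto intro: order_le_less_trans)
    qed
    ultimately show ?thesis by (simp add: X_def)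
  qed
  then show ?thesis using C by blast
qed

definition sup_const :: "real \<Rightarrow> real" where
  "sup_const P = step_const CARD('n) s (frac_laplace_const CARD('n) s / 2) \<gamma> * vol powr (P - (1 - 2 * s / CARD('n)))
    / (1 - 2 powr (- (P - (1 - 2 * s / CARD('n)))))"

text \<open>
  The bound depends on the data only through the rate at which their mass on small sets decays.
\<close>

lemma bounded_of_representative:
  assumes ss: "singular_solution s (frac_laplace_const CARD('n) s / 2) \<Omega> u' (\<lambda>x. f' x / u' x powr \<gamma>) \<gamma> f'"
    and u': "AE x in lborel. u x = u' x" and um: "u \<in> borel_measurable (lebesgue_on \<Omega>)"
    and P: "1 - 2 * s / CARD('n) < P" and Q: "0 \<le> Q"
    and mass: "\<And>j. singular_solution.mass u' f' vol j \<le> Q * (vol / 2 ^ j) powr P"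
  shows "u \<in> Lp_space \<infinity> \<Omega>" "Lp_norm \<infinity> \<Omega> u \<le> sup_const P powr (1 / (\<gamma> + 1)) * Q powr (1 / (\<gamma> + 1))"
proof -
  interpret singular_solution s "frac_laplace_const CARD('n) s / 2" \<Omega> u' "\<lambda>x. f' x / u' x powr \<gamma>" \<gamma> f'
    by (rule ss)
  have "2 powr (- (P - (1 - 2 * s / CARD('n)))) < 2 powr (0::real)" using P by (intro powr_less_mono) auto
  then have K: "0 \<le> sup_const P"
    unfolding sup_const_def by (intro divide_nonneg_nonneg mult_nonneg_nonneg step_const_nonneg[OF vol(2,3)]) auto
  have "AE x in lborel. u' x \<le> (sup_const P * Q) powr (1 / (\<gamma> + 1))"
    unfolding sup_const_def by (rule bounded_of_mass_decay[OF vol(2,3) P Q mass])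
  with u' have "AE x in lborel. \<bar>u x\<bar> \<le> (sup_const P * Q) powr (1 / (\<gamma> + 1))"
    by eventually_elim (use u_nonneg in auto)
  then have "AE x in lebesgue_on \<Omega>. \<bar>u x\<bar> \<le> (sup_const P * Q) powr (1 / (\<gamma> + 1))"
    using \<Omega>_lebesgue by (subst AE_restrict_space_iff) (auto simp: AE_completion_iff elim!: eventually_mono)
  from Lp_space_inftyI[OF um _ this]
  show "u \<in> Lp_space \<infinity> \<Omega>" "Lp_norm \<infinity> \<Omega> u \<le> sup_const P powr (1 / (\<gamma> + 1)) * Q powr (1 / (\<gamma> + 1))"
    using K Q by (simp_all add: powr_mult)
qed

lemma supercritical_regularity_finite:
  fixes r :: real
  assumes r: "1 < r" "CARD('n) / (2 * s) < r"
  shows "\<exists>C>0. \<forall>f u. solves (ereal r) f u \<longrightarrow>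
    u \<in> Lp_space \<infinity> \<Omega> \<and> Lp_norm \<infinity> \<Omega> u \<le> C * Lp_norm (ereal r) \<Omega> f powr (1 / (\<gamma> + 1))"
proof -
  have P: "1 - 2 * s / CARD('n) < 1 - 1 / r" using r s by (simp add: field_simps)
  define C where "C = sup_const (1 - 1 / r) powr (1 / (\<gamma> + 1)) * 2 powr (1 / (\<gamma> + 1))"
  have "u \<in> Lp_space \<infinity> \<Omega> \<and> Lp_norm \<infinity> \<Omega> u \<le> (C + 1) * Lp_norm (ereal r) \<Omega> f powr (1 / (\<gamma> + 1))"
    if sol: "solves (ereal r) f u" for f u
  proof (rule solves_finite_exponent[OF r(1) sol])
    fix u' f' :: "real^'n \<Rightarrow> real"
    assume ss: "singular_solution s (frac_laplace_const CARD('n) s / 2) \<Omega> u' (\<lambda>x. f' x / u' x powr \<gamma>) \<gamma> f'"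
      and u': "\<And>x. x \<notin> \<Omega> \<Longrightarrow> u' x = 0" "AE x in lborel. u x = u' x"
      and fr: "integrable lborel (\<lambda>x. f' x powr r)"
      and norm: "Lp_norm (ereal r) \<Omega> f = (\<integral>x. f' x powr r \<partial>lborel) powr (1 / r)"
    have F: "singular_solution.mass u' f' vol j \<le> (2 * Lp_norm (ereal r) \<Omega> f) * (vol / 2 ^ j) powr (1 - 1 / r)" for j
      using singular_solution.mass_le[OF ss vol(2,3) r(1) fr] by (simp add: norm mult.assoc)
    have n0: "0 \<le> Lp_norm (ereal r) \<Omega> f" by (simp add: norm)
    have "(2 * Lp_norm (ereal r) \<Omega> f) powr (1 / (\<gamma> + 1)) = 2 powr (1 / (\<gamma> + 1)) * Lp_norm (ereal r) \<Omega> f powr (1 / (\<gamma> + 1))"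
      using n0 by (simp add: powr_mult)
    then have "Lp_norm \<infinity> \<Omega> u \<le> C * Lp_norm (ereal r) \<Omega> f powr (1 / (\<gamma> + 1))"
      using bounded_of_representative(2)[OF ss u'(2) solves_measurable[OF sol] P _ F] n0
      by (simp add: C_def mult.assoc)
    also have "\<dots> \<le> (C + 1) * Lp_norm (ereal r) \<Omega> f powr (1 / (\<gamma> + 1))" by (intro mult_right_mono) auto
    finally show ?thesis
      using bounded_of_representative(1)[OF ss u'(2) solves_measurable[OF sol] P _ F] n0 by simp
  qed
  then show ?thesis by (intro exI[of _ "C + 1"]) (auto simp: C_def add_nonneg_pos)
qed

lemma supercritical_regularity_infinite:
  shows "\<exists>C>0. \<forall>f u. solves \<infinity> f u \<longrightarrow>
    u \<in> Lp_space \<infinity> \<Omega> \<and> Lp_norm \<infinity> \<Omega> u \<le> C * Lp_norm \<infinity> \<Omega> f powr (1 / (\<gamma> + 1))"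
proof -
  have P: "1 - 2 * s / CARD('n) < 1" using s by simp
  define C where "C = sup_const 1 powr (1 / (\<gamma> + 1))"
  have "u \<in> Lp_space \<infinity> \<Omega> \<and> Lp_norm \<infinity> \<Omega> u \<le> (C + 1) * Lp_norm \<infinity> \<Omega> f powr (1 / (\<gamma> + 1))"
    if sol: "solves \<infinity> f u" for f u
  proof (rule solves_representative[OF sol])
    fix u' f' :: "real^'n \<Rightarrow> real"
    assume wf: "weak_form s (frac_laplace_const CARD('n) s / 2) \<Omega> u' (\<lambda>x. f' x / u' x powr \<gamma>)"
      and u': "\<And>x. 0 \<le> u' x" "\<And>x. x \<notin> \<Omega> \<Longrightarrow> u' x = 0" "AE x in lborel. u x = u' x"
      and f': "f' \<in> borel_measurable borel" "\<And>x. 0 \<le> f' x" "\<And>x. x \<notin> \<Omega> \<Longrightarrow> f' x = 0"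
        "AE x in lborel. x \<in> \<Omega> \<longrightarrow> f x = f' x"
    have [measurable]: "f' \<in> borel_measurable borel" by (rule f'(1))
    define B where "B = Lp_norm \<infinity> \<Omega> f"
    have B0: "0 \<le> B" by (simp add: B_def Lp_norm_def)
    have "esssup (lebesgue_on \<Omega>) (\<lambda>x. ennreal \<bar>f x\<bar>) = ennreal B"
      using sol by (simp add: B_def Lp_norm_def solves_def Lp_space_def less_top)
    then have "AE x in lebesgue_on \<Omega>. ennreal \<bar>f x\<bar> \<le> ennreal B"
      using esssup_AE[where M = "lebesgue_on \<Omega>" and f = "\<lambda>x. ennreal \<bar>f x\<bar>"] by simp
    then have "AE x in lborel. x \<in> \<Omega> \<longrightarrow> \<bar>f x\<bar> \<le> B"
      using \<Omega>_lebesgue B0 by (subst (asm) AE_restrict_space_iff) (auto simp: AE_completion_iff)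
    then have fB: "AE x in lborel. f' x \<le> B"
      using f'(4) by eventually_elim (use f'(2,3) B0 in force)
    have f1: "integrable lborel f'"
    proof (rule Bochner_Integration.integrable_bound[OF integrable_mult_right[OF integrable_indicator_domain, of B]])
      show "AE x in lborel. norm (f' x) \<le> norm (B * indicator \<Omega> x)"
        using fB by eventually_elim (use f'(2,3) B0 in \<open>auto simp: indicator_def\<close>)
    qed measurable
    have ss: "singular_solution s (frac_laplace_const CARD('n) s / 2) \<Omega> u' (\<lambda>x. f' x / u' x powr \<gamma>) \<gamma> f'"
      by (intro singular_solution.intro wf singular_solution_axioms.intro \<gamma> f1 f'(2) u'(1,2) refl)
    interpret singular_solution s "frac_laplace_const CARD('n) s / 2" \<Omega> u' "\<lambda>x. f' x / u' x powr \<gamma>" \<gamma> f'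
      by (rule ss)
    have F: "mass vol j \<le> B * (vol / 2 ^ j) powr 1" for j
    proof -
      let ?A = "{x. level vol j < u' x}"
      have em: "emeasure lborel ?A \<le> ennreal (vol / 2 ^ j)" by (rule emeasure_above_level[OF vol(2,3)])
      have iA: "integrable lborel (indicator ?A :: _ \<Rightarrow> real)"
        using em by (auto simp: integrable_indicator_iff intro: order_le_less_trans)
      have "mass vol j \<le> (\<integral>x. B * indicator ?A x \<partial>lborel)"
        unfolding mass_def[OF vol(2,3)]
        by (intro integral_mono_AE integrable_f_level integrable_mult_right iA)
          (use fB in eventually_elim, auto simp: indicator_def)
      also have "\<dots> = B * measure lborel ?A" by simp
      also have "\<dots> \<le> B * (vol / 2 ^ j)"
        using em vol(2) by (intro mult_left_mono B0) (simp add: measure_def enn2real_leI)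
      finally show ?thesis using vol(2) by simp
    qed
    have "Lp_norm \<infinity> \<Omega> u \<le> C * Lp_norm \<infinity> \<Omega> f powr (1 / (\<gamma> + 1))"
      using bounded_of_representative(2)[OF ss u'(3) solves_measurable[OF sol] P B0 F] by (simp add: C_def B_def)
    also have "\<dots> \<le> (C + 1) * Lp_norm \<infinity> \<Omega> f powr (1 / (\<gamma> + 1))" by (intro mult_right_mono) auto
    finally show ?thesis
      using bounded_of_representative(1)[OF ss u'(3) solves_measurable[OF sol] P B0 F] by simp
  qed
  then show ?thesis by (intro exI[of _ "C + 1"]) (auto simp: C_def add_nonneg_pos)
qed

end

theorem theorem5p1:
  fixes \<Omega> :: "(real ^ 'n) set" and s \<gamma> :: real and p :: ereal
  assumes "0 < s" "s < 1" "2 \<le> CARD('n)" "0 < \<gamma>"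
    and "open \<Omega>" "bounded \<Omega>" "has_lipschitz_boundary \<Omega>"
    and "p \<ge> ereal (2 * real CARD('n) / (real CARD('n) - 2 * s))"
  shows
    "let N = real CARD('n); r = real_of_ereal p in
      (p < ereal (N / (2 * s)) \<longrightarrow>
        (\<exists>C>0. \<forall>f u.
           f \<in> Lp_space p \<Omega> \<and> (AE x in lebesgue. x \<in> \<Omega> \<longrightarrow> f x \<ge> 0) \<and>
           u \<in> X0 s \<Omega> \<and> weak_solution s \<gamma> f \<Omega> u \<longrightarrow>
             (let q = ereal (N * r * (\<gamma> + 1) / (N - 2 * s * r)) in
               u \<in> Lp_space q \<Omega> \<and>
               Lp_norm q \<Omega> u \<le> C * Lp_norm p \<Omega> f powr (1 / (\<gamma> + 1))))) \<and>
      (p = ereal (N / (2 * s)) \<longrightarrow>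
        (\<exists>C>0. \<forall>f u.
           f \<in> Lp_space p \<Omega> \<and> (AE x in lebesgue. x \<in> \<Omega> \<longrightarrow> f x \<ge> 0) \<and>
           u \<in> X0 s \<Omega> \<and> weak_solution s \<gamma> f \<Omega> u \<longrightarrow>
             (let p' = r / (r - 1); \<Phi> = (\<lambda>t::real. exp (\<bar>t\<bar> powr ((\<gamma> + 1) * p')) - 1) in
               u \<in> orlicz_space \<Phi> \<Omega> \<and>
               luxemburg_norm \<Phi> \<Omega> u \<le> C * Lp_norm p \<Omega> f powr (1 / (\<gamma> + 1))))) \<and>
      (p > ereal (N / (2 * s)) \<longrightarrow>
        (\<exists>C>0. \<forall>f u.
           f \<in> Lp_space p \<Omega> \<and> (AE x in lebesgue. x \<in> \<Omega> \<longrightarrow> f x \<ge> 0) \<and>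
           u \<in> X0 s \<Omega> \<and> weak_solution s \<gamma> f \<Omega> u \<longrightarrow>
             u \<in> Lp_space \<infinity> \<Omega> \<and>
             Lp_norm \<infinity> \<Omega> u \<le> C * Lp_norm p \<Omega> f powr (1 / (\<gamma> + 1))))"
proof -
  note dom = assms(1,2,4,5,6,7)
  have "0 < real CARD('n) - 2 * s" using assms(2,3) by linarith
  then have "2 \<le> 2 * real CARD('n) / (real CARD('n) - 2 * s)" using assms(1) by (simp add: pos_le_divide_eq)
  then have "ereal 2 \<le> p" using assms(8) by (metis ereal_less_eq(3) order_trans)
  then consider (fin) r where "p = ereal r" "1 < r" | (inf) "p = \<infinity>"
    by (cases p) auto
  then show ?thesis
  proof cases
    case fin
    show ?thesis
      using subcritical_regularity[OF dom fin(2)] critical_regularity[OF dom fin(2) _ refl refl]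
        supercritical_regularity_finite[OF dom fin(2)]
      unfolding Let_def fin(1) real_of_ereal.simps(1) solves_def[OF dom] less_ereal.simps(1) ereal.inject
      by blast
  next
    case inf
    have "\<exists>C>0. \<forall>f u. f \<in> Lp_space \<infinity> \<Omega> \<and> (AE x in lebesgue. x \<in> \<Omega> \<longrightarrow> f x \<ge> 0) \<and>
           u \<in> X0 s \<Omega> \<and> weak_solution s \<gamma> f \<Omega> u \<longrightarrow>
             u \<in> Lp_space \<infinity> \<Omega> \<and> Lp_norm \<infinity> \<Omega> u \<le> C * Lp_norm \<infinity> \<Omega> f powr (1 / (\<gamma> + 1))"
      using supercritical_regularity_infinite[OF dom] unfolding solves_def[OF dom] .
    then show ?thesis unfolding Let_def inf by simp
  qed
qed

end
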